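(* Let $n\ge2$ and let $\mathcal F$ be an isoparametric foliation of the round unit sphere $\mathbb S^n$ whose number $g$ of distinct principal curvatures satisfies $g\neq1$. Then every isoparametric tube $\Omega_t$, $t\in(0,D(\mathcal F))$, of $\mathcal F$ fails the Pompeiu property.
   Context: $\mathbb S^n\subset\mathbb R^{n+1}$ is the unit sphere with its round metric, and $\Delta=-\mathrm{div}\,\nabla$ is its positive Laplacian. An isoparametric function on $\mathbb S^n$ is a smooth function $F:\mathbb S^n\to[a,b]$ with $F(\mathbb S^n)=[a,b]$, $a<b$, such that $|\nabla F|^2=A\circ F$ and $\Delta F=B\circ F$ for some smooth functions $A,B:[a,b]\to\mathbb R$. The sets $M^+:=F^{-1}(a)$ and $M^-:=F^{-1}(b)$ are smooth closed submanifolds, called the focal sets; $F$ is called proper if both focal sets have codimension at least $2$. All isoparametric functions are assumed proper. The isoparametric foliation $\mathcal F$ is the decomposition of $\mathbb S^n$ into level sets of $F$. Every regular level set $F^{-1}(t)$, $t\in(a,b)$, is a connected hypersurface with constant principal curvatures, and the number $g$ of distinct principal curvatures is the same for all regular level sets. Let $\rho(x)=\mathrm{dist}(x,M^+)$ and $D(\mathcal F)=\mathrm{dist}(M^+,M^-)$. For $t\in(0,D(\mathcal F))$ the isoparametric tube is $\Omega_t=\{x\in\mathbb S^n:\rho(x)<t\}$. A domain $\Omega\subseteq\mathbb S^n$ has the Pompeiu property if the only continuous function $f:\mathbb S^n\to\mathbb R$ with $\int_{h(\Omega)}f=0$ for all isometries $h$ of $\mathbb S^n$ (integration with respect to the Riemannian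 measure) is $f=0$; otherwise $\Omega$ fails the Pompeiu property. *)

theory Defs
  imports "HOL-Analysis.Analysis"
begin

section \<open>Smooth maps and submanifolds of Euclidean space\<close>

text \<open>\<open>Ck_on k U f\<close> is meant for open \<open>U\<close>.\<close>

primrec Ck_on ::
  "nat \<Rightarrow> 'a::euclidean_space set \<Rightarrow> ('a \<Rightarrow> 'b::real_normed_vector) \<Rightarrow> bool" where
  "Ck_on 0 U f \<longleftrightarrow> continuous_on U f"
| "Ck_on (Suc k) U f \<longleftrightarrow>
     f differentiable_on U \<and> (\<forall>v. Ck_on k U (\<lambda>x. frechet_derivative f (at x) v))"

text \<open>Smoothness on an arbitrary subset of Euclidean space means that the map extends locally to a
  smooth map on an open set.  For the sphere this is smoothness as a map on an embedded
  submanifold, for a compact interval it is smoothness up to the end points.\<close>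

definition smooth_on ::
  "'a::euclidean_space set \<Rightarrow> ('a \<Rightarrow> 'b::real_normed_vector) \<Rightarrow> bool" where
  "smooth_on S f \<longleftrightarrow>
     (\<forall>x\<in>S. \<exists>U G. open U \<and> x \<in> U \<and> (\<forall>k. Ck_on k U G) \<and> (\<forall>y\<in>U \<inter> S. G y = f y))"

text \<open>\<open>M\<close> is, near \<open>p\<close>, a smooth embedded \<open>d\<close>-dimensional submanifold of the ambient Euclidean
  space (slice chart).\<close>

definition submanifold_at :: "'a::euclidean_space set \<Rightarrow> 'a \<Rightarrow> nat \<Rightarrow> bool" where
  "submanifold_at M p d \<longleftrightarrow>
     (\<exists>U V \<phi> \<psi> W. open U \<and> open V \<and> p \<in> U \<and> homeomorphism U V \<phi> \<psi> \<and>
        smooth_on U \<phi> \<and> smooth_on V \<psi> \<and>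
        subspace W \<and> dim W = d \<and> \<phi> ` (M \<inter> U) = V \<inter> (W :: 'a set))"

text \<open>\<open>M\<close> is a smooth submanifold of the unit sphere, each component of which has codimension at
  least \<open>c\<close> in the sphere.  The sphere itself has dimension \<open>DIM('a) - 1\<close>.\<close>

definition sphere_codim_ge :: "'a::euclidean_space set \<Rightarrow> nat \<Rightarrow> bool" where
  "sphere_codim_ge M c \<longleftrightarrow>
     M \<subseteq> sphere 0 1 \<and> (\<forall>p\<in>M. \<exists>d. d + c + 1 \<le> DIM('a) \<and> submanifold_at M p d)"


section \<open>Calculus on the unit sphere\<close>

text \<open>Derivatives within the sphere are determined only on the tangent space, the orthogonal
  complement of \<open>x\<close>; all notions below use only their values there.\<close>

definition tangent_proj :: "'a::euclidean_space \<Rightarrow> 'a \<Rightarrow> 'a" where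
  "tangent_proj x v = v - (v \<bullet> x) *\<^sub>R x"

definition sphere_grad :: "('a::euclidean_space \<Rightarrow> real) \<Rightarrow> 'a \<Rightarrow> 'a" where
  "sphere_grad F x =
     (THE w. w \<bullet> x = 0 \<and> (F has_derivative (\<lambda>v. w \<bullet> v)) (at x within sphere 0 1))"

text \<open>The Levi-Civita derivative of the round metric is the tangential part of the ambient
  derivative.\<close>

definition sphere_cov_deriv :: "('a::euclidean_space \<Rightarrow> 'a) \<Rightarrow> 'a \<Rightarrow> 'a \<Rightarrow> 'a" where
  "sphere_cov_deriv X x v =
     tangent_proj x (frechet_derivative X (at x within sphere 0 1) v)"

text \<open>The divergence is the trace of the covariant derivative over the tangent space, written as
  the trace over the ambient space after projecting.\<close>

definition sphere_div :: "('a::euclidean_space \<Rightarrow> 'a) \<Rightarrow> 'a \<Rightarrow> real" where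
  "sphere_div X x = (\<Sum>b\<in>Basis. sphere_cov_deriv X x (tangent_proj x b) \<bullet> b)"

definition sphere_laplacian :: "('a::euclidean_space \<Rightarrow> real) \<Rightarrow> 'a \<Rightarrow> real" where
  "sphere_laplacian F x = - sphere_div (sphere_grad F) x"

text \<open>Riemannian (great circle) distance between unit vectors.\<close>

definition sphere_dist :: "'a::euclidean_space \<Rightarrow> 'a \<Rightarrow> real" where
  "sphere_dist x y = arccos (x \<bullet> y)"

definition sphere_isometry :: "('a::euclidean_space \<Rightarrow> 'a) \<Rightarrow> bool" where
  "sphere_isometry h \<longleftrightarrow> h ` sphere 0 1 = sphere 0 1 \<and>
     (\<forall>x\<in>sphere 0 1. \<forall>y\<in>sphere 0 1. sphere_dist (h x) (h y) = sphere_dist x y)"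

text \<open>Riemannian measure: by polar coordinates, the area of \<open>E\<close> is \<open>DIM('a)\<close> times the Lebesgue
  measure of the cone of all \<open>r *\<^sub>R x\<close> with \<open>0 < r < 1\<close> and \<open>x \<in> E\<close>.\<close>

definition sphere_measure :: "'a::euclidean_space measure" where
  "sphere_measure =
     scale_measure (of_nat DIM('a))
       (distr (restrict_space lborel (ball 0 1 - {0})) (restrict_space borel (sphere 0 1)) sgn)"


section \<open>Isoparametric functions\<close>

definition isoparametric :: "('a::euclidean_space \<Rightarrow> real) \<Rightarrow> real \<Rightarrow> real \<Rightarrow> bool" where
  "isoparametric F a b \<longleftrightarrow>
     a < b \<and> smooth_on (sphere 0 1) F \<and> F ` sphere 0 1 = {a..b} \<and>
     (\<exists>A B. smooth_on {a..b} A \<and> smooth_on {a..b} B \<and>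
        (\<forall>x\<in>sphere 0 1. (norm (sphere_grad F x))\<^sup>2 = A (F x) \<and>
                         sphere_laplacian F x = B (F x)))"

definition level_set :: "('a::euclidean_space \<Rightarrow> real) \<Rightarrow> real \<Rightarrow> 'a set" where
  "level_set F s = {x \<in> sphere 0 1. F x = s}"

definition proper_isoparametric ::
  "('a::euclidean_space \<Rightarrow> real) \<Rightarrow> real \<Rightarrow> real \<Rightarrow> bool" where
  "proper_isoparametric F a b \<longleftrightarrow> isoparametric F a b \<and>
     sphere_codim_ge (level_set F a) 2 \<and> sphere_codim_ge (level_set F b) 2"

definition unit_normal :: "('a::euclidean_space \<Rightarrow> real) \<Rightarrow> 'a \<Rightarrow> 'a" where
  "unit_normal F x = sgn (sphere_grad F x)"

text \<open>Eigenvalues, at \<open>x\<close>, of the shape operator of the level set through \<open>x\<close> as a hypersurface of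
  the sphere.\<close>

definition principal_curvatures :: "('a::euclidean_space \<Rightarrow> real) \<Rightarrow> 'a \<Rightarrow> real set" where
  "principal_curvatures F x =
     {\<kappa>. \<exists>v. v \<noteq> 0 \<and> v \<bullet> x = 0 \<and> v \<bullet> unit_normal F x = 0 \<and>
            - sphere_cov_deriv (unit_normal F) x v = \<kappa> *\<^sub>R v}"

definition num_principal_curvatures ::
  "('a::euclidean_space \<Rightarrow> real) \<Rightarrow> real \<Rightarrow> real \<Rightarrow> nat" where
  "num_principal_curvatures F a b =
     (THE g. \<forall>s\<in>{a<..<b}. \<forall>x\<in>level_set F s. card (principal_curvatures F x) = g)"

definition sphere_infdist :: "'a::euclidean_space \<Rightarrow> 'a set \<Rightarrow> real" where
  "sphere_infdist x M = (INF p\<in>M. sphere_dist x p)"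

definition focal_distance :: "('a::euclidean_space \<Rightarrow> real) \<Rightarrow> real \<Rightarrow> real \<Rightarrow> real" where
  "focal_distance F a b =
     (INF x\<in>level_set F b. sphere_infdist x (level_set F a))"

definition isoparametric_tube :: "('a::euclidean_space \<Rightarrow> real) \<Rightarrow> real \<Rightarrow> real \<Rightarrow> 'a set" where
  "isoparametric_tube F a t =
     {x \<in> sphere 0 1. sphere_infdist x (level_set F a) < t}"


section \<open>The Pompeiu property\<close>

definition pompeiu_property :: "'a::euclidean_space set \<Rightarrow> bool" where
  "pompeiu_property \<Omega> \<longleftrightarrow>
     (\<forall>f :: 'a \<Rightarrow> real. continuous_on (sphere 0 1) f \<longrightarrow>
        (\<forall>h. sphere_isometry h \<longrightarrow> (LINT x : h ` \<Omega> | sphere_measure. f x) = 0) \<longrightarrow>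
        (\<forall>x\<in>sphere 0 1. f x = 0))"

end

theory Submission
  imports Defs
begin

text \<open>A tube fails the Pompeiu property as soon as its centre of mass is the origin: the linear functions
  \<open>x \<mapsto> x \<bullet> p\<close> form a space invariant under isometries, so if all of them integrate to zero over one
  tube, a single one of them integrates to zero over every congruent copy.  It therefore suffices to
  show that the tubes have vanishing first moments, unless the foliation consists of parallel small
  spheres, in which case \<open>g = 1\<close>.

  Tubes are sublevel sets of \<open>F\<close>.  Let \<open>W s\<close> be the integral of \<open>1 / sqrt A\<close> from \<open>a\<close> to \<open>s\<close>.  A great
  circle crosses the levels at speed at most \<open>sqrt A\<close>, so \<open>W\<close> is finite, at most \<open>pi\<close>, and
  \<open>W (F x)\<close> is a lower bound for the distance of \<open>x\<close> to the focal set \<open>F = a\<close>; following the gradient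
  downhill gives the converse bound (\<open>distance_to_level_a\<close>).

  The gradient lines of \<open>F\<close> are great circles, by differentiating \<open>|grad F|\<^sup>2 = A o F\<close> and using the
  symmetry of the Hessian.  With \<open>w = W (F x)\<close> and the unit normal \<open>X\<close>, the foot point
  \<open>cos w x - sin w X\<close> and the initial direction \<open>sin w x + cos w X\<close> of the line through \<open>x\<close> are
  constant along it.  As the Laplacian of \<open>F\<close> depends on the value of \<open>F\<close> only, the flow distorts area
  by the same factor all over a level set, and the average over a level set of a function that is
  constant on the lines does not depend on the level (\<open>flow_average\<close>).  Solving for \<open>x\<close>, the average
  of \<open>x \<bullet> p\<close> over the level at distance \<open>w\<close> is \<open>\<alpha> cos w + \<beta> sin w\<close> with constants \<open>\<alpha>\<close>, \<open>\<beta>\<close>,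
  and that of \<open>X \<bullet> p\<close> is its derivative in \<open>w\<close>.

  Linear functions are eigenfunctions of the Laplacian with eigenvalue \<open>n\<close>.  Testing this with functions
  of \<open>F\<close> that are concentrated near one end of the range shows that the average of \<open>X \<bullet> p\<close> tends to
  zero there, because the focal sets are null sets (\<open>endpoint_flux_zero\<close>).  At the end \<open>a\<close> this gives
  \<open>\<beta> = 0\<close>, at the end \<open>b\<close> it gives \<open>\<alpha> sin (W b) = 0\<close>.  Hence either all averages vanish, and with
  them the first moments of the tubes, or \<open>W b = pi\<close>.  In the latter case the two focal sets are at
  distance \<open>pi\<close>, so they are antipodal points, \<open>cos (W (F x)) = x \<bullet> p\<close>, and the level sets are small
  spheres with exactly one principal curvature.

  All calculus takes place in Euclidean space without the origin: \<open>F\<close> is extended to be constant on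
  rays, and integrals over the sphere become integrals against radial weights with compact support.\<close>

section \<open>Continuously differentiable maps\<close>

lemma has_derivative_Ck_on:
  assumes "open U" "Ck_on (Suc k) U f" "x \<in> U"
  shows "(f has_derivative frechet_derivative f (at x)) (at x)"
proof -
  have "f differentiable (at x within U)"
    using assms(2,3) unfolding Ck_on.simps differentiable_on_def by blast
  then have "f differentiable (at x)"
    unfolding at_within_open[OF assms(3,1)] .
  then show ?thesis
    by (simp add: frechet_derivative_works)
qed

lemma Ck_on_cong:
  assumes "open U" "\<And>x. x \<in> U \<Longrightarrow> f x = g x" "Ck_on k U f"
  shows "Ck_on k U g"
  using assms(2,3)
proof (induction k arbitrary: f g)
  case 0
  then show ?case using continuous_on_cong[of U U f g] by simp
next
  case (Suc k)
  have der: "(g has_derivative frechet_derivative f (at x)) (at x)" if "x \<in> U" for x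
    using has_derivative_transform_within_open[OF has_derivative_Ck_on[OF assms(1) Suc.prems(2) that] assms(1) that]
      Suc.prems(1) by blast
  have "g differentiable_on U"
    unfolding differentiable_on_def differentiable_def
    using der has_derivative_at_withinI by blast
  moreover have "Ck_on k U (\<lambda>x. frechet_derivative g (at x) v)" for v
  proof (rule Suc.IH[of "\<lambda>x. frechet_derivative f (at x) v"])
    show "frechet_derivative f (at x) v = frechet_derivative g (at x) v" if "x \<in> U" for x
      using frechet_derivative_at[OF der[OF that]] by simp
    show "Ck_on k U (\<lambda>x. frechet_derivative f (at x) v)" using Suc.prems(2) by simp
  qed
  ultimately show ?case by simp
qed

lemma Ck_on_SucI:
  assumes "open U" "\<And>x. x \<in> U \<Longrightarrow> (f has_derivative f' x) (at x)"
    and "\<And>v. Ck_on k U (\<lambda>x. f' x v)"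
  shows "Ck_on (Suc k) U f"
proof -
  have "f differentiable_on U"
    unfolding differentiable_on_def differentiable_def
    using assms(2) has_derivative_at_withinI by blast
  moreover have "Ck_on k U (\<lambda>x. frechet_derivative f (at x) v)" for v
    by (rule Ck_on_cong[OF assms(1) _ assms(3)[of v]])
       (use assms(2) frechet_derivative_at in metis)
  ultimately show ?thesis by simp
qed

lemma Ck_on_Suc_imp: "Ck_on (Suc k) U f \<Longrightarrow> Ck_on k U f"
  by (induction k arbitrary: f) (auto simp: differentiable_imp_continuous_on)

lemma Ck_on_imp_continuous_on: "Ck_on k U f \<Longrightarrow> continuous_on U f"
  by (cases k) (auto simp: differentiable_imp_continuous_on)

lemma Ck_on_local:
  assumes "open U" "\<And>x. x \<in> U \<Longrightarrow> \<exists>V. open V \<and> x \<in> V \<and> Ck_on k V f"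
  shows "Ck_on k U f"
  using assms(2)
proof (induction k arbitrary: f)
  case 0
  have "continuous (at x) f" if x: "x \<in> U" for x
  proof -
    obtain V where V: "open V" "x \<in> V" "continuous_on V f" using 0[OF x] by auto
    then show ?thesis using continuous_on_eq_continuous_at by blast
  qed
  then show ?case by (simp add: continuous_at_imp_continuous_on)
next
  case (Suc k)
  have der: "(f has_derivative frechet_derivative f (at x)) (at x)" if "x \<in> U" for x
    using Suc.prems[OF that] has_derivative_Ck_on by blast
  show ?case
  proof (rule Ck_on_SucI[OF assms(1) der])
    fix v show "Ck_on k U (\<lambda>x. frechet_derivative f (at x) v)"
      by (rule Suc.IH) (use Suc.prems in fastforce)
  qed
qed

lemma Ck_on_subset:
  assumes "open U" "open V" "V \<subseteq> U" "Ck_on k U f"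
  shows "Ck_on k V f"
  using assms(4)
proof (induction k arbitrary: f)
  case 0
  then show ?case using assms continuous_on_subset by auto
next
  case (Suc k)
  show ?case
    by (rule Ck_on_SucI[OF assms(2) has_derivative_Ck_on[OF assms(1) Suc.prems]])
       (use assms Suc in auto)
qed

lemma Ck_on_const: "Ck_on k U (\<lambda>x. c)"
proof (induction k arbitrary: c)
  case (Suc k)
  have "frechet_derivative (\<lambda>x. c) (at x) = (\<lambda>h. 0)" for x :: 'a
    using frechet_derivative_at[OF has_derivative_const, of c x] by simp
  then show ?case using Suc by simp
qed simp

lemma Ck_on_linear:
  assumes "open U" "bounded_linear f"
  shows "Ck_on k U f"
proof (cases k)
  case 0
  then show ?thesis using assms by (simp add: linear_continuous_on)
next
  case (Suc m)
  then show ?thesis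
    using Ck_on_SucI[OF assms(1) bounded_linear.has_derivative[OF assms(2) has_derivative_ident]]
      Ck_on_const by blast
qed

lemma Ck_on_add:
  assumes "open U" "Ck_on k U f" "Ck_on k U g"
  shows "Ck_on k U (\<lambda>x. f x + g x)"
  using assms(2,3)
proof (induction k arbitrary: f g)
  case 0
  then show ?case by (simp add: continuous_on_add)
next
  case (Suc k)
  show ?case
    by (rule Ck_on_SucI[OF assms(1) has_derivative_add[OF
          has_derivative_Ck_on[OF assms(1) Suc.prems(1)] has_derivative_Ck_on[OF assms(1) Suc.prems(2)]]])
       (use Suc in auto)
qed

lemma Ck_on_sum:
  assumes "open U" "finite I" "\<And>i. i \<in> I \<Longrightarrow> Ck_on k U (f i)"
  shows "Ck_on k U (\<lambda>x. \<Sum>i\<in>I. f i x)"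
  using assms(2,3)
  by (induction I rule: finite_induct) (auto intro: Ck_on_const Ck_on_add[OF assms(1)])

lemma (in bounded_bilinear) Ck_on:
  fixes f :: "'d::euclidean_space \<Rightarrow> 'a"
  assumes "open U" "Ck_on k U f" "Ck_on k U g"
  shows "Ck_on k U (\<lambda>x. prod (f x) (g x))"
  using assms(2,3)
proof (induction k arbitrary: f g)
  case 0
  then show ?case by (simp add: continuous_on)
next
  case (Suc k)
  show ?case
  proof (rule Ck_on_SucI[OF assms(1) FDERIV[OF
          has_derivative_Ck_on[OF assms(1) Suc.prems(1)] has_derivative_Ck_on[OF assms(1) Suc.prems(2)]]])
    fix v
    show "Ck_on k U (\<lambda>x. prod (f x) (frechet_derivative g (at x) v) + prod (frechet_derivative f (at x) v) (g x))"
      by (intro Ck_on_add[OF assms(1)] Suc.IH Ck_on_Suc_imp[OF Suc.prems(1)] Ck_on_Suc_imp[OF Suc.prems(2)])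
        (use Suc.prems in auto)
  qed
qed

lemmas Ck_on_mult = bounded_bilinear.Ck_on[OF bounded_bilinear_mult]
lemmas Ck_on_scaleR = bounded_bilinear.Ck_on[OF bounded_bilinear_scaleR]
lemmas Ck_on_inner = bounded_bilinear.Ck_on[OF bounded_bilinear_inner]

lemma Ck_on_diff:
  assumes "open U" "Ck_on k U f" "Ck_on k U g"
  shows "Ck_on k U (\<lambda>x. f x - g x)"
proof -
  have "Ck_on k U (\<lambda>x. f x + (-1) *\<^sub>R g x)"
    by (intro Ck_on_add Ck_on_scaleR Ck_on_const assms)
  then show ?thesis by simp
qed

text \<open>By the chain rule, expanded in the standard basis, the derivative is a sum of products of lower
  order derivatives, so that the induction on the order applies to the composition itself.\<close>

lemma Ck_on_compose:
  fixes f :: "'a::euclidean_space \<Rightarrow> 'b::euclidean_space" and g :: "'b \<Rightarrow> 'c::real_normed_vector"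
  assumes "open U" "open V" "f ` U \<subseteq> V" "Ck_on k U f" "Ck_on k V g"
  shows "Ck_on k U (\<lambda>x. g (f x))"
  using assms(4,5)
proof (induction k arbitrary: g)
  case 0
  then show ?case
    using continuous_on_compose2[of V g U f] assms(3) by simp
next
  case (Suc k)
  let ?f' = "\<lambda>x. frechet_derivative f (at x)" and ?g' = "\<lambda>y. frechet_derivative g (at y)"
  have f: "(f has_derivative ?f' x) (at x)" if "x \<in> U" for x
    using has_derivative_Ck_on[OF assms(1) Suc.prems(1) that] .
  have g: "(g has_derivative ?g' (f x)) (at (f x))" if "x \<in> U" for x
    using has_derivative_Ck_on[OF assms(2) Suc.prems(2)] assms(3) that by blast
  have der: "((\<lambda>x. g (f x)) has_derivative (\<lambda>h. \<Sum>b\<in>Basis. (?f' x h \<bullet> b) *\<^sub>R ?g' (f x) b)) (at x)"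
    if "x \<in> U" for x
  proof -
    have "(\<lambda>h. ?g' (f x) (?f' x h)) = (\<lambda>h. \<Sum>b\<in>Basis. (?f' x h \<bullet> b) *\<^sub>R ?g' (f x) b)"
    proof
      fix h
      interpret bounded_linear "?g' (f x)" using g[OF that] by (rule has_derivative_bounded_linear)
      show "?g' (f x) (?f' x h) = (\<Sum>b\<in>Basis. (?f' x h \<bullet> b) *\<^sub>R ?g' (f x) b)"
        using sum[of "\<lambda>b. (?f' x h \<bullet> b) *\<^sub>R b" Basis] by (simp add: euclidean_representation scaleR)
    qed
    then show ?thesis
      using has_derivative_compose[OF f[OF that] g[OF that]] by simp
  qed
  show ?case
  proof (rule Ck_on_SucI[OF assms(1) der])
    fix v
    have "Ck_on k U (\<lambda>x. ?g' (f x) b)" for b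
    proof (rule Suc.IH[of "\<lambda>y. ?g' y b"])
      show "Ck_on k U f" by (rule Ck_on_Suc_imp[OF Suc.prems(1)])
      show "Ck_on k V (\<lambda>y. ?g' y b)" using Suc.prems(2) by simp
    qed
    moreover have "Ck_on k U (\<lambda>x. ?f' x v)" using Suc.prems by simp
    ultimately show "Ck_on k U (\<lambda>x. \<Sum>b\<in>Basis. (?f' x v \<bullet> b) *\<^sub>R ?g' (f x) b)"
      by (intro Ck_on_sum Ck_on_scaleR Ck_on_inner Ck_on_const assms(1) finite_Basis)
  qed
qed

lemma open_nonzero: "open (- {0::'a::euclidean_space})"
  by auto

lemma Ck_on_inverse_norm: "Ck_on k (- {0}) (\<lambda>x::'a::euclidean_space. inverse (norm x))"
proof (induction k)
  case 0
  then show ?case by (auto intro!: continuous_intros)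
next
  case (Suc k)
  show ?case
  proof (rule Ck_on_SucI[OF open_nonzero])
    fix x :: 'a assume x: "x \<in> - {0}"
    show "((\<lambda>x. inverse (norm x)) has_derivative
        (\<lambda>h. - ((x \<bullet> h) * (inverse (norm x) * (inverse (norm x) * inverse (norm x)))))) (at x)"
      using x by (auto intro!: derivative_eq_intros has_derivative_norm
          simp: sgn_div_norm fun_eq_iff inner_commute divide_simps)
  next
    fix v :: 'a
    show "Ck_on k (- {0}) (\<lambda>x. - ((x \<bullet> v) * (inverse (norm x) * (inverse (norm x) * inverse (norm x)))))"
      using Ck_on_diff[OF open_nonzero Ck_on_const[of k "-{0}" 0] Ck_on_mult[OF open_nonzero
        Ck_on_inner[OF open_nonzero Ck_on_linear[OF open_nonzero bounded_linear_ident] Ck_on_const[of _ _ v]]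
        Ck_on_mult[OF open_nonzero Suc Ck_on_mult[OF open_nonzero Suc Suc]]]]
      by simp
  qed
qed

lemma Ck_on_sgn: "Ck_on k (- {0}) (sgn :: 'a::euclidean_space \<Rightarrow> 'a)"
  using Ck_on_scaleR[OF open_nonzero Ck_on_inverse_norm Ck_on_linear[OF open_nonzero bounded_linear_ident]]
  by (simp add: sgn_div_norm[abs_def])

lemma Ck_on_norm: "Ck_on k (- {0}) (norm :: 'a::euclidean_space \<Rightarrow> real)"
proof (rule Ck_on_cong[OF open_nonzero])
  show "Ck_on k (- {0}) (\<lambda>x::'a. (x \<bullet> x) * inverse (norm x))"
    by (intro Ck_on_mult Ck_on_inner Ck_on_inverse_norm Ck_on_linear bounded_linear_ident open_nonzero)
qed (simp add: dot_square_norm power2_eq_square)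

lemma smooth_onE:
  assumes "smooth_on S f" "x \<in> S"
  obtains U G where "open U" "x \<in> U" "\<forall>k. Ck_on k U G" "\<forall>y\<in>U \<inter> S. G y = f y"
proof -
  from assms have "\<exists>U G. open U \<and> x \<in> U \<and> (\<forall>k. Ck_on k U G) \<and> (\<forall>y\<in>U \<inter> S. G y = f y)"
    unfolding smooth_on_def by (rule bspec)
  then obtain U G where U: "open U" "x \<in> U" and G: "\<forall>k. Ck_on k U G" "\<forall>y\<in>U \<inter> S. G y = f y"
    by (elim exE conjE)
  show thesis
    by (rule that[OF U G])
qed

lemma smooth_on_imp_Ck_on:
  assumes "smooth_on S f" "open T" "T \<subseteq> S"
  shows "Ck_on k T f"
proof (rule Ck_on_local[OF assms(2)])
  fix x assume "x \<in> T"
  with assms(3) have "x \<in> S" by blast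
  obtain U G where U: "open U" "x \<in> U" "\<forall>k. Ck_on k U G" "\<forall>y\<in>U \<inter> S. G y = f y"
    by (rule smooth_onE[OF assms(1) \<open>x \<in> S\<close>])
  have op: "open (U \<inter> T)" using U(1) assms(2) by blast
  have "Ck_on k (U \<inter> T) G"
    by (rule Ck_on_subset[OF U(1) op _ spec[OF U(3)]]) simp
  then have "Ck_on k (U \<inter> T) f"
    by (rule Ck_on_cong[OF op, rotated]) (use U(4) assms(3) in blast)
  then show "\<exists>V. open V \<and> x \<in> V \<and> Ck_on k V f" using op U(2) \<open>x \<in> T\<close> by blast
qed

lemma smooth_on_imp_continuous_on:
  assumes "smooth_on S f"
  shows "continuous_on S f"
  unfolding continuous_on_eq_continuous_within
proof
  fix x assume "x \<in> S"
  obtain U G where U: "open U" "x \<in> U" "\<forall>k. Ck_on k U G" "\<forall>y\<in>U \<inter> S. G y = f y"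
    by (rule smooth_onE[OF assms \<open>x \<in> S\<close>])
  have "continuous (at x) G"
    using spec[OF U(3), of 0] U(1,2) by (simp add: continuous_on_eq_continuous_at)
  then have "continuous (at x within S) G" using continuous_at_imp_continuous_at_within by blast
  moreover have "eventually (\<lambda>y. G y = f y) (at x within S)"
    using U(1,2,4) by (auto simp: eventually_at_topological)
  ultimately show "continuous (at x within S) f"
    using U(2,4) \<open>x \<in> S\<close> tendsto_cong[of G f "at x within S" "f x"] unfolding continuous_within by simp
qed

text \<open>The extension of a function on the sphere to all rays is as smooth as the function; this turns
  calculus on the sphere into calculus on an open subset of Euclidean space.\<close>

lemma Ck_on_compose_sgn:
  fixes F :: "'a::euclidean_space \<Rightarrow> real"
  assumes "smooth_on (sphere 0 1) F"
  shows "Ck_on k (- {0}) (\<lambda>x. F (sgn x))"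
proof (rule Ck_on_local[OF open_nonzero])
  fix x :: 'a assume x: "x \<in> - {0}"
  have "sgn x \<in> sphere 0 1" using x by (simp add: norm_sgn)
  obtain U G where U: "open U" "sgn x \<in> U" "\<forall>k. Ck_on k U G"
    "\<forall>y\<in>U \<inter> sphere 0 1. G y = F y"
    by (rule smooth_onE[OF assms \<open>sgn x \<in> sphere 0 1\<close>])
  define T where "T = (- {0}) \<inter> sgn -` U"
  have "open T" unfolding T_def
    by (rule continuous_open_preimage[OF _ open_nonzero U(1)]) (auto intro!: continuous_intros)
  have "Ck_on k T (\<lambda>x. G (sgn x))"
    by (rule Ck_on_compose[OF \<open>open T\<close> U(1) _ _ spec[OF U(3)]])
       (use Ck_on_subset[OF open_nonzero \<open>open T\<close> _ Ck_on_sgn] in \<open>auto simp: T_def\<close>)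
  then have "Ck_on k T (\<lambda>x. F (sgn x))"
    by (rule Ck_on_cong[OF \<open>open T\<close>, rotated]) (use U(4) in \<open>auto simp: T_def norm_sgn\<close>)
  then show "\<exists>V. open V \<and> x \<in> V \<and> Ck_on k V (\<lambda>x. F (sgn x))"
    using \<open>open T\<close> x U(2) T_def by blast
qed

section \<open>Symmetry of the Hessian and vanishing divergence integrals\<close>

text \<open>The second difference of \<open>f\<close> over a small parallelogram with sides along \<open>u\<close> and \<open>v\<close> can be
  evaluated by the mean value theorem in either order of the two directions; both values converge when
  the parallelogram shrinks to \<open>x\<close>.\<close>

lemma hessian_symmetric:
  fixes V :: "'a::real_inner \<Rightarrow> 'a"
  assumes "open U" "x \<in> U"
    and f: "\<And>x. x \<in> U \<Longrightarrow> (f has_derivative (\<lambda>h. V x \<bullet> h)) (at x)"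
    and V: "\<And>x. x \<in> U \<Longrightarrow> (V has_derivative DV x) (at x)"
    and cont: "\<And>h. continuous_on U (\<lambda>x. DV x h)"
  shows "DV x u \<bullet> v = DV x v \<bullet> u"
proof -
  obtain d where d: "d > 0" "ball x d \<subseteq> U" using assms(1,2) open_contains_ball by blast
  have step: "\<exists>r1 r2. 0 \<le> r1 \<and> r1 \<le> s \<and> 0 \<le> r2 \<and> r2 \<le> s \<and>
      f (x + s *\<^sub>R u + s *\<^sub>R v) - f (x + s *\<^sub>R u) - f (x + s *\<^sub>R v) + f x
        = s * s * (DV (x + r1 *\<^sub>R u + r2 *\<^sub>R v) v \<bullet> u)"
    if s: "0 < s" "s * (norm u + norm v) < d" for s u v
  proof -
    have inU: "x + r1 *\<^sub>R u + r2 *\<^sub>R v \<in> U" if "0 \<le> r1" "r1 \<le> s" "0 \<le> r2" "r2 \<le> s" for r1 r2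
    proof -
      have "norm (r1 *\<^sub>R u + r2 *\<^sub>R v) \<le> r1 * norm u + r2 * norm v"
        using that norm_triangle_ineq[of "r1 *\<^sub>R u" "r2 *\<^sub>R v"] by simp
      also have "\<dots> \<le> s * (norm u + norm v)"
        using that by (simp add: distrib_left add_mono mult_right_mono)
      finally have "norm (r1 *\<^sub>R u + r2 *\<^sub>R v) < d" using s by simp
      then have "x + r1 *\<^sub>R u + r2 *\<^sub>R v \<in> ball x d"
        using norm_minus_cancel[of "r1 *\<^sub>R u + r2 *\<^sub>R v"] by (simp add: dist_norm del: norm_minus_cancel)
      then show ?thesis using d by blast
    qed
    let ?p = "\<lambda>t. f (x + t *\<^sub>R u + s *\<^sub>R v) - f (x + t *\<^sub>R u)"
    have p': "(?p has_real_derivative (V (x + t *\<^sub>R u + s *\<^sub>R v) \<bullet> u - V (x + t *\<^sub>R u) \<bullet> u)) (at t)"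
      if t: "0 \<le> t" "t \<le> s" for t
    proof -
      have 1: "((\<lambda>t. f (x + t *\<^sub>R u + s *\<^sub>R v)) has_derivative (\<lambda>h. V (x + t *\<^sub>R u + s *\<^sub>R v) \<bullet> (h *\<^sub>R u))) (at t)"
        by (rule has_derivative_compose[where g=f and f="\<lambda>t. x + t *\<^sub>R u + s *\<^sub>R v", OF _ f[OF inU]])
           (use t s in \<open>auto intro!: derivative_eq_intros\<close>)
      have 2: "((\<lambda>t. f (x + t *\<^sub>R u)) has_derivative (\<lambda>h. V (x + t *\<^sub>R u) \<bullet> (h *\<^sub>R u))) (at t)"
        by (rule has_derivative_compose[where g=f and f="\<lambda>t. x + t *\<^sub>R u", OF _ f])
           (use t s inU[of t 0] in \<open>auto intro!: derivative_eq_intros\<close>)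
      show ?thesis
        unfolding has_field_derivative_def
        by (rule has_derivative_eq_rhs[OF has_derivative_diff[OF 1 2]])
           (simp add: fun_eq_iff algebra_simps)
    qed
    obtain r1 where r1: "0 < r1" "r1 < s"
      and e1: "?p s - ?p 0 = (s - 0) * (V (x + r1 *\<^sub>R u + s *\<^sub>R v) \<bullet> u - V (x + r1 *\<^sub>R u) \<bullet> u)"
      using MVT2[of 0 s ?p "\<lambda>t. V (x + t *\<^sub>R u + s *\<^sub>R v) \<bullet> u - V (x + t *\<^sub>R u) \<bullet> u"] p' s by blast
    let ?q = "\<lambda>t. V (x + r1 *\<^sub>R u + t *\<^sub>R v) \<bullet> u"
    have q': "(?q has_real_derivative (DV (x + r1 *\<^sub>R u + t *\<^sub>R v) v \<bullet> u)) (at t)"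
      if t: "0 \<le> t" "t \<le> s" for t
    proof -
      have iU: "x + r1 *\<^sub>R u + t *\<^sub>R v \<in> U" using inU r1 t by simp
      have "((\<lambda>t. V (x + r1 *\<^sub>R u + t *\<^sub>R v)) has_derivative (\<lambda>h. DV (x + r1 *\<^sub>R u + t *\<^sub>R v) (h *\<^sub>R v))) (at t)"
        by (rule has_derivative_compose[where g=V and f="\<lambda>t. x + r1 *\<^sub>R u + t *\<^sub>R v", OF _ V[OF iU]]) (auto intro!: derivative_eq_intros)
      from has_derivative_inner_left[OF this, of u]
      show ?thesis
        unfolding has_field_derivative_def
        by (rule has_derivative_eq_rhs)
          (simp add: fun_eq_iff linear_scale[OF has_derivative_linear[OF V[OF iU]]])
    qed
    obtain r2 where r2: "0 < r2" "r2 < s"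
      and e2: "?q s - ?q 0 = (s - 0) * (DV (x + r1 *\<^sub>R u + r2 *\<^sub>R v) v \<bullet> u)"
      using MVT2[of 0 s ?q "\<lambda>t. DV (x + r1 *\<^sub>R u + t *\<^sub>R v) v \<bullet> u"] q' s by blast
    show ?thesis
      using r1 r2 e1 e2 by (intro exI[of _ r1] exI[of _ r2]) (auto simp: algebra_simps)
  qed
  show ?thesis
  proof (rule ccontr)
    assume neq: "DV x u \<bullet> v \<noteq> DV x v \<bullet> u"
    define e where "e = \<bar>DV x u \<bullet> v - DV x v \<bullet> u\<bar> / 2"
    have e: "e > 0" using neq by (simp add: e_def)
    have c: "isCont (\<lambda>y. DV y u \<bullet> v) x" "isCont (\<lambda>y. DV y v \<bullet> u) x"
      using cont[THEN continuous_on_interior] assms(1,2)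
      by (auto intro!: continuous_intros simp: interior_open)
    obtain d1 where d1: "d1 > 0" "\<And>y. dist y x < d1 \<Longrightarrow> \<bar>DV y u \<bullet> v - DV x u \<bullet> v\<bar> < e"
      using c(1) e unfolding continuous_at_eps_delta by (metis dist_real_def)
    obtain d2 where d2: "d2 > 0" "\<And>y. dist y x < d2 \<Longrightarrow> \<bar>DV y v \<bullet> u - DV x v \<bullet> u\<bar> < e"
      using c(2) e unfolding continuous_at_eps_delta by (metis dist_real_def)
    define m where "m = min d (min d1 d2)"
    define K where "K = norm u + norm v"
    have K: "K \<ge> 0" by (simp add: K_def)
    define s where "s = m / (2 * (K + 1))"
    have m: "m > 0" using d d1 d2 by (simp add: m_def)
    have s: "s > 0" using m K by (simp add: s_def)
    have "s * K \<le> s * (K + 1)" using s by simp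
    also have "\<dots> = m / 2" using K by (simp add: s_def field_simps)
    also have "\<dots> < m" using m by simp
    finally have sm: "s * (norm u + norm v) < m" by (simp add: K_def)
    have near: "dist (x + r1 *\<^sub>R u + r2 *\<^sub>R v) x < m" if "0 \<le> r1" "r1 \<le> s" "0 \<le> r2" "r2 \<le> s" for r1 r2
    proof -
      have "dist (x + r1 *\<^sub>R u + r2 *\<^sub>R v) x = norm (r1 *\<^sub>R u + r2 *\<^sub>R v)"
        by (simp add: dist_norm)
      also have "\<dots> \<le> r1 * norm u + r2 * norm v"
        using that norm_triangle_ineq[of "r1 *\<^sub>R u" "r2 *\<^sub>R v"] by simp
      also have "\<dots> \<le> s * (norm u + norm v)"
        using that by (simp add: distrib_left add_mono mult_right_mono)
      finally show ?thesis using sm by simp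
    qed
    obtain r1 r2 where r: "0 \<le> r1" "r1 \<le> s" "0 \<le> r2" "r2 \<le> s"
      "f (x + s *\<^sub>R u + s *\<^sub>R v) - f (x + s *\<^sub>R u) - f (x + s *\<^sub>R v) + f x
        = s * s * (DV (x + r1 *\<^sub>R u + r2 *\<^sub>R v) v \<bullet> u)"
      using step[of s u v] s sm m_def by auto
    obtain q1 q2 where q: "0 \<le> q1" "q1 \<le> s" "0 \<le> q2" "q2 \<le> s"
      "f (x + s *\<^sub>R v + s *\<^sub>R u) - f (x + s *\<^sub>R v) - f (x + s *\<^sub>R u) + f x
        = s * s * (DV (x + q1 *\<^sub>R v + q2 *\<^sub>R u) u \<bullet> v)"
      using step[of s v u] s sm m_def by (auto simp: add.commute)
    have "s * s * (DV (x + r1 *\<^sub>R u + r2 *\<^sub>R v) v \<bullet> u) = s * s * (DV (x + q2 *\<^sub>R u + q1 *\<^sub>R v) u \<bullet> v)"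
    proof -
      have e: "x + s *\<^sub>R v + s *\<^sub>R u = x + s *\<^sub>R u + s *\<^sub>R v"
        "x + q1 *\<^sub>R v + q2 *\<^sub>R u = x + q2 *\<^sub>R u + q1 *\<^sub>R v" by simp_all
      show ?thesis using r(5) q(5)[unfolded e] by linarith
    qed
    then have "DV (x + r1 *\<^sub>R u + r2 *\<^sub>R v) v \<bullet> u = DV (x + q2 *\<^sub>R u + q1 *\<^sub>R v) u \<bullet> v"
      using s by simp
    moreover have "\<bar>DV (x + r1 *\<^sub>R u + r2 *\<^sub>R v) v \<bullet> u - DV x v \<bullet> u\<bar> < e"
      using near[OF r(1-4)] d2(2) m_def by simp
    moreover have "\<bar>DV (x + q2 *\<^sub>R u + q1 *\<^sub>R v) u \<bullet> v - DV x u \<bullet> v\<bar> < e"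
      using near[OF q(3,4,1,2)] d1(2) m_def by simp
    ultimately show False unfolding e_def by (auto simp: abs_if split: if_splits)
  qed
qed

lemma derivative_eq_0_off_support:
  assumes "open U" "x \<in> U" "\<And>y. y \<in> U \<Longrightarrow> f y = 0" "(f has_derivative f') (at x)"
  shows "f' = (\<lambda>h. 0)"
proof -
  have "(f has_derivative (\<lambda>h. 0)) (at x)"
    by (rule has_derivative_transform_within_open[OF has_derivative_const[of 0] assms(1,2)])
       (simp add: assms(3))
  then show ?thesis by (rule has_derivative_unique[OF assms(4)])
qed

text \<open>By translation invariance all difference quotients of \<open>f\<close> in direction \<open>v\<close> have integral zero.
  They are bounded by the maximum of the derivative and vanish outside a fixed ball, so that dominated
  convergence carries this over to the derivative.\<close>

lemma integral_partial_derivative_zero: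
  fixes f :: "'a::euclidean_space \<Rightarrow> real"
  assumes f': "\<And>x. (f has_derivative f' x) (at x)"
    and cont: "continuous_on UNIV (\<lambda>x. f' x v)"
    and K: "compact K" "\<And>x. x \<notin> K \<Longrightarrow> f x = 0"
  shows "integrable lborel (\<lambda>x. f' x v)" "(LINT x|lborel. f' x v) = 0"
proof -
  have opK: "open (- K)" using K(1) compact_imp_closed by blast
  have zero: "f' x v = 0" if "x \<notin> K" for x
    using derivative_eq_0_off_support[OF opK _ _ f'[of x]] that K(2) by auto
  have contf: "continuous_on UNIV f"
    by (intro continuous_at_imp_continuous_on ballI has_derivative_continuous[OF f'])
  have ind: "(\<lambda>x. indicator K x *\<^sub>R f' x v) = (\<lambda>x. f' x v)"
    using zero by (auto simp: fun_eq_iff indicator_def)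
  show "integrable lborel (\<lambda>x. f' x v)"
    using borel_integrable_compact[OF K(1) continuous_on_subset[OF cont subset_UNIV]] ind by simp
  have indf: "(\<lambda>x. indicator K x *\<^sub>R f x) = f"
    using K(2) by (auto simp: fun_eq_iff indicator_def)
  have intf: "integrable lborel f"
    using borel_integrable_compact[OF K(1) continuous_on_subset[OF contf subset_UNIV]] indf by simp
  obtain L where L: "\<And>x. \<bar>f' x v\<bar> \<le> L"
  proof -
    have "bounded ((\<lambda>x. f' x v) ` K)"
      using K(1) cont by (intro compact_imp_bounded compact_continuous_image continuous_on_subset[OF cont]) auto
    then obtain M where M: "\<And>x. x \<in> K \<Longrightarrow> \<bar>f' x v\<bar> \<le> M" by (auto simp: bounded_iff)
    have "\<bar>f' x v\<bar> \<le> max M 0" for x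
      using M[of x] zero[of x] by (cases "x \<in> K") auto
    then show ?thesis using that by blast
  qed
  obtain R where R: "\<And>x. x \<in> K \<Longrightarrow> norm x \<le> R"
    using compact_imp_bounded[OF K(1)] by (auto simp: bounded_iff)
  define B where "B = cball (0::'a) (R + norm v)"
  define t where "t = (\<lambda>k::nat. inverse (real (Suc k)))"
  have t: "0 < t k" "t k \<le> 1" for k by (auto simp: t_def inverse_le_1_iff)
  define q where "q = (\<lambda>k x. (f (x + t k *\<^sub>R v) - f x) / t k)"
  have trans: "integrable lborel (\<lambda>x. f (x + c))" "(LINT x|lborel. f (x + c)) = (LINT x|lborel. f x)" for c
  proof -
    have m: "(+) c \<in> measurable lborel borel" by simp
    have fm: "f \<in> borel_measurable borel" using contf by (rule borel_measurable_continuous_onI)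
    show "(LINT x|lborel. f (x + c)) = (LINT x|lborel. f x)"
      using integral_distr[OF m fm] by (simp add: lborel_distr_plus add.commute)
    show "integrable lborel (\<lambda>x. f (x + c))"
      using integrable_distr_eq[OF m fm] intf by (simp add: lborel_distr_plus add.commute)
  qed
  have intq: "(LINT x|lborel. q k x) = 0" for k
    unfolding q_def using trans intf by simp
  have lim: "(\<lambda>k. q k x) \<longlonglongrightarrow> f' x v" for x
  proof -
    have "((\<lambda>s. f (x + s *\<^sub>R v)) has_derivative (\<lambda>h. f' x (h *\<^sub>R v))) (at 0)"
      by (rule has_derivative_compose[where f="\<lambda>s. x + s *\<^sub>R v" and g=f])
         (auto intro!: derivative_eq_intros simp: f')
    moreover have "(\<lambda>h. f' x (h *\<^sub>R v)) = (*) (f' x v)"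
      using linear_scale[OF has_derivative_linear[OF f'[of x]]] by (auto simp: fun_eq_iff)
    ultimately have "((\<lambda>s. f (x + s *\<^sub>R v)) has_real_derivative f' x v) (at 0)"
      by (simp add: has_field_derivative_def)
    then have "((\<lambda>h. (f (x + h *\<^sub>R v) - f x) / h) \<longlongrightarrow> f' x v) (at 0)"
      by (simp add: DERIV_def)
    moreover have "filterlim t (at 0) sequentially"
      using t LIMSEQ_inverse_real_of_nat
      by (auto simp: filterlim_at t_def intro!: always_eventually)
    ultimately show ?thesis unfolding q_def by (rule filterlim_compose)
  qed
  have bound: "norm (q k x) \<le> indicator B x * L" for k x
  proof (cases "x \<in> B")
    case True
    have "\<exists>z. 0 < z \<and> z < t k \<and> f (x + t k *\<^sub>R v) - f (x + 0 *\<^sub>R v) = (t k - 0) * f' (x + z *\<^sub>R v) v"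
    proof (rule MVT2)
      fix s
      have "((\<lambda>s. f (x + s *\<^sub>R v)) has_derivative (\<lambda>h. f' (x + s *\<^sub>R v) (h *\<^sub>R v))) (at s)"
        by (rule has_derivative_compose[where f="\<lambda>s. x + s *\<^sub>R v" and g=f])
           (auto intro!: derivative_eq_intros simp: f')
      moreover have "(\<lambda>h. f' (x + s *\<^sub>R v) (h *\<^sub>R v)) = (*) (f' (x + s *\<^sub>R v) v)"
        using linear_scale[OF has_derivative_linear[OF f']] by (auto simp: fun_eq_iff)
      ultimately show "((\<lambda>s. f (x + s *\<^sub>R v)) has_real_derivative f' (x + s *\<^sub>R v) v) (at s)"
        by (simp add: has_field_derivative_def)
    qed (use t in auto)
    then obtain z where "f (x + t k *\<^sub>R v) - f x = t k * f' (x + z *\<^sub>R v) v" by auto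
    then have "q k x = f' (x + z *\<^sub>R v) v" using t[of k] by (simp add: q_def)
    then show ?thesis using L True by simp
  next
    case False
    have "x \<notin> K" using False R[of x] norm_ge_zero[of v] by (auto simp: B_def)
    moreover have "x + t k *\<^sub>R v \<notin> K"
    proof
      assume "x + t k *\<^sub>R v \<in> K"
      then have "norm (x + t k *\<^sub>R v) \<le> R" using R by blast
      moreover have "norm (t k *\<^sub>R v) \<le> norm v" using t[of k] mult_right_mono[of "t k" 1 "norm v"] by simp
      moreover have "norm x \<le> norm (x + t k *\<^sub>R v) + norm (t k *\<^sub>R v)"
        using norm_triangle_ineq4[of "x + t k *\<^sub>R v" "t k *\<^sub>R v"] by simp
      ultimately show False using False by (auto simp: B_def)
    qed
    ultimately show ?thesis using K(2) False by (simp add: q_def)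
  qed
  have w: "integrable lborel (\<lambda>x. indicator B x * L)"
    using borel_integrable_compact[OF compact_cball, of "0::'a" "R + norm v" "\<lambda>_. L"] by (simp add: B_def)
  have "(\<lambda>k. LINT x|lborel. q k x) \<longlonglongrightarrow> (LINT x|lborel. f' x v)"
    by (rule integral_dominated_convergence[where w="\<lambda>x. indicator B x * L"])
      (use lim bound w \<open>integrable lborel (\<lambda>x. f' x v)\<close> intf trans(1) in \<open>auto simp: q_def\<close>)
  then show "(LINT x|lborel. f' x v) = 0"
    by (simp add: intq LIMSEQ_const_iff)
qed

text \<open>The integrand \<open>D\<close> is the divergence of \<open>f T\<close>.  The compact set \<open>K\<close> keeps the support of this field
  away from the boundary of \<open>U\<close>, so its components, extended by zero, are differentiable everywhere.\<close>

lemma integral_divergence_zero: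
  fixes f :: "'a::euclidean_space \<Rightarrow> real" and T :: "'a \<Rightarrow> 'a"
  assumes U: "open U" and K: "compact K" "K \<subseteq> U" "\<And>x. x \<in> U \<Longrightarrow> x \<notin> K \<Longrightarrow> f x = 0"
    and f': "\<And>x. x \<in> U \<Longrightarrow> (f has_derivative f' x) (at x)" "\<And>h. continuous_on U (\<lambda>x. f' x h)"
    and T': "\<And>x. x \<in> U \<Longrightarrow> (T has_derivative T' x) (at x)" "\<And>h. continuous_on U (\<lambda>x. T' x h)"
    and D: "\<And>x. D x = (if x \<in> U then f' x (T x) + f x * (\<Sum>b\<in>Basis. T' x b \<bullet> b) else 0)"
  shows "integrable lborel D" "(LINT x|lborel. D x) = 0"
proof -
  have opK: "open (- K)" using K(1) compact_imp_closed by blast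
  define g where "g = (\<lambda>b x. if x \<in> U then f x * (T x \<bullet> b) else 0)"
  define g' where "g' = (\<lambda>b x h. if x \<in> U then f' x h * (T x \<bullet> b) + f x * (T' x h \<bullet> b) else 0)"
  have cU: "continuous_on U f" "continuous_on U T"
    by (auto intro!: continuous_at_imp_continuous_on has_derivative_continuous[OF f'(1)]
        has_derivative_continuous[OF T'(1)])
  have f'0: "f' x h = 0" if "x \<in> U" "x \<notin> K" for x h
    using derivative_eq_0_off_support[of "U - K" x f "f' x"] that K(3) f'(1)[OF that(1)]
      open_Diff[OF U compact_imp_closed[OF K(1)]] by simp
  have g0: "g b x = 0" "g' b x h = 0" if "x \<notin> K" for b x h
    using that K(3) f'0 by (auto simp: g_def g'_def)
  have der: "(g b has_derivative g' b x) (at x)" for b x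
  proof (cases "x \<in> U")
    case True
    have "((\<lambda>x. f x * (T x \<bullet> b)) has_derivative (\<lambda>h. f' x h * (T x \<bullet> b) + f x * (T' x h \<bullet> b))) (at x)"
      using f'(1)[OF True] T'(1)[OF True] by (auto intro!: derivative_eq_intros simp: algebra_simps)
    from has_derivative_transform_within_open[OF this U True, of "g b"]
    show ?thesis using True by (simp add: g_def g'_def)
  next
    case False
    then have x: "x \<in> - K" using K(2) by blast
    have "g' b x = (\<lambda>h. 0)" using False by (simp add: g'_def fun_eq_iff)
    then show ?thesis
      using has_derivative_transform_within_open[OF has_derivative_const[of 0] opK x, of "g b"] g0 by simp
  qed
  have cont: "continuous_on UNIV (\<lambda>x. g' b x h)" for b h
  proof -
    have "continuous_on U (\<lambda>x. f' x h * (T x \<bullet> b) + f x * (T' x h \<bullet> b))"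
      by (intro continuous_intros cU f'(2) T'(2))
    then have "continuous_on U (\<lambda>x. g' b x h)"
      by (simp add: g'_def cong: continuous_on_cong_simp)
    moreover have "continuous_on (- K) (\<lambda>x. g' b x h)"
      by (rule continuous_on_eq[of _ "\<lambda>x. 0"]) (auto simp: g0)
    ultimately have "continuous_on (U \<union> - K) (\<lambda>x. g' b x h)"
      by (intro continuous_on_open_Un U opK)
    moreover have "U \<union> - K = UNIV" using K(2) by blast
    ultimately show ?thesis by simp
  qed
  note I = integral_partial_derivative_zero[OF der cont K(1) g0(1)]
  have D': "D x = (\<Sum>b\<in>Basis. g' b x b)" for x
  proof (cases "x \<in> U")
    case True
    interpret bounded_linear "f' x" using f'(1)[OF True] by (rule has_derivative_bounded_linear)
    have "f' x (T x) = f' x (\<Sum>b\<in>Basis. (T x \<bullet> b) *\<^sub>R b)" by (simp add: euclidean_representation)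
    also have "\<dots> = (\<Sum>b\<in>Basis. f' x b * (T x \<bullet> b))" by (simp add: sum scaleR mult.commute)
    finally show ?thesis using True by (simp add: D g'_def sum.distrib sum_distrib_left)
  qed (simp add: D g'_def)
  show "integrable lborel D" unfolding D'[abs_def] by (intro Bochner_Integration.integrable_sum I)
  show "(LINT x|lborel. D x) = 0"
    unfolding D' by (subst Bochner_Integration.integral_sum) (auto intro: I simp: I)
qed

section \<open>The length of gradient lines and the distance to a focal set\<close>

text \<open>The vector \<open>e\<close> is the initial direction of a great circle from \<open>x\<close> to \<open>y\<close>, whose length is the
  angle \<open>arccos (x \<bullet> y)\<close>.  For \<open>y = x\<close> and \<open>y = - x\<close> any direction orthogonal to \<open>x\<close> will do.\<close>

lemma great_circle:
  fixes x y :: "'a::euclidean_space"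
  assumes "DIM('a) \<ge> 2" "norm x = 1" "norm y = 1"
  obtains e where "norm e = 1" "x \<bullet> e = 0" "y = cos (arccos (x \<bullet> y)) *\<^sub>R x + sin (arccos (x \<bullet> y)) *\<^sub>R e"
proof -
  have c: "\<bar>x \<bullet> y\<bar> \<le> 1" using Cauchy_Schwarz_ineq2[of x y] assms by simp
  define z where "z = y - (x \<bullet> y) *\<^sub>R x"
  have xx: "x \<bullet> x = 1" "y \<bullet> y = 1" using assms by (simp_all add: dot_square_norm)
  have zx: "x \<bullet> z = 0" by (simp add: z_def inner_diff_right xx)
  have "z \<bullet> z = 1 - (x \<bullet> y)\<^sup>2"
    by (simp add: z_def inner_diff_left inner_diff_right xx inner_commute power2_eq_square)
  then have nz: "norm z = sin (arccos (x \<bullet> y))"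
    using c by (simp add: norm_eq_sqrt_inner sin_arccos_abs)
  show thesis
  proof (cases "z = 0")
    case True
    obtain w :: 'a where w: "w \<noteq> 0" "orthogonal x w" using orthogonal_to_vector_exists[OF assms(1)] .
    show thesis
    proof (rule that[of "sgn w"])
      show "norm (sgn w) = 1" "x \<bullet> sgn w = 0" using w by (simp_all add: norm_sgn orthogonal_def sgn_div_norm)
      have "sin (arccos (x \<bullet> y)) = 0" using nz True by simp
      then show "y = cos (arccos (x \<bullet> y)) *\<^sub>R x + sin (arccos (x \<bullet> y)) *\<^sub>R sgn w"
        using True c by (simp add: z_def cos_arccos_abs)
    qed
  next
    case False
    show thesis
    proof (rule that[of "sgn z"])
      show "norm (sgn z) = 1" "x \<bullet> sgn z = 0" using False zx by (simp_all add: norm_sgn sgn_div_norm)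
      show "y = cos (arccos (x \<bullet> y)) *\<^sub>R x + sin (arccos (x \<bullet> y)) *\<^sub>R sgn z"
        using False c nz[symmetric] by (simp add: cos_arccos_abs sgn_div_norm) (simp add: z_def)
    qed
  qed
qed

text \<open>At a zero of second order, \<open>1 / sqrt A\<close> is not integrable; quantitatively, the integral of the
  regularised function grows at least like \<open>ln (1 / e)\<close>.\<close>

lemma integral_inverse_sqrt_lower_bound:
  fixes A :: "real \<Rightarrow> real"
  assumes "a \<le> s0" "s0 < s1" "s1 \<le> b" "c > 0" "e > 0" "continuous_on {a..b} A"
    and "\<And>s. s \<in> {a..b} \<Longrightarrow> A s \<ge> 0" "\<And>s. s \<in> {s0..s1} \<Longrightarrow> A s \<le> (c * (s - s0))\<^sup>2"
  shows "ln ((c * (s1 - s0) + e) / e) / c \<le> integral {a..b} (\<lambda>s. 1 / sqrt (A s + e\<^sup>2))"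
proof -
  let ?q = "\<lambda>s. 1 / sqrt (A s + e\<^sup>2)" and ?r = "\<lambda>s. 1 / (c * (s - s0) + e)"
  have pos: "A s + e\<^sup>2 > 0" if "s \<in> {a..b}" for s
    using assms(5) assms(7)[OF that] by (intro add_nonneg_pos) auto
  have contq: "continuous_on {a..b} ?q"
    using pos by (intro continuous_intros assms(6)) (metis less_irrefl real_sqrt_eq_0_iff)
  have q: "?q integrable_on {a..b}" "?q integrable_on {s0..s1}"
    using contq assms(1,3) by (auto intro!: integrable_continuous_real intro: continuous_on_subset)
  have r: "(?r has_integral (ln (c * (s1 - s0) + e) / c - ln (c * (s0 - s0) + e) / c)) {s0..s1}"
  proof (rule fundamental_theorem_of_calculus)
    fix s assume "s \<in> {s0..s1}"
    then have "c * (s - s0) + e > 0" using assms(4,5) by (intro add_nonneg_pos) auto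
    then show "((\<lambda>s. ln (c * (s - s0) + e) / c) has_vector_derivative ?r s) (at s within {s0..s1})"
      unfolding has_real_derivative_iff_has_vector_derivative[symmetric]
      using assms(4) by (auto intro!: derivative_eq_intros)
  qed (use assms(2) in simp)
  have "integral {s0..s1} ?r \<le> integral {s0..s1} ?q"
  proof (rule integral_le)
    fix s assume s: "s \<in> {s0..s1}"
    then have "c * (s - s0) \<ge> 0" using assms(4) by simp
    then have "A s + e\<^sup>2 \<le> (c * (s - s0) + e)\<^sup>2"
    proof -
      have "0 \<le> 2 * (c * (s - s0)) * e" using \<open>c * (s - s0) \<ge> 0\<close> assms(5) by simp
      then show ?thesis using assms(8)[OF s] unfolding power2_sum by linarith
    qed
    then have "sqrt (A s + e\<^sup>2) \<le> c * (s - s0) + e"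
      using \<open>c * (s - s0) \<ge> 0\<close> assms(5) by (intro real_le_lsqrt) auto
    moreover have "0 < sqrt (A s + e\<^sup>2)" using pos[of s] s assms(1,3) by simp
    ultimately show "?r s \<le> ?q s" by (simp add: frac_le)
  qed (use q r in \<open>auto simp: integrable_on_def\<close>)
  also have "\<dots> \<le> integral {a..b} ?q"
    using q assms(1,3) pos by (intro integral_subset_le) (auto simp: less_imp_le)
  also have "integral {s0..s1} ?r = ln ((c * (s1 - s0) + e) / e) / c"
  proof -
    have "c * (s1 - s0) + e > 0" using assms(2,4,5) by (intro add_pos_pos mult_pos_pos) auto
    then show ?thesis
      using integral_unique[OF r] assms(5) by (simp add: ln_div diff_divide_distrib)
  qed
  finally show ?thesis .
qed

lemma gradient_orthogonal_of_radially_constant: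
  fixes x :: "'a::real_inner"
  assumes f: "(f has_derivative (\<lambda>h. v \<bullet> h)) (at x)"
    and const: "\<And>c. c > 0 \<Longrightarrow> f (c *\<^sub>R x) = f x"
  shows "v \<bullet> x = 0"
proof -
  have "((\<lambda>t. f ((1 + t) *\<^sub>R x)) has_derivative (\<lambda>h. v \<bullet> (h *\<^sub>R x))) (at 0)"
    by (rule has_derivative_compose[where f="\<lambda>t. (1 + t) *\<^sub>R x" and g=f])
       (use f in \<open>auto intro!: derivative_eq_intros\<close>)
  then have "((\<lambda>t. f x) has_derivative (\<lambda>h. v \<bullet> (h *\<^sub>R x))) (at 0)"
    by (rule has_derivative_transform_within_open[of _ _ _ _ "{-1<..}"]) (auto simp: const)
  from has_derivative_unique[OF this has_derivative_const] have "(\<lambda>h. v \<bullet> (h *\<^sub>R x)) = (\<lambda>h. 0)" .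
  from fun_cong[OF this, of 1] show ?thesis by simp
qed

lemma has_derivative_norm':
  fixes x :: "'a::real_inner"
  assumes "x \<noteq> 0" shows "(norm has_derivative (\<lambda>h. (x \<bullet> h) / norm x)) (at x)"
  using has_derivative_norm[OF assms]
  by (simp add: sgn_div_norm inner_commute divide_inverse mult.commute)

text \<open>An isoparametric function in homogeneous form: \<open>f\<close> is constant on rays, \<open>V\<close> is its gradient and
  \<open>DV\<close> its Hessian in the ambient space.  Since \<open>V\<close> and \<open>DV\<close> are homogeneous of degrees -1 and -2, a factor \<open>|x|\<^sup>2\<close> makes
  both sides of the two isoparametric equations constant on rays.\<close>

locale isoparametric_extension =
  fixes f :: "'a::euclidean_space \<Rightarrow> real" and V :: "'a \<Rightarrow> 'a" and DV :: "'a \<Rightarrow> 'a \<Rightarrow> 'a"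
    and A A' B :: "real \<Rightarrow> real" and a b :: real and n :: nat
  assumes dim: "DIM('a) = n + 1" and n2: "n \<ge> 2" and ab: "a < b"
    and f_sgn: "f (sgn x) = f x"
    and f_range: "f ` sphere 0 1 = {a..b}"
    and f_der: "x \<noteq> 0 \<Longrightarrow> (f has_derivative (\<lambda>h. V x \<bullet> h)) (at x)"
    and V_der: "x \<noteq> 0 \<Longrightarrow> (V has_derivative DV x) (at x)"
    and DV_cont: "continuous_on (- {0}) (\<lambda>x. DV x h)"
    and V_norm: "x \<noteq> 0 \<Longrightarrow> (norm x)\<^sup>2 * (V x \<bullet> V x) = A (f x)"
    and V_div: "x \<noteq> 0 \<Longrightarrow> (norm x)\<^sup>2 * (\<Sum>b\<in>Basis. DV x b \<bullet> b) = - B (f x)"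
    and A_cont: "continuous_on {a..b} A" and B_cont: "continuous_on {a..b} B"
    and A_der: "s \<in> {a<..<b} \<Longrightarrow> (A has_real_derivative A' s) (at s)"
    and A'_diff: "s \<in> {a<..<b} \<Longrightarrow> A' differentiable (at s)"
begin

lemma dim2: "DIM('a) \<ge> 2" using dim n2 by simp

lemma f_bounds: "x \<noteq> 0 \<Longrightarrow> f x \<in> {a..b}"
  using f_range f_sgn[of x] by (metis image_eqI mem_sphere_0 norm_sgn)

lemma f_scale: "c > 0 \<Longrightarrow> f (c *\<^sub>R x) = f x"
  using f_sgn[of "c *\<^sub>R x"] f_sgn[of x] by (simp add: sgn_scaleR)

lemma f_onto:
  assumes "s \<in> {a..b}" obtains x where "norm x = 1" "f x = s"
  using assms f_range by (metis imageE mem_sphere_0)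

lemma V_radial: "x \<noteq> 0 \<Longrightarrow> V x \<bullet> x = 0"
  using gradient_orthogonal_of_radially_constant[OF f_der f_scale] .

lemma A_nonneg: "s \<in> {a..b} \<Longrightarrow> A s \<ge> 0"
proof -
  assume "s \<in> {a..b}"
  then obtain x where "norm x = 1" "f x = s" by (rule f_onto)
  then show ?thesis using V_norm[of x] by (metis inner_ge_zero mult_1 norm_zero power_one zero_neq_one)
qed

text \<open>Along a unit speed great circle \<open>f\<close> changes at a rate of at most \<open>|grad f| = sqrt (A f)\<close>.\<close>

lemma f_great_circle:
  fixes x e :: 'a
  defines "c \<equiv> \<lambda>t. cos t *\<^sub>R x + sin t *\<^sub>R e"
  assumes "norm x = 1" "norm e = 1" "x \<bullet> e = 0"
  shows "norm (c t) = 1" "((\<lambda>t. f (c t)) has_real_derivative V (c t) \<bullet> (cos t *\<^sub>R e - sin t *\<^sub>R x)) (at t)"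
    "\<bar>V (c t) \<bullet> (cos t *\<^sub>R e - sin t *\<^sub>R x)\<bar> \<le> sqrt (A (f (c t)))"
proof -
  have xx: "x \<bullet> x = 1" "e \<bullet> e = 1" using assms by (simp_all add: dot_square_norm)
  have "c t \<bullet> c t = 1"
    using assms(4) by (simp add: c_def inner_add_left inner_add_right xx inner_commute
        power2_eq_square[symmetric])
  then show n1: "norm (c t) = 1" by (simp add: norm_eq_sqrt_inner)
  then have c0: "c t \<noteq> 0" by (metis norm_zero zero_neq_one)
  have "((\<lambda>t. f (c t)) has_derivative (\<lambda>h. V (c t) \<bullet> (h *\<^sub>R (cos t *\<^sub>R e - sin t *\<^sub>R x)))) (at t)"
    by (rule has_derivative_compose[where f=c and g=f])
       (use f_der[OF c0] in \<open>auto simp: c_def fun_eq_iff algebra_simps intro!: derivative_eq_intros\<close>)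
  then show "((\<lambda>t. f (c t)) has_real_derivative V (c t) \<bullet> (cos t *\<^sub>R e - sin t *\<^sub>R x)) (at t)"
    by (simp add: has_field_derivative_def mult_commute_abs)
  have "(cos t *\<^sub>R e - sin t *\<^sub>R x) \<bullet> (cos t *\<^sub>R e - sin t *\<^sub>R x) = 1"
    using assms(4) by (simp add: inner_diff_left inner_diff_right xx inner_commute
        power2_eq_square[symmetric])
  then have "norm (cos t *\<^sub>R e - sin t *\<^sub>R x) = 1" by (simp add: norm_eq_sqrt_inner)
  moreover have "norm (V (c t)) = sqrt (A (f (c t)))"
    using V_norm[OF c0] n1 by (simp add: norm_eq_sqrt_inner)
  ultimately show "\<bar>V (c t) \<bullet> (cos t *\<^sub>R e - sin t *\<^sub>R x)\<bar> \<le> sqrt (A (f (c t)))"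
    using Cauchy_Schwarz_ineq2[of "V (c t)" "cos t *\<^sub>R e - sin t *\<^sub>R x"] by simp
qed

text \<open>With \<open>h sqrt A \<le> 1\<close> the function \<open>H o f\<close> is 1-Lipschitz for the distance on the sphere, as one sees
  along the great circle from \<open>x\<close> to \<open>y\<close>.\<close>

lemma path_bound:
  assumes H: "\<And>s. s \<in> {a..b} \<Longrightarrow> (H has_real_derivative h s) (at s within {a..b})"
    and h: "\<And>s. s \<in> {a..b} \<Longrightarrow> 0 \<le> h s" "\<And>s. s \<in> {a..b} \<Longrightarrow> h s * sqrt (A s) \<le> 1"
    and xy: "norm x = 1" "norm y = 1"
  shows "H (f y) - H (f x) \<le> arccos (x \<bullet> y)"
proof -
  define d where "d = arccos (x \<bullet> y)"
  have d: "d \<ge> 0" using Cauchy_Schwarz_ineq2[of x y] xy by (auto simp: d_def intro!: arccos_lbound)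
  obtain e where e: "norm e = 1" "x \<bullet> e = 0" "y = cos d *\<^sub>R x + sin d *\<^sub>R e"
    using great_circle[OF dim2 xy] unfolding d_def .
  define c where "c t = cos t *\<^sub>R x + sin t *\<^sub>R e" for t
  define g where "g t = V (c t) \<bullet> (cos t *\<^sub>R e - sin t *\<^sub>R x)" for t
  note F = f_great_circle[OF xy(1) e(1,2), folded c_def, folded g_def]
  have c0: "c t \<noteq> 0" for t using F(1)[of t] by auto
  have der: "((\<lambda>t. H (f (c t)) - t) has_real_derivative h (f (c t)) * g t - 1) (at t)" for t
  proof -
    have sub: "range (\<lambda>t. f (c t)) \<subseteq> {a..b}" using f_bounds[OF c0] by auto
    have "((\<lambda>t. H (f (c t))) has_real_derivative h (f (c t)) * g t) (at t)"
      using has_derivative_in_compose2[of "{a..b}" H "\<lambda>s. (*) (h s)" "\<lambda>t. f (c t)" UNIV t "(*) (g t)"]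
        H F(2)[of t] sub unfolding has_field_derivative_def
      by (simp add: mult.assoc[symmetric])
    then show ?thesis by (auto intro!: derivative_eq_intros)
  qed
  have "(\<lambda>t. H (f (c t)) - t) d \<le> (\<lambda>t. H (f (c t)) - t) 0"
  proof (rule DERIV_nonpos_imp_nonincreasing[OF d])
    fix t
    have fb: "f (c t) \<in> {a..b}" using f_bounds[OF c0] .
    have "h (f (c t)) * g t \<le> h (f (c t)) * sqrt (A (f (c t)))"
      using F(3)[of t] h(1)[OF fb] by (intro mult_left_mono) auto
    then show "\<exists>y. ((\<lambda>t. H (f (c t)) - t) has_real_derivative y) (at t) \<and> y \<le> 0"
      using der[of t] h(2)[OF fb] by (intro exI[of _ "h (f (c t)) * g t - 1"]) simp
  qed
  moreover have "c d = y" "c 0 = x" by (simp_all add: c_def e(3)[symmetric])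
  ultimately show ?thesis by (simp add: d_def)
qed

text \<open>The function \<open>1 / sqrt A\<close> is the time per unit of value for a unit speed motion along the gradient.
  Its singularities at zeros of \<open>A\<close> are removed by the parameter \<open>e\<close>.\<close>

definition "reg_slowness e s = 1 / sqrt (A s + e\<^sup>2)"

lemma reg_slowness_cont: "e > 0 \<Longrightarrow> continuous_on {a..b} (reg_slowness e)"
  unfolding reg_slowness_def using A_nonneg A_cont
  by (intro continuous_intros ballI) (auto simp: add_nonneg_eq_0_iff)

lemma reg_slowness_pos: "s \<in> {a..b} \<Longrightarrow> e > 0 \<Longrightarrow> reg_slowness e s > 0"
  using A_nonneg[of s] by (simp add: reg_slowness_def add_nonneg_pos)

lemma path_bound_reg_slowness:
  assumes "e > 0" "norm x = 1" "norm y = 1"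
  shows "integral {a..f y} (reg_slowness e) - integral {a..f x} (reg_slowness e) \<le> arccos (x \<bullet> y)"
proof (rule path_bound[where H="\<lambda>s. integral {a..s} (reg_slowness e)" and h="reg_slowness e"])
  fix s assume s: "s \<in> {a..b}"
  show "((\<lambda>s. integral {a..s} (reg_slowness e)) has_real_derivative reg_slowness e s) (at s within {a..b})"
    by (rule integral_has_real_derivative[OF reg_slowness_cont[OF assms(1)] s])
  show "0 \<le> reg_slowness e s" using reg_slowness_pos[OF s assms(1)] by simp
  have "sqrt (A s) \<le> sqrt (A s + e\<^sup>2)" by simp
  moreover have "sqrt (A s + e\<^sup>2) > 0" using A_nonneg[OF s] assms(1) by (simp add: add_nonneg_pos)
  ultimately show "reg_slowness e s * sqrt (A s) \<le> 1" by (simp add: reg_slowness_def)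
qed (use assms in auto)

lemma integral_reg_slowness_le_pi:
  assumes "e > 0" shows "integral {a..b} (reg_slowness e) \<le> pi"
proof -
  obtain x where x: "norm x = 1" "f x = a" using f_onto[of a] ab by auto
  obtain y where y: "norm y = 1" "f y = b" using f_onto[of b] ab by auto
  have "arccos (x \<bullet> y) \<le> pi"
    using Cauchy_Schwarz_ineq2[of x y] x y by (intro arccos_ubound) auto
  then show ?thesis using path_bound_reg_slowness[OF assms x(1) y(1)] x(2) y(2) by simp
qed

text \<open>At an interior zero the nonnegative function \<open>A\<close> has a minimum, hence a zero of second order.  Then the
  integral of \<open>1 / sqrt A\<close> across this zero diverges, whereas a great circle of length at most \<open>pi\<close>
  connects the two focal sets.\<close>

lemma A_pos:
  assumes s0: "s0 \<in> {a<..<b}" shows "A s0 > 0"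
proof (rule ccontr)
  assume "\<not> A s0 > 0"
  then have A0: "A s0 = 0" using A_nonneg[of s0] s0 by simp
  have "A' s0 = 0"
  proof (rule DERIV_local_min[OF A_der[OF s0]])
    show "0 < min (s0 - a) (b - s0)" using s0 by simp
    show "\<forall>y. \<bar>s0 - y\<bar> < min (s0 - a) (b - s0) \<longrightarrow> A s0 \<le> A y" using A_nonneg A0 by (auto simp: abs_if split: if_splits)
  qed
  obtain A'' where "(A' has_real_derivative A'') (at s0)"
    using A'_diff[OF s0] real_differentiable_def by blast
  then have "((\<lambda>h. (A' (s0 + h) - A' s0) / h) \<longlongrightarrow> A'') (at 0)" by (simp add: DERIV_def)
  from tendstoD[OF this, of 1] obtain d where d: "d > 0"
    "\<And>h. h \<noteq> 0 \<Longrightarrow> \<bar>h\<bar> < d \<Longrightarrow> \<bar>(A' (s0 + h) - A' s0) / h - A''\<bar> < 1"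
    by (auto simp: eventually_at dist_real_def)
  define C where "C = \<bar>A''\<bar> + 1"
  have C: "C > 0" by (simp add: C_def)
  have A'_le: "A' (s0 + h) \<le> C * h" if "0 < h" "h < d" for h
  proof -
    have "\<bar>A' (s0 + h) / h\<bar> \<le> C" using d(2)[of h] that \<open>A' s0 = 0\<close> by (simp add: C_def)
    then have "A' (s0 + h) / h \<le> C" by linarith
    then show ?thesis using that by (simp add: divide_le_eq)
  qed
  define s1 where "s1 = min ((s0 + b) / 2) (s0 + d / 2)"
  have s1: "s0 < s1" "s1 < b" "s1 < s0 + d" using s0 d(1) by (auto simp: s1_def min_def)
  define c where "c = sqrt C"
  have c: "c > 0" using C by (simp add: c_def)
  have quad: "A s \<le> (c * (s - s0))\<^sup>2" if s: "s \<in> {s0..s1}" for s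
  proof (cases "s = s0")
    case False
    then have "s0 < s" using s by simp
    have "\<exists>z. s0 < z \<and> z < s \<and> A s - A s0 = (s - s0) * A' z"
      by (rule MVT2[OF \<open>s0 < s\<close>]) (use s s0 s1 A_der in auto)
    then obtain z where z: "s0 < z" "z < s" "A s = (s - s0) * A' z" using A0 by auto
    have "A' z \<le> C * (z - s0)" using A'_le[of "z - s0"] z s s1 by simp
    also have "\<dots> \<le> C * (s - s0)" using z C by simp
    finally have "A s \<le> (s - s0) * (C * (s - s0))" using z \<open>s0 < s\<close> by (simp add: mult_left_mono)
    also have "\<dots> = (c * (s - s0))\<^sup>2" using C by (simp add: c_def power_mult_distrib power2_eq_square)
    finally show ?thesis .
  qed (simp add: A0)
  define D where "D = c * (s1 - s0)"
  have D: "D > 0" using c s1 by (simp add: D_def)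
  \<comment> \<open>With this \<open>e\<close> the logarithmic lower bound exceeds \<open>pi\<close>.\<close>
  define e where "e = D * exp (- (c * pi + 1))"
  have e: "e > 0" using D by (simp add: e_def)
  have "ln ((D + e) / e) / c \<le> integral {a..b} (reg_slowness e)"
    unfolding reg_slowness_def D_def
    by (rule integral_inverse_sqrt_lower_bound) (use s0 s1 c e A_cont A_nonneg quad in auto)
  also have "\<dots> \<le> pi" by (rule integral_reg_slowness_le_pi[OF e])
  finally have "ln ((D + e) / e) \<le> c * pi" using c by (simp add: divide_le_eq mult.commute)
  moreover have "ln (D / e) \<le> ln ((D + e) / e)" using D e by (simp add: divide_right_mono)
  moreover have "D / e = exp (c * pi + 1)" using D unfolding e_def exp_minus by (simp add: divide_simps)
  ultimately show False by simp
qed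

definition "slowness s = (if s \<in> {a<..<b} then 1 / sqrt (A s) else 0)"

text \<open>The arc length of a gradient line between the levels \<open>a\<close> and \<open>s\<close>.\<close>

definition "W s = integral {a..s} slowness"

text \<open>The regularised integrals increase to the improper one and stay below \<open>pi\<close>, so monotone convergence
  also yields the integrability of \<open>1 / sqrt A\<close> up to the end points.\<close>

lemma W_limit:
  assumes "s \<in> {a..b}"
  shows "slowness integrable_on {a..s}" "(\<lambda>k. integral {a..s} (reg_slowness (inverse (real (Suc k))))) \<longlonglongrightarrow> W s"
proof -
  let ?e = "\<lambda>k. inverse (real (Suc k))"
  have "slowness integrable_on {a<..<s} \<and> (\<lambda>k. integral {a<..<s} (reg_slowness (?e k))) \<longlonglongrightarrow> integral {a<..<s} slowness"
  proof (rule monotone_convergence_increasing)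
    have int: "reg_slowness (?e k) integrable_on {a..s}" for k
      by (intro integrable_continuous_real continuous_on_subset[OF reg_slowness_cont]) (use assms in auto)
    then show "reg_slowness (?e k) integrable_on {a<..<s}" for k by (simp add: integrable_on_open_interval_real)
    show "reg_slowness (?e k) x \<le> reg_slowness (?e (Suc k)) x" if "x \<in> {a<..<s}" for k x
    proof -
      have "?e (Suc k) \<le> ?e k" by (simp add: le_imp_inverse_le)
      then have "(?e (Suc k))\<^sup>2 \<le> (?e k)\<^sup>2" by (intro power_mono) auto
      moreover have "A x + (?e (Suc k))\<^sup>2 > 0" using A_nonneg[of x] that assms by (intro add_nonneg_pos) auto
      moreover from this have "A x + (?e k)\<^sup>2 > 0" using calculation by linarith
      ultimately show ?thesis unfolding reg_slowness_def by (intro divide_left_mono mult_pos_pos) simp_all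
    qed
    show "(\<lambda>k. reg_slowness (?e k) x) \<longlonglongrightarrow> slowness x" if x: "x \<in> {a<..<s}" for x
    proof -
      have "x \<in> {a<..<b}" using x assms by auto
      moreover have "(\<lambda>k. 1 / sqrt (A x + (?e k)\<^sup>2)) \<longlonglongrightarrow> 1 / sqrt (A x + 0\<^sup>2)"
        using A_pos[OF calculation] by (intro tendsto_intros LIMSEQ_inverse_real_of_nat) auto
      ultimately show ?thesis by (simp add: reg_slowness_def slowness_def)
    qed
    have "norm (integral {a<..<s} (reg_slowness (?e k))) \<le> pi" for k
    proof -
      have "integral {a..s} (reg_slowness (?e k)) \<le> integral {a..b} (reg_slowness (?e k))"
        using assms int reg_slowness_pos[of _ "?e k"]
        by (intro integral_subset_le int integrable_continuous_real[OF reg_slowness_cont]) (auto simp: less_imp_le)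
      moreover have "integral {a..s} (reg_slowness (?e k)) \<ge> 0"
        using assms int reg_slowness_pos[of _ "?e k"] by (intro integral_nonneg) (auto simp: less_imp_le)
      ultimately show ?thesis using integral_reg_slowness_le_pi[of "?e k"] by (simp add: integral_open_interval_real[symmetric])
    qed
    then show "bounded (range (\<lambda>k. integral {a<..<s} (reg_slowness (?e k))))" by (auto simp: bounded_iff)
  qed
  then show "slowness integrable_on {a..s}" "(\<lambda>k. integral {a..s} (reg_slowness (?e k))) \<longlonglongrightarrow> W s"
    by (auto simp: integrable_on_open_interval_real integral_open_interval_real W_def)
qed

lemma W_lipschitz:
  assumes "norm x = 1" "norm y = 1"
  shows "W (f y) - W (f x) \<le> arccos (x \<bullet> y)"
proof (rule LIMSEQ_le_const2)
  have "f x \<in> {a..b}" "f y \<in> {a..b}" using assms f_bounds by (metis norm_zero zero_neq_one)+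
  then show "(\<lambda>k. integral {a..f y} (reg_slowness (inverse (real (Suc k)))) - integral {a..f x} (reg_slowness (inverse (real (Suc k)))))
      \<longlonglongrightarrow> W (f y) - W (f x)"
    by (intro tendsto_diff W_limit)
qed (use path_bound_reg_slowness[OF _ assms] in auto)

lemma W_a [simp]: "W a = 0"
  by (simp add: W_def)

lemma W_cont: "continuous_on {a..b} W"
  unfolding W_def using W_limit(1)[of b] ab by (intro indefinite_integral_continuous_1) auto

lemma W_der:
  assumes "s \<in> {a<..<b}" shows "(W has_real_derivative 1 / sqrt (A s)) (at s)"
proof -
  have "continuous_on {a<..<b} slowness"
  proof (rule continuous_on_eq)
    show "continuous_on {a<..<b} (\<lambda>s. 1 / sqrt (A s))"
      using A_pos by (intro continuous_intros continuous_on_subset[OF A_cont]) force+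
  qed (simp add: slowness_def)
  then have "isCont slowness s" using assms by (simp add: continuous_on_eq_continuous_at)
  then have cq: "continuous (at s within {a..b} - {}) slowness"
    by (rule continuous_at_imp_continuous_at_within)
  have s: "s \<in> {a..b} - {}" and b: "b \<in> {a..b}" using assms ab by auto
  have "((\<lambda>u. integral {a..u} slowness) has_vector_derivative slowness s) (at s within {a..b} - {})"
    by (rule integral_has_vector_derivative_continuous_at[OF W_limit(1)[OF b] s finite.emptyI cq])
  then have "(W has_real_derivative slowness s) (at s within {a..b})"
    unfolding has_real_derivative_iff_has_vector_derivative W_def[abs_def] Diff_empty .
  moreover have "at s within {a..b} = at s"
    using assms by (intro at_within_interior) (simp add: interior_atLeastAtMost_real)
  ultimately show ?thesis using assms by (simp add: slowness_def)
qed

lemma W_less: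
  assumes "a \<le> s" "s < t" "t \<le> b" shows "W s < W t"
proof (rule DERIV_pos_imp_increasing_open[OF assms(2)])
  show "\<exists>y. (W has_real_derivative y) (at x) \<and> 0 < y" if "s < x" "x < t" for x
    using W_der[of x] A_pos[of x] that assms by (intro exI[of _ "1 / sqrt (A x)"]) auto
  show "continuous_on {s..t} W" using continuous_on_subset[OF W_cont] assms by auto
qed

lemma W_b_le_pi: "W b \<le> pi"
proof -
  obtain x where x: "norm x = 1" "f x = a" using f_onto[of a] ab by auto
  obtain y where y: "norm y = 1" "f y = b" using f_onto[of b] ab by auto
  have "arccos (x \<bullet> y) \<le> pi"
    using Cauchy_Schwarz_ineq2[of x y] x y by (intro arccos_ubound) auto
  then show ?thesis using W_lipschitz[OF x(1) y(1)] x(2) y(2) by simp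
qed

lemma f_cont: "continuous_on (- {0}) f"
  using f_der by (auto intro!: continuous_at_imp_continuous_on has_derivative_continuous)

lemma f_borel: "f \<in> borel_measurable borel"
proof -
  have "(\<lambda>x. indicator (- {0}) x *\<^sub>R f x) \<in> borel_measurable borel"
    by (rule borel_measurable_continuous_on_indicator[OF _ f_cont]) auto
  then have "(\<lambda>x. indicator (- {0}) x *\<^sub>R f x + indicator {0} x *\<^sub>R f 0) \<in> borel_measurable borel"
    by (rule borel_measurable_add) auto
  moreover have eq: "(\<lambda>x. indicator (- {0}) x *\<^sub>R f x + indicator {0} x *\<^sub>R f 0) = f"
    by (auto simp: fun_eq_iff indicator_def)
  ultimately show ?thesis unfolding eq by blast
qed

lemma norm1_nonzero: "norm x = 1 \<Longrightarrow> x \<noteq> (0::'a)" by auto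

text \<open>The lower bound for the distance is the Lipschitz bound for \<open>W o f\<close>.  The upper bound is what
  following a gradient line from \<open>x\<close> would give; a minimiser \<open>y\<close> of \<open>W (f y) + (1 - e) arccos (x \<bullet> y)\<close>
  serves instead of the line.  Off the level \<open>a\<close>, a step from \<open>y\<close> in the direction of steepest
  descent lowers the first term at unit rate and raises the second at a rate of at most \<open>1 - e\<close>, which is
  impossible; so \<open>y\<close> lies on the level \<open>a\<close>, and comparing with \<open>y = x\<close> bounds the distance.\<close>

lemma distance_to_level_a:
  assumes x: "norm x = 1" "f x < b"
  shows "(INF p\<in>{p \<in> sphere 0 1. f p = a}. arccos (x \<bullet> p)) = W (f x)"
proof (rule antisym)
  let ?M = "{p \<in> sphere 0 1. f p = a}"
  have ne: "?M \<noteq> {}" using f_onto[of a] ab by (metis (mono_tags, lifting) atLeastAtMost_iff empty_iff less_imp_le mem_Collect_eq mem_sphere_0 order_refl)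
  have low: "W (f x) \<le> arccos (x \<bullet> p)" if "p \<in> ?M" for p
    using W_lipschitz[of p x] that x by (simp add: inner_commute)
  then show "W (f x) \<le> (INF p\<in>?M. arccos (x \<bullet> p))" using ne by (intro cINF_greatest)
  have bdd: "bdd_below ((\<lambda>p. arccos (x \<bullet> p)) ` ?M)" using low by (intro bdd_belowI2)
  have fb: "f y \<in> {a..b}" if "norm y = 1" for y using f_bounds[OF norm1_nonzero[OF that]] .
  have "(1 - e) * (INF p\<in>?M. arccos (x \<bullet> p)) \<le> W (f x)" if e: "0 < e" "e < 1" for e
  proof -
    let ?P = "\<lambda>y. W (f y) + (1 - e) * arccos (x \<bullet> y)"
    have ip: "\<bar>x \<bullet> y\<bar> \<le> 1" if "norm y = 1" for y using Cauchy_Schwarz_ineq2[of x y] x that by simp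
    have "continuous_on (sphere 0 1) ?P"
    proof (intro continuous_intros)
      show "continuous_on (sphere 0 1) (\<lambda>y. W (f y))"
        by (rule continuous_on_compose2[OF W_cont continuous_on_subset[OF f_cont]]) (use fb in auto)
      show "\<forall>y\<in>sphere 0 1. - 1 \<le> x \<bullet> y \<and> x \<bullet> y \<le> 1" using ip by (auto simp: abs_le_iff)
    qed
    moreover have "sphere (0::'a) 1 \<noteq> {}" using x(1) by (metis empty_iff mem_sphere_0)
    ultimately have "\<exists>y\<in>sphere 0 1. \<forall>z\<in>sphere 0 1. ?P y \<le> ?P z"
      by (intro continuous_attains_inf compact_sphere)
    then obtain y where y: "norm y = 1" and "\<forall>z\<in>sphere 0 1. ?P y \<le> ?P z" by auto
    then have ymin: "?P y \<le> ?P z" if "norm z = 1" for z using that by simp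
    have "x \<bullet> x = 1" using x by (simp add: dot_square_norm)
    then have Px: "?P x = W (f x)" by simp
    have d0: "arccos (x \<bullet> y) \<ge> 0" using ip[OF y] by (intro arccos_lbound) auto
    have "W (f y) \<le> ?P y" using d0 e by simp
    also have "\<dots> \<le> W (f x)" using ymin[OF x(1)] Px by simp
    finally have "f y < b" using W_less[of "f x" "f y"] fb[OF x(1)] fb[OF y] x(2) by force
    have "f y = a"
    proof (rule ccontr)
      assume "f y \<noteq> a"
      then have reg: "f y \<in> {a<..<b}" using fb[OF y] \<open>f y < b\<close> by simp
      \<comment> \<open>the unit vector of steepest descent\<close>
      define X where "X = - (1 / sqrt (A (f y))) *\<^sub>R V y"
      have VV: "V y \<bullet> V y = A (f y)" using V_norm[OF norm1_nonzero[OF y]] y by simp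
      have X: "norm X = 1" "y \<bullet> X = 0"
      proof -
        have "X \<bullet> X = 1" using A_pos[OF reg] by (simp add: X_def VV)
        then show "norm X = 1" by (simp add: norm_eq_sqrt_inner)
        show "y \<bullet> X = 0" using V_radial[OF norm1_nonzero[OF y]] by (simp add: X_def inner_commute)
      qed
      define c where "c t = cos t *\<^sub>R y + sin t *\<^sub>R X" for t
      note F = f_great_circle[OF y X, folded c_def]
      have "V y \<bullet> X = - sqrt (A (f y))"
        using A_pos[OF reg] by (simp add: X_def VV real_div_sqrt)
      then have fc: "((\<lambda>t. f (c t)) has_real_derivative - sqrt (A (f y))) (at 0)"
        using F(2)[of 0] by (simp add: c_def)
      have "((\<lambda>t. W (f (c t)) + (1 - e) * t) has_real_derivative
          (1 / sqrt (A (f y))) * (- sqrt (A (f y))) + (1 - e)) (at 0)"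
      proof -
        have "(W has_real_derivative 1 / sqrt (A (f y))) (at (f (c 0)))"
          using W_der[OF reg] by (simp add: c_def)
        from DERIV_chain2[OF this fc] show ?thesis
          by (rule DERIV_add) (auto intro!: derivative_eq_intros)
      qed
      moreover have "(1 / sqrt (A (f y))) * (- sqrt (A (f y))) + (1 - e) < 0" using A_pos[OF reg] e by simp
      ultimately obtain d where d: "d > 0"
        "\<And>t. 0 < t \<Longrightarrow> t < d \<Longrightarrow> W (f (c (0 + t))) + (1 - e) * (0 + t) < W (f (c 0)) + (1 - e) * 0"
        using DERIV_neg_dec_right by blast
      define t where "t = min (d / 2) 1"
      have t: "0 < t" "t < d" using d(1) by (auto simp: t_def)
      \<comment> \<open>a triangle inequality on the sphere\<close>
      have "arccos (x \<bullet> c t) \<le> arccos (x \<bullet> y) + t"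
      proof (cases "arccos (x \<bullet> y) + t \<le> pi")
        case False
        then show ?thesis using arccos_ubound[of "x \<bullet> c t"] ip[OF F(1)[of t]] by (simp add: abs_le_iff)
      next
        case True
        let ?d = "arccos (x \<bullet> y)"
        have "\<bar>x \<bullet> X\<bar> \<le> sin ?d"
        proof -
          have "(x \<bullet> X)\<^sup>2 + (x \<bullet> y)\<^sup>2 \<le> 1"
          proof -
            have XX: "X \<bullet> X = 1" "y \<bullet> y = 1" using X y by (simp_all add: dot_square_norm)
            let ?z = "x - (x \<bullet> X) *\<^sub>R X - (x \<bullet> y) *\<^sub>R y"
            have "0 \<le> ?z \<bullet> ?z" by simp
            also have "?z \<bullet> ?z = 1 - (x \<bullet> X)\<^sup>2 - (x \<bullet> y)\<^sup>2"
              using X(2) \<open>x \<bullet> x = 1\<close>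
              by (simp add: inner_diff_left inner_diff_right XX inner_commute power2_eq_square)
            finally show ?thesis by simp
          qed
          then have "\<bar>x \<bullet> X\<bar> \<le> sqrt (1 - (x \<bullet> y)\<^sup>2)" by (intro real_le_rsqrt) simp
          then show ?thesis using ip[OF y] by (simp add: sin_arccos_abs)
        qed
        then have "- sin ?d \<le> x \<bullet> X" by linarith
        moreover have "sin t \<ge> 0" using t(1) True d0 by (intro sin_ge_zero) auto
        ultimately have "sin t * (- sin ?d) \<le> sin t * (x \<bullet> X)" by (rule mult_left_mono)
        then have "cos (?d + t) \<le> x \<bullet> c t"
          using ip[OF y] by (simp add: c_def cos_add inner_add_right cos_arccos_abs mult.commute)
        then have "arccos (x \<bullet> c t) \<le> arccos (cos (?d + t))"
          using ip[OF F(1)[of t]] by (intro arccos_le_arccos) (auto simp: abs_le_iff)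
        then show ?thesis using True d0 t by (simp add: arccos_cos)
      qed
      then have "(1 - e) * arccos (x \<bullet> c t) \<le> (1 - e) * arccos (x \<bullet> y) + (1 - e) * t"
        using e mult_left_mono[of "arccos (x \<bullet> c t)" "arccos (x \<bullet> y) + t" "1 - e"] by (simp add: distrib_left)
      moreover have "W (f (c t)) + (1 - e) * t < W (f y)" using d(2)[OF t] by (simp add: c_def)
      ultimately have "?P (c t) < ?P y" by simp
      then show False using ymin[OF F(1)[of t]] by simp
    qed
    then have "(INF p\<in>?M. arccos (x \<bullet> p)) \<le> arccos (x \<bullet> y)"
      using y bdd by (intro cINF_lower) auto
    then have "(1 - e) * (INF p\<in>?M. arccos (x \<bullet> p)) \<le> (1 - e) * arccos (x \<bullet> y)"
      using e by (intro mult_left_mono) auto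
    also have "\<dots> = ?P y" using \<open>f y = a\<close> by simp
    also have "\<dots> \<le> W (f x)" using ymin[OF x(1)] Px by simp
    finally show ?thesis .
  qed
  then have 1: "\<forall>\<^sub>F e in at_right 0. (1 - e) * (INF p\<in>?M. arccos (x \<bullet> p)) \<le> W (f x)"
    using eventually_at_right_less by (auto simp: eventually_at_right_field intro!: exI[of _ 1])
  have 2: "((\<lambda>e. (1 - e) * (INF p\<in>?M. arccos (x \<bullet> p))) \<longlongrightarrow> (1 - 0) * (INF p\<in>?M. arccos (x \<bullet> p))) (at_right 0)"
    by (intro tendsto_intros)
  show "(INF p\<in>?M. arccos (x \<bullet> p)) \<le> W (f x)"
    using tendsto_upperbound[OF 2 1] by simp
qed

end

section \<open>Averages that are constant along gradient lines\<close>

lemma Ck_on_1_real: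
  fixes g :: "real \<Rightarrow> real"
  assumes "open U" "\<And>s. s \<in> U \<Longrightarrow> (g has_real_derivative g' s) (at s)" "continuous_on U g'"
  shows "Ck_on (Suc 0) U g"
proof (rule Ck_on_SucI[OF assms(1)])
  show "(g has_derivative (*) (g' s)) (at s)" if "s \<in> U" for s
    using assms(2)[OF that] by (simp add: has_field_derivative_def)
qed (simp add: assms(3) continuous_on_mult_right)

text \<open>Integrals over the sphere are replaced by integrals over Euclidean space against the radial weight
  \<open>k (x \<bullet> x)\<close>, which is supported in an annulus around the origin.  The gradient of a radial weight is
  orthogonal to the spheres, so it never contributes to a divergence of a tangential field.\<close>

locale cutoff_extension = isoparametric_extension +
  fixes k k' :: "real \<Rightarrow> real" and r u0 :: real
  assumes k_der: "(k has_real_derivative k' u) (at u)" and k'_cont: "continuous_on UNIV k'"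
    and k_nonneg: "k u \<ge> 0" and r_pos: "r > 0"
    and k_supp: "u < r \<or> 1 < u \<Longrightarrow> k u = 0" and k_pos: "k u0 > 0"
begin

definition "annulus = {x::'a. r \<le> x \<bullet> x \<and> x \<bullet> x \<le> 1}"

lemma compact_annulus: "compact annulus"
  unfolding compact_eq_bounded_closed
proof
  have "norm x \<le> 1" if "x \<in> annulus" for x
    using that by (simp add: annulus_def norm_eq_sqrt_inner)
  then show "bounded annulus" unfolding bounded_iff by blast
  show "closed annulus"
    unfolding annulus_def by (intro closed_Collect_conj closed_Collect_le continuous_intros)
qed

lemma annulus_nonzero: "annulus \<subseteq> - {0}"
  using r_pos by (auto simp: annulus_def)

lemma k_off_annulus: "x \<notin> annulus \<Longrightarrow> k (x \<bullet> x) = 0"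
  using k_supp by (auto simp: annulus_def not_le)

lemma k_cont: "continuous_on UNIV k"
  using k_der by (auto intro!: continuous_at_imp_continuous_on DERIV_isCont)

lemma kx_der: "((\<lambda>x::'a. k (x \<bullet> x)) has_derivative (\<lambda>h. k' (x \<bullet> x) * (2 * (x \<bullet> h)))) (at x)"
proof -
  have "((\<lambda>x::'a. x \<bullet> x) has_derivative (\<lambda>h. 2 * (x \<bullet> h))) (at x)"
    by (auto intro!: derivative_eq_intros simp: inner_commute)
  from has_derivative_compose[OF this k_der[unfolded has_field_derivative_def]] show ?thesis .
qed

lemma continuous_on_compose_UNIV:
  "continuous_on UNIV g \<Longrightarrow> continuous_on S h \<Longrightarrow> continuous_on S (\<lambda>x. g (h x))"
  by (erule continuous_on_compose2) auto

definition "I g = (LINT x|lborel. k (x \<bullet> x) * g (x::'a))"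

lemma I_integrable_compact:
  assumes "compact K" "continuous_on K g" "\<And>x. x \<in> annulus \<Longrightarrow> x \<notin> K \<Longrightarrow> g x = 0"
  shows "integrable lborel (\<lambda>x. k (x \<bullet> x) * g x)"
proof -
  have "continuous_on K (\<lambda>x. k (x \<bullet> x) * g x)"
    by (intro continuous_intros assms(2) continuous_on_compose_UNIV[OF k_cont])
  moreover have "(\<lambda>x. indicator K x *\<^sub>R (k (x \<bullet> x) * g x)) = (\<lambda>x. k (x \<bullet> x) * g x)"
    using assms(3) k_off_annulus by (auto simp: fun_eq_iff indicator_def)
  ultimately show ?thesis
    using borel_integrable_compact[OF assms(1)] by metis
qed

lemma I_integrable:
  assumes "continuous_on (- {0}) g" shows "integrable lborel (\<lambda>x::'a. k (x \<bullet> x) * g x)"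
  by (rule I_integrable_compact[OF compact_annulus continuous_on_subset[OF assms annulus_nonzero]]) simp

definition "reg = {x. x \<noteq> 0 \<and> f x \<in> {a<..<b}}"

lemma open_reg: "open reg"
proof -
  have "open (- {0} \<inter> f -` {a<..<b})"
    by (rule continuous_open_preimage[OF f_cont]) auto
  moreover have "- {0} \<inter> f -` {a<..<b} = reg" by (auto simp: reg_def)
  ultimately show ?thesis by simp
qed

text \<open>Composed with \<open>f\<close>, these functions vanish near the focal sets, where the unit normal is undefined.\<close>

definition "test \<zeta> \<longleftrightarrow> continuous_on UNIV \<zeta> \<and>
  (\<exists>c d. a < c \<and> d < b \<and> (\<forall>s. s \<notin> {c..d} \<longrightarrow> \<zeta> s = (0::real)))"

lemma test_cont: "test \<zeta> \<Longrightarrow> continuous_on UNIV \<zeta>"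
  by (simp add: test_def)

lemma compact_reg_part: "compact (annulus \<inter> f -` {c..d})"
proof -
  have "closed (annulus \<inter> f -` {c..d})"
    by (rule continuous_closed_preimage[OF continuous_on_subset[OF f_cont annulus_nonzero]
          compact_imp_closed[OF compact_annulus]]) simp
  then have "compact (annulus \<inter> (annulus \<inter> f -` {c..d}))"
    by (rule compact_Int_closed[OF compact_annulus])
  then show ?thesis by (simp add: Int_assoc[symmetric])
qed

lemma I_integrable_test:
  assumes "test \<zeta>" "continuous_on reg g"
  shows "integrable lborel (\<lambda>x. k (x \<bullet> x) * (\<zeta> (f x) * g x))"
proof -
  obtain c d where cd: "a < c" "d < b" "\<And>s. s \<notin> {c..d} \<Longrightarrow> \<zeta> s = 0"
    using assms(1) by (auto simp: test_def)
  have sub: "annulus \<inter> f -` {c..d} \<subseteq> reg"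
    using annulus_nonzero cd by (auto simp: reg_def)
  show ?thesis
  proof (rule I_integrable_compact[OF compact_reg_part[of c d]])
    have "continuous_on (annulus \<inter> f -` {c..d}) f"
      using annulus_nonzero by (intro continuous_on_subset[OF f_cont]) auto
    then show "continuous_on (annulus \<inter> f -` {c..d}) (\<lambda>x. \<zeta> (f x) * g x)"
      by (intro continuous_on_mult continuous_on_compose_UNIV[OF test_cont[OF assms(1)]]
          continuous_on_subset[OF assms(2) sub])
  qed (use cd(3) in auto)
qed

lemma continuous_on_UNIV_supp:
  assumes "continuous_on {a<..<b} w" "a < c" "d < b" "\<And>s. s \<notin> {c..d} \<Longrightarrow> w s = (0::real)"
  shows "continuous_on UNIV w"
proof -
  have "continuous_on (- {c..d}) w"
    by (rule continuous_on_eq[of _ "\<lambda>s. 0"]) (use assms(4) in auto)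
  then have "continuous_on ({a<..<b} \<union> - {c..d}) w"
    using assms(1) by (intro continuous_on_open_Un) auto
  moreover have "{a<..<b} \<union> - {c..d} = UNIV" using assms(2,3) by auto
  ultimately show ?thesis by simp
qed

lemma test_mult:
  assumes "test \<zeta>" "continuous_on {a<..<b} w"
  shows "test (\<lambda>s. \<zeta> s * w s)"
proof -
  obtain c d where cd: "a < c" "d < b" "\<And>s. s \<notin> {c..d} \<Longrightarrow> \<zeta> s = 0"
    using assms(1) by (auto simp: test_def)
  have "continuous_on {a<..<b} \<zeta>"
    using continuous_on_subset[OF test_cont[OF assms(1)]] by simp
  then have "continuous_on {a<..<b} (\<lambda>s. \<zeta> s * w s)"
    by (intro continuous_on_mult assms(2))
  moreover have "\<zeta> s * w s = 0" if "s \<notin> {c..d}" for s using cd(3)[OF that] by simp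
  ultimately have "continuous_on UNIV (\<lambda>s. \<zeta> s * w s)"
    by (intro continuous_on_UNIV_supp[OF _ cd(1,2)])
  then show ?thesis using cd by (auto simp: test_def)
qed

text \<open>Functions that are constant along the gradient lines, in the infinitesimal form available without a
  flow.\<close>

definition "flow_invariant g \<longleftrightarrow> Ck_on (Suc 0) reg g \<and>
  (\<forall>x\<in>reg. frechet_derivative g (at x) (V x) = 0)"

text \<open>The integrand is the divergence of the field \<open>k (x \<bullet> x) |x|\<^sup>2 \<eta> (f x) g x V x\<close>: neither the radial
  factor nor \<open>g\<close> varies in the direction \<open>V\<close>, and the isoparametric equations turn \<open>|V|\<^sup>2\<close> and the
  divergence of \<open>V\<close> into functions of \<open>f\<close>.\<close>

lemma flow_integral:
  assumes g: "flow_invariant g" and cd: "a < c" "d < b" "\<And>s. s \<notin> {c..d} \<Longrightarrow> \<eta> s = 0"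
    and \<eta>: "\<And>s. (\<eta> has_real_derivative \<eta>' s) (at s)" "continuous_on UNIV \<eta>'"
  shows "I (\<lambda>x. (\<eta>' (f x) * A (f x) - \<eta> (f x) * B (f x)) * g x) = 0"
proof -
  let ?g' = "\<lambda>x. frechet_derivative g (at x)"
  let ?F = "\<lambda>x. k (x \<bullet> x) * ((x \<bullet> x) * (\<eta> (f x) * g x))"
  let ?F' = "\<lambda>x h. k' (x \<bullet> x) * (2 * (x \<bullet> h)) * ((x \<bullet> x) * (\<eta> (f x) * g x))
     + k (x \<bullet> x) * ((2 * (x \<bullet> h)) * (\<eta> (f x) * g x)
        + (x \<bullet> x) * (\<eta>' (f x) * (V x \<bullet> h) * g x + \<eta> (f x) * ?g' x h))"
  let ?D = "\<lambda>x. k (x \<bullet> x) * ((\<eta>' (f x) * A (f x) - \<eta> (f x) * B (f x)) * g x)"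
  let ?K = "annulus \<inter> f -` {c..d}"
  have Ksub: "?K \<subseteq> reg" using annulus_nonzero cd by (auto simp: reg_def)
  have \<eta>'0: "\<eta>' s = 0" if "s \<notin> {c..d}" for s
  proof -
    have "(\<eta> has_real_derivative 0) (at s)"
      by (rule has_field_derivative_transform_within_open[of "\<lambda>_. 0" _ _ "- {c..d}"])
         (use cd(3) that in auto)
    then show ?thesis using \<eta>(1)[of s] DERIV_unique by blast
  qed
  have \<eta>_cont: "continuous_on UNIV \<eta>"
    using \<eta>(1) by (auto intro!: continuous_at_imp_continuous_on DERIV_isCont)
  have reg0: "x \<noteq> 0" if "x \<in> reg" for x using that by (simp add: reg_def)
  have g_der: "(g has_derivative ?g' x) (at x)" if "x \<in> reg" for x
    using g has_derivative_Ck_on[OF open_reg _ that] unfolding flow_invariant_def by blast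
  have V_cont: "continuous_on reg V"
    using V_der reg0 by (auto intro!: continuous_at_imp_continuous_on has_derivative_continuous)
  have g_cont: "continuous_on reg g" "continuous_on reg (\<lambda>x. ?g' x h)" for h
    using g Ck_on_imp_continuous_on[of "Suc 0" reg g] unfolding flow_invariant_def by simp_all
  have fr: "continuous_on reg f" using reg0 by (intro continuous_on_subset[OF f_cont]) auto
  have "(LINT x|lborel. ?D x) = 0"
  proof (rule integral_divergence_zero(2)[OF open_reg compact_reg_part[of c d] Ksub])
    show "?F x = 0" if "x \<in> reg" "x \<notin> ?K" for x
      using that cd(3)[of "f x"] k_off_annulus[of x] by auto
    show "(?F has_derivative ?F' x) (at x)" if x: "x \<in> reg" for x
    proof -
      have "((\<lambda>x. \<eta> (f x)) has_derivative (\<lambda>h. \<eta>' (f x) * (V x \<bullet> h))) (at x)"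
        using has_derivative_compose[OF f_der[OF reg0[OF x]] \<eta>(1)[unfolded has_field_derivative_def]] .
      note this[derivative_intros] g_der[OF x, derivative_intros] kx_der[derivative_intros]
      have xx: "((\<lambda>x. x \<bullet> x) has_derivative (\<lambda>h. 2 * (x \<bullet> h))) (at x)"
        by (auto intro!: derivative_eq_intros simp: inner_commute)
      note this[derivative_intros]
      show ?thesis
        by (rule has_derivative_eq_rhs, (rule derivative_intros)+) (simp add: fun_eq_iff algebra_simps)
    qed
    show "continuous_on reg (\<lambda>x. ?F' x h)" for h
      by (intro continuous_intros V_cont g_cont fr continuous_on_compose_UNIV[OF k_cont]
          continuous_on_compose_UNIV[OF k'_cont] continuous_on_compose_UNIV[OF \<eta>_cont]
          continuous_on_compose_UNIV[OF \<eta>(2)])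
    show "(V has_derivative DV x) (at x)" if "x \<in> reg" for x using V_der reg0[OF that] by simp
    show "continuous_on reg (\<lambda>x. DV x h)" for h
      using reg0 by (intro continuous_on_subset[OF DV_cont]) auto
    show "?D x = (if x \<in> reg then ?F' x (V x) + ?F x * (\<Sum>b\<in>Basis. DV x b \<bullet> b) else 0)" for x
    proof (cases "x \<in> reg")
      case True
      have 1: "(x \<bullet> x) * (V x \<bullet> V x) = A (f x)" "(x \<bullet> x) * (\<Sum>b\<in>Basis. DV x b \<bullet> b) = - B (f x)"
        using V_norm[OF reg0[OF True]] V_div[OF reg0[OF True]] by (simp_all add: dot_square_norm)
      have 2: "x \<bullet> V x = 0" using V_radial[OF reg0[OF True]] by (simp add: inner_commute)
      have 3: "?g' x (V x) = 0" using g True by (simp add: flow_invariant_def)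
      have "?F' x (V x) + ?F x * (\<Sum>b\<in>Basis. DV x b \<bullet> b) =
         k (x \<bullet> x) * (\<eta>' (f x) * ((x \<bullet> x) * (V x \<bullet> V x)) * g x
           + \<eta> (f x) * g x * ((x \<bullet> x) * (\<Sum>b\<in>Basis. DV x b \<bullet> b)))"
        by (simp add: 2 3 algebra_simps)
      also have "\<dots> = ?D x" unfolding 1 by (simp add: algebra_simps)
      finally show ?thesis using True by simp
    next
      case False
      then have "x \<notin> annulus \<or> f x \<notin> {c..d}" using Ksub by auto
      then show ?thesis using False cd(3)[of "f x"] \<eta>'0[of "f x"] k_off_annulus[of x] by auto
    qed
  qed
  then show ?thesis by (simp add: I_def)
qed

lemma B_over_A_cont: "continuous_on {a<..<b} (\<lambda>s. B s / A s)"
  using A_pos by (intro continuous_intros continuous_on_subset[OF A_cont] continuous_on_subset[OF B_cont])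
    force+

text \<open>The distribution of the values of \<open>f\<close> has a density that is a multiple of \<open>1 / (\<theta> A)\<close>.\<close>

lemma weight_exists:
  "\<exists>\<theta>. (\<forall>s\<in>{a<..<b}. (\<theta> has_real_derivative \<theta> s * (B s / A s)) (at s)) \<and> (\<forall>s. \<theta> s > 0)"
proof -
  have c: "isCont (\<lambda>s. B s / A s) s" if "ereal a < ereal s" "ereal s < ereal b" for s
    using B_over_A_cont that by (simp add: continuous_on_eq_continuous_at)
  obtain L where L: "\<And>s. a < s \<Longrightarrow> s < b \<Longrightarrow> (L has_vector_derivative (B s / A s)) (at s)"
    using einterval_antiderivative[of "ereal a" "ereal b" "\<lambda>s. B s / A s"] c ab by auto
  show ?thesis
  proof (intro exI[of _ "\<lambda>s. exp (L s)"] conjI ballI allI)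
    fix s assume "s \<in> {a<..<b}"
    then have "(L has_real_derivative (B s / A s)) (at s)"
      using L by (simp add: has_real_derivative_iff_has_vector_derivative)
    then show "((\<lambda>s. exp (L s)) has_real_derivative exp (L s) * (B s / A s)) (at s)"
      by (rule DERIV_fun_exp)
  qed simp
qed

text \<open>One has \<open>\<zeta> = \<eta>' A - \<eta> B\<close> for \<open>\<eta> = \<theta> G\<close>, where \<open>G\<close> is the integral of \<open>\<zeta> / (\<theta> A)\<close> from \<open>a\<close>.  The mean value
  condition makes \<open>\<eta>\<close> vanish to the right of the support of \<open>\<zeta>\<close> too, so that it may be used in
  \<open>flow_integral\<close>.\<close>

lemma I_zero_of_mean_zero:
  assumes \<theta>: "\<And>s. s \<in> {a<..<b} \<Longrightarrow> (\<theta> has_real_derivative \<theta> s * (B s / A s)) (at s)" "\<And>s. \<theta> s > 0"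
    and \<zeta>: "test \<zeta>" "integral {a..b} (\<lambda>s. \<zeta> s * (1 / (\<theta> s * A s))) = 0"
    and g: "flow_invariant g"
  shows "I (\<lambda>x. \<zeta> (f x) * g x) = 0"
proof -
  let ?h = "\<lambda>s. \<zeta> s * (1 / (\<theta> s * A s))"
  obtain c d where cd: "a < c" "d < b" "\<And>s. s \<notin> {c..d} \<Longrightarrow> \<zeta> s = 0"
    using \<zeta>(1) by (auto simp: test_def)
  have \<theta>_cont: "continuous_on {a<..<b} \<theta>"
    by (intro continuous_at_imp_continuous_on ballI DERIV_isCont[OF \<theta>(1)])
  have A_cont': "continuous_on {a<..<b} A" by (rule continuous_on_subset[OF A_cont]) auto
  have nz: "\<theta> s * A s \<noteq> 0" if "s \<in> {a<..<b}" for s using \<theta>(2)[of s] A_pos[OF that] by simp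
  have "test ?h"
    by (rule test_mult[OF \<zeta>(1)]) (use nz in \<open>intro continuous_intros \<theta>_cont A_cont', auto\<close>)
  then have h_cont: "continuous_on S ?h" for S
    using continuous_on_subset[OF test_cont subset_UNIV] by blast
  define G where "G s = integral {a..s} ?h" for s
  have G_der: "(G has_real_derivative ?h s) (at s)" if s: "s \<in> {a<..<b}" for s
  proof -
    have "((\<lambda>s. integral {a..s} ?h) has_real_derivative ?h s) (at s within {a..b})"
      by (rule integral_has_real_derivative[OF h_cont]) (use s in auto)
    moreover have "at s within {a..b} = at s"
      using s by (intro at_within_interior) (simp add: interior_atLeastAtMost_real)
    ultimately show ?thesis unfolding G_def[abs_def] by simp
  qed
  have G0: "G s = 0" if s: "s \<in> {a<..<b}" "s \<notin> {c..d}" for s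
  proof (cases "s < c")
    case True
    have "integral {a..s} ?h = integral {a..s} (\<lambda>_. 0)"
      by (rule integral_cong) (use True cd(3) in auto)
    then show ?thesis by (simp add: G_def)
  next
    case False
    have "integral {s..b} ?h = integral {s..b} (\<lambda>_. 0)"
      by (rule integral_cong) (use False s cd(3) in auto)
    moreover have "integral {a..s} ?h + integral {s..b} ?h = integral {a..b} ?h"
      by (rule Henstock_Kurzweil_Integration.integral_combine)
         (use s h_cont in \<open>auto intro: integrable_continuous_real\<close>)
    ultimately show ?thesis using \<zeta>(2) by (simp add: G_def)
  qed
  define \<eta> where "\<eta> s = (if s \<in> {a<..<b} then \<theta> s * G s else 0)" for s
  define \<eta>' where "\<eta>' s = (if s \<in> {a<..<b} then \<theta> s * (B s / A s) * G s + \<theta> s * ?h s else 0)" for s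
  have \<eta>0: "\<eta> s = 0" "\<eta>' s = 0" if "s \<notin> {c..d}" for s
    using that G0[of s] cd(3)[of s] by (auto simp: \<eta>_def \<eta>'_def)
  have \<eta>_der: "(\<eta> has_real_derivative \<eta>' s) (at s)" for s
  proof (cases "s \<in> {a<..<b}")
    case True
    have "((\<lambda>s. \<theta> s * G s) has_real_derivative \<eta>' s) (at s)"
      by (rule DERIV_cong[OF DERIV_mult[OF \<theta>(1)[OF True] G_der[OF True]]]) (use True in \<open>simp add: \<eta>'_def\<close>)
    then show ?thesis
      by (rule has_field_derivative_transform_within_open[of _ _ _ "{a<..<b}"]) (use True in \<open>auto simp: \<eta>_def\<close>)
  next
    case False
    then have "s \<notin> {c..d}" using cd by auto
    then show ?thesis
      using has_field_derivative_transform_within_open[of "\<lambda>_. 0" 0 s "- {c..d}" \<eta>] \<eta>0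
      by (simp add: open_Compl)
  qed
  have "continuous_on {a<..<b} G"
    by (intro continuous_at_imp_continuous_on ballI DERIV_isCont[OF G_der])
  then have "continuous_on {a<..<b} (\<lambda>s. \<theta> s * (B s / A s) * G s + \<theta> s * ?h s)"
    by (intro continuous_on_add continuous_on_mult \<theta>_cont B_over_A_cont h_cont)
  then have "continuous_on {a<..<b} \<eta>'"
    by (rule continuous_on_eq) (simp add: \<eta>'_def)
  then have \<eta>'_cont: "continuous_on UNIV \<eta>'"
    by (rule continuous_on_UNIV_supp[OF _ cd(1,2) \<eta>0(2)])
  have "\<eta>' s * A s - \<eta> s * B s = \<zeta> s" for s
  proof (cases "s \<in> {a<..<b}")
    case True
    then show ?thesis using A_pos[OF True] \<theta>(2)[of s]
      by (simp add: \<eta>_def \<eta>'_def field_simps)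
  next
    case False
    then have "s \<notin> {c..d}" using cd by auto
    then show ?thesis using \<eta>0[of s] cd(3)[of s] by simp
  qed
  then show ?thesis
    using flow_integral[OF g cd(1,2) \<eta>0(1) \<eta>_der \<eta>'_cont] by simp
qed

lemma I_pos:
  assumes h: "continuous_on (- {0}) h" "\<And>x. h x \<ge> 0" and x: "x \<noteq> 0" "k (x \<bullet> x) > 0" "h x > 0"
  shows "I h > 0"
proof -
  let ?g = "\<lambda>x. k (x \<bullet> x) * h x"
  have nn: "?g x \<ge> 0" for x using h(2) k_nonneg by simp
  have "I h \<noteq> 0"
  proof
    assume "I h = 0"
    then have ae: "AE x in lborel. ?g x = 0"
      using integral_nonneg_eq_0_iff_AE[OF I_integrable[OF h(1)]] nn by (simp add: I_def)
    define T where "T = - {0} \<inter> ?g -` {0<..}"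
    have gc: "continuous_on (- {0}) ?g"
      by (intro continuous_on_mult h(1) continuous_on_compose_UNIV[OF k_cont] continuous_intros)
    have "open T"
      unfolding T_def by (rule continuous_open_preimage[OF gc]) auto
    have "AE x in lborel. x \<notin> T"
      using ae by eventually_elim (auto simp: T_def)
    then have "T \<in> null_sets lborel"
      using \<open>open T\<close> by (subst (asm) AE_iff_null_sets[symmetric]) auto
    then have "negligible T"
      by (simp add: negligible_iff_null_sets null_sets_completionI)
    moreover have "x \<in> T" using x by (simp add: T_def)
    ultimately show False using open_not_negligible[OF \<open>open T\<close>] by blast
  qed
  moreover have "I h \<ge> 0" unfolding I_def using nn by (intro Bochner_Integration.integral_nonneg) auto
  ultimately show ?thesis by simp
qed

lemma level_point:
  assumes "s \<in> {a..b}" obtains x where "x \<noteq> 0" "k (x \<bullet> x) > 0" "f x = s"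
proof -
  obtain y where y: "norm y = 1" "f y = s" using f_onto[OF assms] .
  have u: "u0 > 0" using k_supp[of u0] k_pos r_pos by force
  show thesis
  proof (rule that[of "sqrt u0 *\<^sub>R y"])
    have "y \<bullet> y = 1" using y by (simp add: dot_square_norm)
    then show "k ((sqrt u0 *\<^sub>R y) \<bullet> (sqrt u0 *\<^sub>R y)) > 0" using u k_pos by simp
    show "f (sqrt u0 *\<^sub>R y) = s" using f_scale[of "sqrt u0" y] u y by simp
    show "sqrt u0 *\<^sub>R y \<noteq> 0" using u y by auto
  qed
qed

lemma flow_invariant_1: "flow_invariant (\<lambda>x. 1)"
proof -
  have "frechet_derivative (\<lambda>x. 1::real) (at x) = (\<lambda>h. 0)" for x :: 'a
    using frechet_derivative_at[OF has_derivative_const, of "1::real" x] by simp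
  then show ?thesis unfolding flow_invariant_def by (auto intro: Ck_on_const simp del: Ck_on.simps)
qed

lemma I_diff_scale:
  assumes "test \<zeta>" "test \<zeta>0" "continuous_on reg g"
  shows "I (\<lambda>x. (u * \<zeta> (f x) - v * \<zeta>0 (f x)) * g x) = u * I (\<lambda>x. \<zeta> (f x) * g x) - v * I (\<lambda>x. \<zeta>0 (f x) * g x)"
proof -
  have "I (\<lambda>x. (u * \<zeta> (f x) - v * \<zeta>0 (f x)) * g x)
      = (LINT x|lborel. u * (k (x \<bullet> x) * (\<zeta> (f x) * g x)) - v * (k (x \<bullet> x) * (\<zeta>0 (f x) * g x)))"
    unfolding I_def by (intro arg_cong[of _ _ "integral\<^sup>L lborel"]) (simp add: fun_eq_iff algebra_simps)
  then show ?thesis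
    using I_integrable_test[OF assms(1,3)] I_integrable_test[OF assms(2,3)] by (simp add: I_def)
qed

lemma test_diff_scale:
  assumes "test \<zeta>" "test \<zeta>0"
  shows "test (\<lambda>s. u * \<zeta> s - v * \<zeta>0 s)"
proof -
  obtain c d where cd: "a < c" "d < b" "\<And>s. s \<notin> {c..d} \<Longrightarrow> \<zeta> s = 0"
    using assms(1) by (auto simp: test_def)
  obtain c' d' where cd': "a < c'" "d' < b" "\<And>s. s \<notin> {c'..d'} \<Longrightarrow> \<zeta>0 s = 0"
    using assms(2) by (auto simp: test_def)
  have "a < min c c' \<and> max d d' < b \<and> (\<forall>s. s \<notin> {min c c'..max d d'} \<longrightarrow> u * \<zeta> s - v * \<zeta>0 s = 0)"
    using cd cd' by (auto simp: min_def max_def)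
  moreover have "continuous_on UNIV (\<lambda>s. u * \<zeta> s - v * \<zeta>0 s)"
    by (intro continuous_intros test_cont assms)
  ultimately show ?thesis unfolding test_def by blast
qed

text \<open>The average of a flow invariant function over a level set is the same constant for all levels: as
  functionals of \<open>\<zeta>\<close>, both integrals vanish on the same hyperplane, hence they are proportional.\<close>

lemma flow_average:
  assumes g: "flow_invariant g"
  shows "\<exists>c. \<forall>\<zeta>. test \<zeta> \<longrightarrow> I (\<lambda>x. \<zeta> (f x) * g x) = c * I (\<lambda>x. \<zeta> (f x))"
proof -
  obtain \<theta> where "\<forall>s\<in>{a<..<b}. (\<theta> has_real_derivative \<theta> s * (B s / A s)) (at s)" "\<forall>s. \<theta> s > 0"
    using weight_exists by (elim exE conjE)
  then have \<theta>: "\<And>s. s \<in> {a<..<b} \<Longrightarrow> (\<theta> has_real_derivative \<theta> s * (B s / A s)) (at s)" "\<And>s. \<theta> s > 0"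
    by simp_all
  let ?h = "\<lambda>\<zeta> s. \<zeta> s * (1 / (\<theta> s * A s))"
  let ?l = "\<lambda>\<zeta>. integral {a..b} (?h \<zeta>)"
  have "continuous_on {a<..<b} (\<lambda>s. 1 / (\<theta> s * A s))"
  proof -
    have "continuous_on {a<..<b} \<theta>"
      by (intro continuous_at_imp_continuous_on ballI DERIV_isCont[OF \<theta>(1)])
    moreover have "continuous_on {a<..<b} A" by (rule continuous_on_subset[OF A_cont]) auto
    moreover have "\<theta> s * A s \<noteq> 0" if "s \<in> {a<..<b}" for s using \<theta>(2)[of s] A_pos[OF that] by simp
    ultimately show ?thesis by (intro continuous_on_divide continuous_on_mult continuous_on_const) auto
  qed
  then have h_int: "?h \<zeta> integrable_on {a..b}" if "test \<zeta>" for \<zeta>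
    using continuous_on_subset[OF test_cont[OF test_mult[OF that]]] integrable_continuous_real by blast
  have gc: "continuous_on reg g" "continuous_on reg (\<lambda>x::'a. 1::real)"
    using g Ck_on_imp_continuous_on unfolding flow_invariant_def by (blast, simp)
  define m where "m = (a + b) / 2"
  define \<zeta>0 where "\<zeta>0 s = max 0 ((b - a) / 4 - \<bar>s - m\<bar>)" for s
  have t0: "test \<zeta>0"
    unfolding test_def
  proof (intro conjI exI)
    show "continuous_on UNIV \<zeta>0" unfolding \<zeta>0_def by (intro continuous_intros)
    show "a < m - (b - a) / 4" "m + (b - a) / 4 < b" using ab by (simp_all add: m_def field_simps)
    show "\<forall>s. s \<notin> {m - (b - a) / 4..m + (b - a) / 4} \<longrightarrow> \<zeta>0 s = 0" by (auto simp: \<zeta>0_def)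
  qed
  have I0: "I (\<lambda>x. \<zeta>0 (f x)) > 0"
  proof -
    have "m \<in> {a..b}" using ab by (simp add: m_def)
    then obtain x where "x \<noteq> 0" "k (x \<bullet> x) > 0" "f x = m" using level_point by blast
    then show ?thesis
      using ab by (intro I_pos[of _ x] continuous_on_compose_UNIV[OF test_cont[OF t0]] f_cont) (auto simp: \<zeta>0_def)
  qed
  have l0: "?l \<zeta>0 \<noteq> 0"
    using I_zero_of_mean_zero[OF \<theta> t0 _ flow_invariant_1] I0 by auto
  show ?thesis
  proof (intro exI allI impI)
    fix \<zeta> assume t: "test \<zeta>"
    \<comment> \<open>the combination of \<open>\<zeta>\<close> and \<open>\<zeta>0\<close> that has mean zero\<close>
    let ?z = "\<lambda>s. ?l \<zeta>0 * \<zeta> s - ?l \<zeta> * \<zeta>0 s"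
    have tz: "test ?z" by (rule test_diff_scale[OF t t0])
    have "integral {a..b} (?h ?z) = integral {a..b} (\<lambda>s. ?l \<zeta>0 * ?h \<zeta> s - ?l \<zeta> * ?h \<zeta>0 s)"
      by (rule integral_cong) (simp add: algebra_simps diff_divide_distrib)
    also have "\<dots> = ?l \<zeta>0 * ?l \<zeta> - ?l \<zeta> * ?l \<zeta>0"
      by (subst Henstock_Kurzweil_Integration.integral_diff)
         (auto intro!: integrable_on_mult_right h_int t t0 simp del: times_divide_eq_right mult_1_right)
    finally have z0: "integral {a..b} (?h ?z) = 0" by simp
    have key: "p * (x * y0) = p * (y * x0)" if "p * x = q * x0" "p * y = q * y0" for p q x x0 y y0 :: real
      using that by algebra
    have "?l \<zeta>0 * I (\<lambda>x. \<zeta> (f x) * g x) = ?l \<zeta> * I (\<lambda>x. \<zeta>0 (f x) * g x)"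
      using I_zero_of_mean_zero[OF \<theta> tz z0 g] I_diff_scale[OF t t0 gc(1)] by simp
    moreover have "?l \<zeta>0 * I (\<lambda>x. \<zeta> (f x)) = ?l \<zeta> * I (\<lambda>x. \<zeta>0 (f x))"
      using I_zero_of_mean_zero[OF \<theta> tz z0 flow_invariant_1] I_diff_scale[OF t t0 gc(2)] by simp
    ultimately have "?l \<zeta>0 * (I (\<lambda>x. \<zeta> (f x) * g x) * I (\<lambda>x. \<zeta>0 (f x)))
        = ?l \<zeta>0 * (I (\<lambda>x. \<zeta> (f x)) * I (\<lambda>x. \<zeta>0 (f x) * g x))"
      by (rule key)
    then have "I (\<lambda>x. \<zeta> (f x) * g x) * I (\<lambda>x. \<zeta>0 (f x)) = I (\<lambda>x. \<zeta> (f x)) * I (\<lambda>x. \<zeta>0 (f x) * g x)"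
      by (rule mult_left_cancel[OF l0, THEN iffD1])
    moreover have "x = x0 / y0 * y" if "x * y0 = y * x0" "y0 > 0" for x y x0 y0 :: real
      using that by (simp add: field_simps)
    ultimately show "I (\<lambda>x. \<zeta> (f x) * g x) = (I (\<lambda>x. \<zeta>0 (f x) * g x) / I (\<lambda>x. \<zeta>0 (f x))) * I (\<lambda>x. \<zeta> (f x))"
      using I0 by blast
  qed
qed

end

context isoparametric_extension begin

text \<open>The gradient lines are great circles up to parametrisation: the derivative of \<open>V\<close> along itself lies
  in the plane of \<open>V\<close> and \<open>x\<close>.  This follows by differentiating \<open>|x|\<^sup>2 |V|\<^sup>2 = A (f x)\<close>, as the symmetry of
  the Hessian turns the gradient of \<open>|V|\<^sup>2\<close> into \<open>2 DV x (V x)\<close>.\<close>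

lemma DV_V:
  assumes "x \<noteq> 0" "f x \<in> {a<..<b}"
  shows "DV x (V x) \<bullet> p = A' (f x) * (V x \<bullet> p) / (2 * (x \<bullet> x)) - (x \<bullet> p) * A (f x) / (x \<bullet> x)\<^sup>2"
proof -
  have xx: "x \<bullet> x > 0" using assms by simp
  have VV: "V x \<bullet> V x = A (f x) / (x \<bullet> x)"
    using V_norm[OF assms(1)] xx by (simp add: field_simps dot_square_norm)
  have "((\<lambda>x. (x \<bullet> x) * (V x \<bullet> V x)) has_derivative
      (\<lambda>h. 2 * (x \<bullet> h) * (V x \<bullet> V x) + (x \<bullet> x) * (2 * (DV x h \<bullet> V x)))) (at x)"
    by (auto intro!: derivative_eq_intros V_der[OF assms(1)] simp: inner_commute algebra_simps)
  then have 1: "((\<lambda>x. A (f x)) has_derivative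
      (\<lambda>h. 2 * (x \<bullet> h) * (V x \<bullet> V x) + (x \<bullet> x) * (2 * (DV x h \<bullet> V x)))) (at x)"
    by (rule has_derivative_transform_within_open[of _ _ _ _ "- {0}"])
       (use assms V_norm in \<open>auto simp: dot_square_norm\<close>)
  have 2: "((\<lambda>x. A (f x)) has_derivative (\<lambda>h. A' (f x) * (V x \<bullet> h))) (at x)"
    using has_derivative_compose[OF f_der[OF assms(1)] A_der[OF assms(2), unfolded has_field_derivative_def]] .
  have "2 * (x \<bullet> p) * (V x \<bullet> V x) + (x \<bullet> x) * (2 * (DV x p \<bullet> V x)) = A' (f x) * (V x \<bullet> p)"
    using fun_cong[OF has_derivative_unique[OF 1 2], of p] .
  moreover have "DV x p \<bullet> V x = DV x (V x) \<bullet> p"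
    by (rule hessian_symmetric[of "- {0}" x f V DV]) (use assms f_der V_der DV_cont in auto)
  ultimately have "2 * (x \<bullet> p) * (A (f x) / (x \<bullet> x)) + (x \<bullet> x) * (2 * (DV x (V x) \<bullet> p)) = A' (f x) * (V x \<bullet> p)"
    by (simp add: VV)
  then show ?thesis using xx by (simp add: field_simps power2_eq_square)
qed

end

context cutoff_extension begin

text \<open>The \<open>p\<close>-components of the unit vector \<open>x / |x|\<close> and, at regular values, of the unit normal of the
  level set through it.\<close>

definition "height p x = sgn x \<bullet> (p::'a)"
definition "normal_height p x = 1 / sqrt (A (f x)) * (norm x * (V x \<bullet> p))"

lemma iA_der:
  assumes "s \<in> {a<..<b}"
  shows "((\<lambda>s. 1 / sqrt (A s)) has_real_derivative - A' s / (2 * A s * sqrt (A s))) (at s)"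
  using A_der[OF assms] A_pos[OF assms]
  by (auto intro!: derivative_eq_intros simp: field_simps)

lemma height_der:
  assumes "x \<noteq> 0"
  shows "(height p has_derivative (\<lambda>h. (h \<bullet> p) / norm x - (x \<bullet> h) * (x \<bullet> p) / (norm x) ^ 3)) (at x)"
proof -
  note n = has_derivative_norm'[OF assms]
  have "((\<lambda>x. (x \<bullet> p) / norm x) has_derivative (\<lambda>h. (h \<bullet> p) / norm x - (x \<bullet> h) * (x \<bullet> p) / (norm x) ^ 3)) (at x)"
    using assms by (auto intro!: derivative_eq_intros n simp: fun_eq_iff field_simps power3_eq_cube)
  moreover have "height p = (\<lambda>x. (x \<bullet> p) / norm x)"
    by (simp add: height_def fun_eq_iff sgn_div_norm divide_inverse mult.commute)
  ultimately show ?thesis by simp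
qed

lemma normal_height_der:
  assumes "x \<in> reg"
  shows "(normal_height p has_derivative (\<lambda>h. - A' (f x) / (2 * A (f x) * sqrt (A (f x))) * (V x \<bullet> h) * (norm x * (V x \<bullet> p))
     + 1 / sqrt (A (f x)) * ((x \<bullet> h) / norm x * (V x \<bullet> p) + norm x * (DV x h \<bullet> p)))) (at x)"
proof -
  have x: "x \<noteq> 0" "f x \<in> {a<..<b}" using assms by (auto simp: reg_def)
  note n = has_derivative_norm'[OF x(1)]
  have 1: "((\<lambda>x. 1 / sqrt (A (f x))) has_derivative (\<lambda>h. - A' (f x) / (2 * A (f x) * sqrt (A (f x))) * (V x \<bullet> h))) (at x)"
    using has_derivative_compose[OF f_der[OF x(1)] iA_der[OF x(2), unfolded has_field_derivative_def]] .
  have 2: "((\<lambda>x. norm x * (V x \<bullet> p)) has_derivative (\<lambda>h. (x \<bullet> h) / norm x * (V x \<bullet> p) + norm x * (DV x h \<bullet> p))) (at x)"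
    by (rule has_derivative_eq_rhs[OF has_derivative_mult[OF n has_derivative_inner_left[OF V_der[OF x(1)]]]])
       (simp add: fun_eq_iff)
  show ?thesis
    unfolding normal_height_def[abs_def]
    by (rule has_derivative_eq_rhs[OF has_derivative_mult[OF 1 2]]) (simp add: fun_eq_iff)
qed

lemma reg_Ck:
  "Ck_on (Suc 0) reg f" "Ck_on (Suc 0) reg (height p)" "Ck_on (Suc 0) reg (normal_height p)"
  and real_Ck: "Ck_on (Suc 0) {a<..<b} (\<lambda>s. cos (W s))" "Ck_on (Suc 0) {a<..<b} (\<lambda>s. sin (W s))"
proof -
  have sub: "reg \<subseteq> - {0}" by (auto simp: reg_def)
  note open_nonzero' = open_nonzero[where ?'a='a]
  have V: "Ck_on (Suc 0) (- {0}) V"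
    by (rule Ck_on_SucI[OF open_nonzero' V_der]) (auto simp: DV_cont)
  have "continuous_on (- {0}) (\<lambda>x. V x \<bullet> v)" for v
    by (intro continuous_intros Ck_on_imp_continuous_on[OF V])
  then have "Ck_on (Suc 0) (- {0}) f"
    by (intro Ck_on_SucI[OF open_nonzero' f_der]) auto
  then show f: "Ck_on (Suc 0) reg f" by (rule Ck_on_subset[OF open_nonzero' open_reg sub])
  have "Ck_on (Suc 0) (- {0}) (height p)"
    unfolding height_def[abs_def] by (intro Ck_on_inner Ck_on_sgn Ck_on_const open_nonzero')
  then show "Ck_on (Suc 0) reg (height p)" by (rule Ck_on_subset[OF open_nonzero' open_reg sub])
  have Ac: "continuous_on {a<..<b} A" by (rule continuous_on_subset[OF A_cont]) auto
  have A'c: "continuous_on {a<..<b} A'"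
    using A'_diff differentiable_imp_continuous_within by (intro continuous_at_imp_continuous_on) blast
  have iA: "continuous_on {a<..<b} (\<lambda>s. 1 / sqrt (A s))"
    by (intro continuous_at_imp_continuous_on ballI DERIV_isCont[OF iA_der])
  have "Ck_on (Suc 0) {a<..<b} (\<lambda>s. 1 / sqrt (A s))"
  proof (rule Ck_on_1_real[OF _ iA_der])
    show "continuous_on {a<..<b} (\<lambda>s. - A' s / (2 * A s * sqrt (A s)))"
    proof (intro continuous_on_divide continuous_on_minus continuous_on_mult continuous_on_const
        continuous_on_real_sqrt Ac A'c ballI)
      show "2 * A s * sqrt (A s) \<noteq> 0" if "s \<in> {a<..<b}" for s using A_pos[OF that] by simp
    qed
  qed auto
  then have 1: "Ck_on (Suc 0) reg (\<lambda>x. 1 / sqrt (A (f x)))"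
    by (intro Ck_on_compose[OF open_reg _ _ f]) (auto simp: reg_def)
  have 2: "Ck_on (Suc 0) reg norm" "Ck_on (Suc 0) reg V"
    using Ck_on_subset[OF open_nonzero' open_reg sub Ck_on_norm] Ck_on_subset[OF open_nonzero' open_reg sub V] by auto
  show "Ck_on (Suc 0) reg (normal_height p)"
    unfolding normal_height_def[abs_def] by (intro Ck_on_mult Ck_on_inner Ck_on_const 1 2 open_reg)
  have Wc: "continuous_on {a<..<b} W" by (rule continuous_on_subset[OF W_cont]) auto
  show "Ck_on (Suc 0) {a<..<b} (\<lambda>s. cos (W s))"
  proof (rule Ck_on_1_real[where g'="\<lambda>s. - sin (W s) * (1 / sqrt (A s))"])
    show "continuous_on {a<..<b} (\<lambda>s. - sin (W s) * (1 / sqrt (A s)))"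
      by (intro continuous_on_mult continuous_on_minus continuous_on_sin continuous_on_cos Wc iA)
  qed (auto intro!: derivative_eq_intros W_der)
  show "Ck_on (Suc 0) {a<..<b} (\<lambda>s. sin (W s))"
  proof (rule Ck_on_1_real[where g'="\<lambda>s. cos (W s) * (1 / sqrt (A s))"])
    show "continuous_on {a<..<b} (\<lambda>s. cos (W s) * (1 / sqrt (A s)))"
      by (intro continuous_on_mult continuous_on_minus continuous_on_sin continuous_on_cos Wc iA)
  qed (auto intro!: derivative_eq_intros W_der)
qed

text \<open>The \<open>p\<close>-components of the point where the gradient line through \<open>x\<close> starts on the focal set of the
  value \<open>a\<close>, and of its direction there: the great circle is followed back over the length
  \<open>W (f x)\<close>.\<close>

definition "foot_height p x = cos (W (f x)) * height p x - sin (W (f x)) * normal_height p x"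
definition "foot_slope p x = sin (W (f x)) * height p x + cos (W (f x)) * normal_height p x"

lemma flow_invariant_foot: "flow_invariant (foot_height p)" "flow_invariant (foot_slope p)"
proof -
  have comp: "Ck_on (Suc 0) reg (\<lambda>x. cos (W (f x)))" "Ck_on (Suc 0) reg (\<lambda>x. sin (W (f x)))"
    using Ck_on_compose[OF open_reg _ _ reg_Ck(1) real_Ck(1)] Ck_on_compose[OF open_reg _ _ reg_Ck(1) real_Ck(2)]
    by (auto simp: reg_def image_subset_iff simp del: Ck_on.simps)
  have ckP: "Ck_on (Suc 0) reg (foot_height p)"
    unfolding foot_height_def[abs_def] by (intro Ck_on_diff Ck_on_mult comp reg_Ck open_reg)
  have ckR: "Ck_on (Suc 0) reg (foot_slope p)"
    unfolding foot_slope_def[abs_def] by (intro Ck_on_add Ck_on_mult comp reg_Ck open_reg)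
  have "frechet_derivative (foot_height p) (at x) (V x) = 0 \<and> frechet_derivative (foot_slope p) (at x) (V x) = 0"
    if xr: "x \<in> reg" for x
  proof -
    have x: "x \<noteq> 0" "f x \<in> {a<..<b}" using xr by (auto simp: reg_def)
    define r2 where "r2 = x \<bullet> x"
    have nx: "norm x > 0" "r2 = norm x * norm x" using x by (simp_all add: r2_def dot_square_norm power2_eq_square)
    define w where "w = sqrt (A (f x))"
    have w: "w > 0" "A (f x) = w * w" using A_pos[OF x(2)] by (simp_all add: w_def)
    have VV: "V x \<bullet> V x = w * w / r2"
      using V_norm[OF x(1)] nx w by (simp add: field_simps power2_eq_square)
    have xV: "x \<bullet> V x = 0" using V_radial[OF x(1)] by (simp add: inner_commute)
    obtain S' where S': "(height p has_derivative S') (at x)" "S' (V x) = (V x \<bullet> p) / norm x"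
      using height_der[OF x(1), of p] xV by fastforce
    obtain N' where N': "(normal_height p has_derivative N') (at x)" "N' (V x) = - (x \<bullet> p) * w / (norm x * r2)"
    proof (rule that[OF normal_height_der[OF xr]])
      have D: "DV x (V x) \<bullet> p = A' (f x) * (V x \<bullet> p) / (2 * r2) - (x \<bullet> p) * (w * w) / r2\<^sup>2"
        using DV_V[OF x, of p] by (simp add: w r2_def)
      show "- A' (f x) / (2 * A (f x) * sqrt (A (f x))) * (V x \<bullet> V x) * (norm x * (V x \<bullet> p))
     + 1 / sqrt (A (f x)) * ((x \<bullet> V x) / norm x * (V x \<bullet> p) + norm x * (DV x (V x) \<bullet> p)) = - (x \<bullet> p) * w / (norm x * r2)"
        unfolding D w_def[symmetric] xV VV w(2) nx(2) using nx(1) w(1)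
        by (simp add: field_simps power2_eq_square)
    qed
    have c: "((\<lambda>x. cos (W (f x))) has_derivative (\<lambda>h. - sin (W (f x)) * (1 / w) * (V x \<bullet> h))) (at x)"
    proof -
      have "((\<lambda>s. cos (W s)) has_real_derivative - sin (W (f x)) * (1 / w)) (at (f x))"
        using W_der[OF x(2)] by (auto intro!: derivative_eq_intros simp: w_def)
      from has_derivative_compose[OF f_der[OF x(1)] this[unfolded has_field_derivative_def]] show ?thesis .
    qed
    have s: "((\<lambda>x. sin (W (f x))) has_derivative (\<lambda>h. cos (W (f x)) * (1 / w) * (V x \<bullet> h))) (at x)"
    proof -
      have "((\<lambda>s. sin (W s)) has_real_derivative cos (W (f x)) * (1 / w)) (at (f x))"
        using W_der[OF x(2)] by (auto intro!: derivative_eq_intros simp: w_def)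
      from has_derivative_compose[OF f_der[OF x(1)] this[unfolded has_field_derivative_def]] show ?thesis .
    qed
    have Sx: "height p x = (x \<bullet> p) / norm x" by (simp add: height_def sgn_div_norm divide_inverse mult.commute)
    have Nx: "normal_height p x = norm x * (V x \<bullet> p) / w" by (simp add: normal_height_def w_def)
    have "(foot_height p has_derivative (\<lambda>h. (cos (W (f x)) * S' h + - sin (W (f x)) * (1 / w) * (V x \<bullet> h) * height p x)
       - (sin (W (f x)) * N' h + cos (W (f x)) * (1 / w) * (V x \<bullet> h) * normal_height p x))) (at x)"
      unfolding foot_height_def[abs_def]
      by (intro has_derivative_diff has_derivative_mult c s S' N')
    from fun_cong[OF frechet_derivative_at[OF this], of "V x"]
    have 1: "frechet_derivative (foot_height p) (at x) (V x) = 0"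
      unfolding S'(2) N'(2) VV Sx Nx nx(2) using nx(1) w(1) by (simp add: field_simps)
    have "(foot_slope p has_derivative (\<lambda>h. (sin (W (f x)) * S' h + cos (W (f x)) * (1 / w) * (V x \<bullet> h) * height p x)
       + (cos (W (f x)) * N' h + - sin (W (f x)) * (1 / w) * (V x \<bullet> h) * normal_height p x))) (at x)"
      unfolding foot_slope_def[abs_def]
      by (intro has_derivative_add has_derivative_mult c s S' N')
    from fun_cong[OF frechet_derivative_at[OF this], of "V x"]
    have 2: "frechet_derivative (foot_slope p) (at x) (V x) = 0"
      unfolding S'(2) N'(2) VV Sx Nx nx(2) using nx(1) w(1) by (simp add: field_simps)
    show ?thesis using 1 2 by simp
  qed
  then show "flow_invariant (foot_height p)" "flow_invariant (foot_slope p)"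
    using ckP ckR unfolding flow_invariant_def by blast+
qed

end

section \<open>Flux at the end points of the range of values\<close>

lemma antiderivative_real:
  fixes g :: "real \<Rightarrow> real"
  assumes "continuous_on UNIV g"
  shows "\<exists>G. \<forall>s. (G has_real_derivative g s) (at s)"
proof -
  have "\<exists>F. \<forall>x::real. -\<infinity> < ereal x \<longrightarrow> ereal x < \<infinity> \<longrightarrow> (F has_vector_derivative g x) (at x)"
    by (rule einterval_antiderivative) (use assms in \<open>auto simp: continuous_on_eq_continuous_at\<close>)
  then show ?thesis by (simp add: has_real_derivative_iff_has_vector_derivative)
qed

text \<open>The distribution \<open>M\<close> of the values of an isoparametric function, and the averages \<open>\<Phi>\<close>, \<open>\<Phi>'\<close> of a linear
  function and of its normal derivative over the level sets.  The identity \<open>flux\<close> is the weak form of the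
  eigenvalue equation of the linear function with eigenvalue \<open>n\<close>.\<close>

locale value_distribution =
  fixes M :: "real measure" and A \<Phi> \<Phi>' W :: "real \<Rightarrow> real" and a b n :: real
  assumes fin: "finite_measure M" and sM: "sets M = sets borel" and ab: "a < b"
    and supp: "AE s in M. a < s \<and> s < b"
    and pos: "\<And>s t. a \<le> s \<Longrightarrow> s < t \<Longrightarrow> t \<le> b \<Longrightarrow> emeasure M {s<..<t} \<noteq> 0"
    and A: "continuous_on UNIV A" "\<And>s. s \<in> {a<..<b} \<Longrightarrow> A s > 0" "\<And>s. A s \<ge> 0"
    and W: "continuous_on {a..b} W" "\<And>s. s \<in> {a<..<b} \<Longrightarrow> (W has_real_derivative 1 / sqrt (A s)) (at s)"
    and \<Phi>: "continuous_on UNIV \<Phi>" "continuous_on UNIV \<Phi>'"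
    and flux: "\<And>\<psi> \<psi>'. (\<And>s. (\<psi> has_real_derivative \<psi>' s) (at s)) \<Longrightarrow> continuous_on UNIV \<psi>' \<Longrightarrow>
       (LINT s|M. \<psi>' s * (sqrt (A s) * \<Phi>' s)) = n * (LINT s|M. \<psi> s * \<Phi> s)"
    and n: "n \<ge> 0"
begin

text \<open>Ideally one would test with \<open>\<psi>' = - cut / sqrt A\<close>, where \<open>cut\<close> is
  supported in \<open>[a, \<sigma>]\<close>.  If \<open>\<Phi>' > c0\<close> on this interval, then the left-hand side is at most \<open>- c0\<close> times the
  integral of \<open>cut\<close>, while \<open>\<psi>\<close> is at most \<open>cut\<close> times the length \<open>W \<sigma> - W a\<close>, which is small for
  \<open>\<sigma>\<close> near \<open>a\<close>.  This is a contradiction, because the values near \<open>a\<close> have positive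
  measure and the value \<open>a\<close> itself has measure zero.\<close>

lemma endpoint_flux_not_pos: "\<not> \<Phi>' a > 0"
proof
  assume P: "\<Phi>' a > 0"
  interpret finite_measure M by (rule fin)
  have meas: "g \<in> borel_measurable M" if "continuous_on UNIV g" for g :: "real \<Rightarrow> real"
    using borel_measurable_continuous_onI[OF that] measurable_cong_sets[OF sM refl] by blast
  define c0 where "c0 = \<Phi>' a / 2"
  have c0: "c0 > 0" "c0 < \<Phi>' a" using P by (auto simp: c0_def)
  obtain m where m: "\<And>s. s \<in> {a..b} \<Longrightarrow> \<bar>\<Phi> s\<bar> \<le> m" "m \<ge> 0"
  proof -
    have "bounded (\<Phi> ` {a..b})"
      by (intro compact_imp_bounded compact_continuous_image continuous_on_subset[OF \<Phi>(1)]) auto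
    then have "\<exists>m. \<forall>s\<in>{a..b}. \<bar>\<Phi> s\<bar> \<le> m" by (simp add: bounded_iff)
    then obtain m where m: "\<forall>s\<in>{a..b}. \<bar>\<Phi> s\<bar> \<le> m" by blast
    then have "\<bar>\<Phi> a\<bar> \<le> m" using ab by simp
    then show ?thesis using that[of m] m by force
  qed
  obtain m' where m': "\<And>s. s \<in> {a..b} \<Longrightarrow> \<bar>\<Phi>' s\<bar> \<le> m'"
  proof -
    have "bounded (\<Phi>' ` {a..b})"
      by (intro compact_imp_bounded compact_continuous_image continuous_on_subset[OF \<Phi>(2)]) auto
    then have "\<exists>m. \<forall>s\<in>{a..b}. \<bar>\<Phi>' s\<bar> \<le> m" by (simp add: bounded_iff)
    then show ?thesis using that by blast
  qed
  have "(\<Phi>' \<longlongrightarrow> \<Phi>' a) (at_right a)"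
    using \<Phi>(2) by (simp add: continuous_on_eq_continuous_at continuous_at_imp_continuous_at_within flip: continuous_within)
  then have e1: "eventually (\<lambda>s. \<Phi>' s > c0) (at_right a)" using c0(2) by (rule order_tendstoD)
  have "(W \<longlongrightarrow> W a) (at_right a)"
  proof -
    have "(W \<longlongrightarrow> W a) (at a within {a..b})" using W(1) ab by (simp add: continuous_on_def)
    then show ?thesis using ab by (simp add: at_within_Icc_at_right)
  qed
  then have "((\<lambda>s. n * m * (W s - W a)) \<longlongrightarrow> n * m * (W a - W a)) (at_right a)" by (intro tendsto_intros)
  then have e2: "eventually (\<lambda>s. n * m * (W s - W a) < c0) (at_right a)"
    by (rule order_tendstoD) (use c0 in simp)
  obtain d where d: "d > a" "\<And>s. a < s \<Longrightarrow> s < d \<Longrightarrow> \<Phi>' s > c0 \<and> n * m * (W s - W a) < c0"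
    using eventually_conj[OF e1 e2] unfolding eventually_at_right_field by blast
  define \<sigma> where "\<sigma> = (a + min d b) / 2"
  have \<sigma>: "a < \<sigma>" "\<sigma> < d" "\<sigma> < b" using d(1) ab by (auto simp: \<sigma>_def min_def)
  define \<omega> where "\<omega> = W \<sigma> - W a"
  have \<omega>: "n * m * \<omega> < c0" using d(2)[of \<sigma>] \<sigma> by (simp add: \<omega>_def)
  define cut where "cut s = max 0 (\<sigma> - s)" for s
  have cut: "continuous_on UNIV cut" "cut s \<ge> 0" "s \<ge> a \<Longrightarrow> cut s \<le> b - a" for s
    using \<sigma> unfolding cut_def by (auto intro!: continuous_intros)
  have W_mono: "W s \<le> W t" if "a \<le> s" "s \<le> t" "t \<le> b" for s t
  proof (cases "s = t")
    case False
    then have st: "s < t" using that by simp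
    have "W s < W t"
    proof (rule DERIV_pos_imp_increasing_open[OF st])
      fix x assume "s < x" "x < t"
      then have "x \<in> {a<..<b}" using that by auto
      then show "\<exists>y. (W has_real_derivative y) (at x) \<and> 0 < y" using W(2) A(2) by (intro exI[of _ "1 / sqrt (A x)"]) auto
    qed (use that in \<open>auto intro: continuous_on_subset[OF W(1)]\<close>)
    then show ?thesis by simp
  qed simp
  have bnd: "integrable M g" if "continuous_on UNIV g" "\<And>s. s \<in> {a..b} \<Longrightarrow> \<bar>g s\<bar> \<le> K" for g :: "real \<Rightarrow> real" and K :: real
    by (rule integrable_const_bound[where B=K, OF _ meas[OF that(1)]])
       (use eventually_mono[OF supp] that(2) in auto)
  have int_cut: "integrable M cut" by (rule bnd[of _ "b - a"]) (use cut in auto)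
  have key: "(LINT s|M. cut s * (sqrt (A s) / sqrt (A s + e\<^sup>2)) * \<Phi>' s) \<le> n * m * \<omega> * (LINT s|M. cut s)"
    if e: "e > 0" for e
  proof -
    have Ae: "A s + e\<^sup>2 > 0" for s using A(3)[of s] e by (simp add: add_nonneg_pos)
    \<comment> \<open>The regularisation by \<open>e\<close> keeps \<open>\<psi>\<close> continuously differentiable at \<open>a\<close>, where \<open>A\<close> may vanish.\<close>
    define \<psi>' where "\<psi>' s = - (cut s / sqrt (A s + e\<^sup>2))" for s
    have \<psi>'c: "continuous_on UNIV \<psi>'"
      unfolding \<psi>'_def by (intro continuous_intros cut A(1)) (use Ae in \<open>auto simp: less_imp_neq[symmetric]\<close>)
    obtain H where H: "\<And>s. (H has_real_derivative \<psi>' s) (at s)"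
      using antiderivative_real[OF \<psi>'c] by blast
    define \<psi> where "\<psi> s = H s - H \<sigma>" for s
    have \<psi>: "(\<psi> has_real_derivative \<psi>' s) (at s)" for s
      unfolding \<psi>_def[abs_def] using H[of s] by (auto intro!: derivative_eq_intros)
    have \<psi>\<sigma>: "\<psi> \<sigma> = 0" by (simp add: \<psi>_def)
    have \<psi>c: "continuous_on S \<psi>" for S
      by (intro continuous_at_imp_continuous_on ballI DERIV_isCont[OF \<psi>])
    have bound: "\<bar>\<psi> s\<bar> \<le> cut s * \<omega>" if s: "s \<in> {a..b}" for s
    proof (cases "s < \<sigma>")
      case False
      have "\<psi> s = 0"
      proof (cases "s = \<sigma>")
        case False
        then have "\<sigma> < s" using \<open>\<not> s < \<sigma>\<close> by simp
        from MVT2[OF this \<psi>] obtain z where "\<sigma> < z" "\<psi> s - \<psi> \<sigma> = (s - \<sigma>) * \<psi>' z" by blast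
        then show ?thesis by (simp add: \<psi>\<sigma> \<psi>'_def cut_def)
      qed (simp add: \<psi>\<sigma>)
      then show ?thesis using False by (simp add: cut_def)
    next
      case True
      have "\<psi> \<sigma> \<le> \<psi> s"
      proof (rule DERIV_nonpos_imp_nonincreasing[OF less_imp_le[OF True]])
        fix t
        have "\<psi>' t \<le> 0" using cut(2)[of t] Ae[of t] by (simp add: \<psi>'_def less_imp_le)
        then show "\<exists>y. (\<psi> has_real_derivative y) (at t) \<and> y \<le> 0" using \<psi>[of t] by blast
      qed
      moreover have "\<psi> s + cut s * W s \<le> \<psi> \<sigma> + cut s * W \<sigma>"
      proof (rule DERIV_nonneg_imp_increasing_open[OF less_imp_le[OF True], of "\<lambda>t. \<psi> t + cut s * W t"])
        fix t assume t: "s < t" "t < \<sigma>"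
        then have t': "t \<in> {a<..<b}" using s \<sigma> by auto
        have "((\<lambda>t. \<psi> t + cut s * W t) has_real_derivative \<psi>' t + cut s * (1 / sqrt (A t))) (at t)"
          by (intro DERIV_add DERIV_cmult \<psi> W(2) t')
        moreover have "\<psi>' t + cut s * (1 / sqrt (A t)) \<ge> 0"
        proof -
          have "cut t / sqrt (A t + e\<^sup>2) \<le> cut s / sqrt (A t)"
            using t cut(2)[of s] A(2)[OF t'] by (intro frac_le) (auto simp: cut_def)
          then show ?thesis by (simp add: \<psi>'_def)
        qed
        ultimately show "\<exists>y. ((\<lambda>t. \<psi> t + cut s * W t) has_real_derivative y) (at t) \<and> 0 \<le> y" by blast
      next
        show "continuous_on {s..\<sigma>} (\<lambda>t. \<psi> t + cut s * W t)"
          using s \<sigma> by (intro continuous_intros \<psi>c continuous_on_subset[OF W(1)]) auto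
      qed
      moreover have "cut s * W a \<le> cut s * W s"
        using cut(2) W_mono[of a s] s by (intro mult_left_mono) auto
      ultimately show ?thesis using \<psi>\<sigma> by (simp add: \<omega>_def right_diff_distrib)
    qed
    have "(LINT s|M. cut s * (sqrt (A s) / sqrt (A s + e\<^sup>2)) * \<Phi>' s) = (LINT s|M. - (\<psi>' s * (sqrt (A s) * \<Phi>' s)))"
      by (intro Bochner_Integration.integral_cong) (auto simp: \<psi>'_def)
    also have "\<dots> = - (n * (LINT s|M. \<psi> s * \<Phi> s))"
      using flux[OF \<psi> \<psi>'c] by simp
    also have "\<dots> = n * (LINT s|M. - (\<psi> s * \<Phi> s))" by simp
    also have "\<dots> \<le> n * (LINT s|M. (m * \<omega>) * cut s)"
    proof (rule mult_left_mono[OF _ n], rule integral_mono_AE)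
      have b: "\<bar>\<psi> s * \<Phi> s\<bar> \<le> m * \<omega> * cut s" if "s \<in> {a..b}" for s
        using mult_mono[OF bound[OF that] m(1)[OF that]] order_trans[OF abs_ge_zero bound[OF that]]
        by (simp add: abs_mult mult.assoc mult.commute mult.left_commute)
      show "integrable M (\<lambda>s. - (\<psi> s * \<Phi> s))"
      proof (rule bnd)
        show "continuous_on UNIV (\<lambda>s. - (\<psi> s * \<Phi> s))" by (intro continuous_intros \<psi>c \<Phi>)
        have "0 \<le> m * \<omega>" using m(2) W_mono[of a \<sigma>] \<sigma> by (simp add: \<omega>_def)
        then show "\<bar>- (\<psi> s * \<Phi> s)\<bar> \<le> m * \<omega> * (b - a)" if "s \<in> {a..b}" for s
          using b[OF that] mult_left_mono[OF cut(3)[of s], of "m * \<omega>"] that by auto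
      qed
      show "integrable M (\<lambda>s. m * \<omega> * cut s)" using int_cut by simp
      show "AE s in M. - (\<psi> s * \<Phi> s) \<le> m * \<omega> * cut s"
        using supp by eventually_elim (use b in \<open>force simp: abs_le_iff\<close>)
    qed
    also have "\<dots> = n * m * \<omega> * (LINT s|M. cut s)" by simp
    finally show ?thesis .
  qed
  let ?e = "\<lambda>k. inverse (real (Suc k))"
  have lim: "(\<lambda>k. LINT s|M. cut s * (sqrt (A s) / sqrt (A s + (?e k)\<^sup>2)) * \<Phi>' s) \<longlonglongrightarrow> (LINT s|M. cut s * \<Phi>' s)"
  proof (rule integral_dominated_convergence[where w="\<lambda>_. (b - a) * m'"])
    show "(\<lambda>s. cut s * \<Phi>' s) \<in> borel_measurable M" by (intro meas continuous_intros cut \<Phi>)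
    have Ae: "A s + (?e k)\<^sup>2 > 0" for s k using A(3)[of s] by (intro add_nonneg_pos) auto
    then show "(\<lambda>s. cut s * (sqrt (A s) / sqrt (A s + (?e k)\<^sup>2)) * \<Phi>' s) \<in> borel_measurable M" for k
      by (intro meas continuous_intros cut \<Phi> A(1)) (auto simp: less_imp_neq[symmetric] simp del: of_nat_Suc)
    show "AE s in M. (\<lambda>k. cut s * (sqrt (A s) / sqrt (A s + (?e k)\<^sup>2)) * \<Phi>' s) \<longlonglongrightarrow> cut s * \<Phi>' s"
      using supp
    proof eventually_elim
      case (elim s)
      then have "A s > 0" using A(2) by simp
      then have "(\<lambda>k. cut s * (sqrt (A s) / sqrt (A s + (?e k)\<^sup>2)) * \<Phi>' s)
           \<longlonglongrightarrow> cut s * (sqrt (A s) / sqrt (A s + 0\<^sup>2)) * \<Phi>' s"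
        by (intro tendsto_intros LIMSEQ_inverse_real_of_nat) auto
      then show ?case using \<open>A s > 0\<close> by simp
    qed
    show "AE s in M. norm (cut s * (sqrt (A s) / sqrt (A s + (?e k)\<^sup>2)) * \<Phi>' s) \<le> (b - a) * m'" for k
      using supp
    proof eventually_elim
      case (elim s)
      have "sqrt (A s) / sqrt (A s + (?e k)\<^sup>2) \<le> 1" using Ae[of s k] A(3)[of s] by (simp add: divide_le_eq_1)
      then have "cut s * (sqrt (A s) / sqrt (A s + (?e k)\<^sup>2)) \<le> (b - a) * 1"
        using elim cut(2,3)[of s] A(3)[of s] ab by (intro mult_mono) auto
      then have "cut s * (sqrt (A s) / sqrt (A s + (?e k)\<^sup>2)) * \<bar>\<Phi>' s\<bar> \<le> (b - a) * m'"
        using elim m'[of s] ab by (intro mult_mono) auto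
      then show ?case using cut(2)[of s] A(3)[of s] Ae[of s k] by (simp add: abs_mult del: of_nat_Suc)
    qed
  qed simp
  have "(LINT s|M. cut s * \<Phi>' s) \<le> n * m * \<omega> * (LINT s|M. cut s)"
    by (rule LIMSEQ_le_const2[OF lim]) (use key in auto)
  moreover have "(LINT s|M. c0 * cut s) \<le> (LINT s|M. cut s * \<Phi>' s)"
  proof (rule integral_mono_AE)
    show "integrable M (\<lambda>s. cut s * \<Phi>' s)"
    proof (rule bnd)
      show "continuous_on UNIV (\<lambda>s. cut s * \<Phi>' s)" by (intro continuous_intros cut \<Phi>)
      show "\<bar>cut s * \<Phi>' s\<bar> \<le> (b - a) * m'" if "s \<in> {a..b}" for s
        using cut(2,3)[of s] m'[OF that] that by (auto simp: abs_mult intro!: mult_mono)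
    qed
    show "AE s in M. c0 * cut s \<le> cut s * \<Phi>' s"
      using supp
    proof eventually_elim
      case (elim s)
      show ?case
      proof (cases "s < \<sigma>")
        case True
        then have "c0 \<le> \<Phi>' s" using d(2)[of s] elim \<sigma> by auto
        then show ?thesis using mult_left_mono[OF _ cut(2)[of s]] by (simp add: mult.commute)
      qed (simp add: cut_def)
    qed
  qed (use int_cut in simp)
  ultimately have "c0 * (LINT s|M. cut s) \<le> n * m * \<omega> * (LINT s|M. cut s)" by simp
  moreover have "(LINT s|M. cut s) > 0"
  proof -
    have "(LINT s|M. cut s) \<noteq> 0"
    proof
      assume "(LINT s|M. cut s) = 0"
      then have "AE s in M. cut s = 0"
        using integral_nonneg_eq_0_iff_AE[OF int_cut] cut(2) by simp
      then have "AE s in M. s \<notin> {a<..<\<sigma>}"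
        by eventually_elim (auto simp: cut_def)
      then have "emeasure M {a<..<\<sigma>} = 0"
        using sM by (subst (asm) AE_iff_measurable[of "{a<..<\<sigma>}"]) (auto simp: sets_eq_imp_space_eq[OF sM])
      then show False using pos[of a \<sigma>] \<sigma> by simp
    qed
    moreover have "(LINT s|M. cut s) \<ge> 0" using cut(2) by (intro Bochner_Integration.integral_nonneg) auto
    ultimately show ?thesis by simp
  qed
  ultimately have "c0 \<le> n * m * \<omega>" by simp
  then show False using \<omega> by simp
qed

end

lemma (in value_distribution) value_distribution_uminus:
  "value_distribution M A (\<lambda>s. - \<Phi> s) (\<lambda>s. - \<Phi>' s) W a b n"
proof (rule value_distribution.intro)
  fix \<psi> \<psi>' :: "real \<Rightarrow> real"
  assume "\<And>s. (\<psi> has_real_derivative \<psi>' s) (at s)" "continuous_on UNIV \<psi>'"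
  from flux[OF this]
  show "(LINT s|M. \<psi>' s * (sqrt (A s) * - \<Phi>' s)) = n * (LINT s|M. \<psi> s * - \<Phi> s)" by simp
qed (use fin sM ab supp pos A W \<Phi> n in \<open>auto intro: continuous_on_minus\<close>)

lemma (in value_distribution) endpoint_flux_zero: "\<Phi>' a = 0"
  using endpoint_flux_not_pos value_distribution.endpoint_flux_not_pos[OF value_distribution_uminus]
  by simp

text \<open>Reflection of the interval exchanges the two end points and changes the sign of the flux.\<close>

lemma (in value_distribution) endpoint_flux_zero_right: "\<Phi>' b = 0"
proof -
  interpret finite_measure M by (rule fin)
  define M' where "M' = distr M borel uminus"
  have um: "uminus \<in> measurable M borel"
    using measurable_cong_sets[OF sM refl, of borel] borel_measurable_uminus by auto
  have neg: "continuous_on UNIV (\<lambda>s::real. g (- s))" if "continuous_on UNIV g" for g :: "real \<Rightarrow> real"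
    using continuous_on_compose2[OF that continuous_on_minus[OF continuous_on_id]] by simp
  have int: "(LINT s|M'. g s) = (LINT s|M. g (- s))" if "continuous_on UNIV g" for g :: "real \<Rightarrow> real"
    unfolding M'_def by (rule integral_distr[OF um borel_measurable_continuous_onI[OF that]])
  have "value_distribution M' (\<lambda>s. A (- s)) (\<lambda>s. \<Phi> (- s)) (\<lambda>s. - \<Phi>' (- s)) (\<lambda>s. - W (- s)) (- b) (- a) n"
  proof (rule value_distribution.intro)
    show "finite_measure M'" unfolding M'_def by (rule finite_measure_distr[OF um])
    show "sets M' = sets borel" by (simp add: M'_def)
    show "AE s in M'. - b < s \<and> s < - a"
      unfolding M'_def using supp by (subst AE_distr_iff[OF um]) (auto elim!: eventually_mono)
    show "continuous_on UNIV (\<lambda>s. A (- s))" "continuous_on UNIV (\<lambda>s. \<Phi> (- s))" "continuous_on UNIV (\<lambda>s. - \<Phi>' (- s))"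
      by (intro neg A(1) \<Phi> continuous_on_minus)+
    show "continuous_on {- b..- a} (\<lambda>s. - W (- s))"
      by (intro continuous_on_minus continuous_on_compose2[OF W(1)] continuous_on_id) auto
    show "((\<lambda>s. - W (- s)) has_real_derivative 1 / sqrt (A (- s))) (at s)" if "s \<in> {- b<..<- a}" for s
    proof -
      have "- s \<in> {a<..<b}" using that by auto
      from DERIV_chain2[OF W(2)[OF this] DERIV_minus[OF DERIV_ident]]
      show ?thesis by (auto intro!: derivative_eq_intros)
    qed
    show "emeasure M' {s<..<t} \<noteq> 0" if "- b \<le> s" "s < t" "t \<le> - a" for s t
    proof -
      have "emeasure M' {s<..<t} = emeasure M (uminus -` {s<..<t} \<inter> space M)"
        unfolding M'_def by (rule emeasure_distr[OF um]) simp
      also have "uminus -` {s<..<t} \<inter> space M = {- t<..<- s}"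
        by (auto simp: sets_eq_imp_space_eq[OF sM])
      finally show ?thesis using pos[of "- t" "- s"] that by simp
    qed
    fix \<psi> \<psi>' :: "real \<Rightarrow> real"
    assume \<psi>: "\<And>s. (\<psi> has_real_derivative \<psi>' s) (at s)" "continuous_on UNIV \<psi>'"
    have \<psi>c: "continuous_on UNIV \<psi>"
      by (intro continuous_at_imp_continuous_on ballI DERIV_isCont[OF \<psi>(1)])
    have "((\<lambda>s. \<psi> (- s)) has_real_derivative - \<psi>' (- s)) (at s)" for s
      using DERIV_chain2[OF \<psi>(1) DERIV_minus[OF DERIV_ident], of s] by simp
    from flux[OF this continuous_on_minus[OF neg[OF \<psi>(2)]]]
    have "(LINT s|M. - \<psi>' (- s) * (sqrt (A s) * \<Phi>' s)) = n * (LINT s|M. \<psi> (- s) * \<Phi> s)" .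
    moreover have "(LINT s|M'. \<psi>' s * (sqrt (A (- s)) * - \<Phi>' (- s))) = (LINT s|M. - \<psi>' (- s) * (sqrt (A s) * \<Phi>' s))"
      by (subst int) (auto intro!: continuous_on_mult \<psi>(2) neg A(1) \<Phi> continuous_on_minus continuous_on_real_sqrt)
    moreover have "(LINT s|M'. \<psi> s * \<Phi> (- s)) = (LINT s|M. \<psi> (- s) * \<Phi> s)"
      by (subst int) (auto intro!: continuous_on_mult \<psi>c neg \<Phi>)
    ultimately show "(LINT s|M'. \<psi>' s * (sqrt (A (- s)) * - \<Phi>' (- s))) = n * (LINT s|M'. \<psi> s * \<Phi> (- s))"
      by simp
  qed (use ab A n in auto)
  from value_distribution.endpoint_flux_zero[OF this] show ?thesis by simp
qed

section \<open>The centre of mass of a tube\<close>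

locale cutoff_extension_null = cutoff_extension +
  assumes null: "AE x in lborel. x \<noteq> 0 \<longrightarrow> f x \<noteq> a \<and> f x \<noteq> b"
begin

text \<open>The position \<open>x\<close> and the unit normal are recovered from the foot point and the foot direction by a
  rotation through the angle \<open>W (f x)\<close>, and the averages of the latter are the constants \<open>\<alpha>\<close> and \<open>\<beta>\<close>.\<close>

lemma average_height:
  "\<exists>\<alpha> \<beta>. \<forall>\<zeta>. test \<zeta> \<longrightarrow>
     I (\<lambda>x. \<zeta> (f x) * height p x) = I (\<lambda>x. \<zeta> (f x) * (\<alpha> * cos (W (f x)) + \<beta> * sin (W (f x)))) \<and>
     I (\<lambda>x. \<zeta> (f x) * (norm x * (V x \<bullet> p)))
       = I (\<lambda>x. \<zeta> (f x) * (sqrt (A (f x)) * (\<beta> * cos (W (f x)) - \<alpha> * sin (W (f x)))))"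
proof -
  obtain \<alpha> where \<alpha>: "\<And>\<zeta>. test \<zeta> \<Longrightarrow> I (\<lambda>x. \<zeta> (f x) * foot_height p x) = \<alpha> * I (\<lambda>x. \<zeta> (f x))"
    using flow_average[OF flow_invariant_foot(1)[of p]] by blast
  obtain \<beta> where \<beta>: "\<And>\<zeta>. test \<zeta> \<Longrightarrow> I (\<lambda>x. \<zeta> (f x) * foot_slope p x) = \<beta> * I (\<lambda>x. \<zeta> (f x))"
    using flow_average[OF flow_invariant_foot(2)[of p]] by blast
  have PR: "continuous_on reg (foot_height p)" "continuous_on reg (foot_slope p)"
    using flow_invariant_foot[of p] Ck_on_imp_continuous_on unfolding flow_invariant_def by blast+
  have one: "continuous_on reg (\<lambda>x::'a. 1::real)" by simp
  have combine: "I (\<lambda>x. u (f x) * foot_height p x + v (f x) * foot_slope p x) = I (\<lambda>x. \<alpha> * u (f x) + \<beta> * v (f x))"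
    if t: "test u" "test v" for u v
  proof -
    have "I (\<lambda>x. u (f x) * foot_height p x + v (f x) * foot_slope p x)
        = (LINT x|lborel. k (x \<bullet> x) * (u (f x) * foot_height p x) + k (x \<bullet> x) * (v (f x) * foot_slope p x))"
      unfolding I_def by (intro arg_cong[of _ _ "integral\<^sup>L lborel"]) (simp add: fun_eq_iff algebra_simps)
    also have "\<dots> = I (\<lambda>x. u (f x) * foot_height p x) + I (\<lambda>x. v (f x) * foot_slope p x)"
      unfolding I_def
      by (intro Bochner_Integration.integral_add I_integrable_test[OF t(1) PR(1)] I_integrable_test[OF t(2) PR(2)])
    also have "\<dots> = \<alpha> * I (\<lambda>x. u (f x)) + \<beta> * I (\<lambda>x. v (f x))" using \<alpha>[OF t(1)] \<beta>[OF t(2)] by simp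
    also have "\<dots> = (LINT x|lborel. \<alpha> * (k (x \<bullet> x) * (u (f x) * 1)) + \<beta> * (k (x \<bullet> x) * (v (f x) * 1)))"
      unfolding I_def
      using I_integrable_test[OF t(1) one] I_integrable_test[OF t(2) one] by simp
    also have "\<dots> = I (\<lambda>x. \<alpha> * u (f x) + \<beta> * v (f x))"
      unfolding I_def by (intro arg_cong[of _ _ "integral\<^sup>L lborel"]) (simp add: fun_eq_iff algebra_simps)
    finally show ?thesis .
  qed
  have Wc: "continuous_on {a<..<b} W" by (rule continuous_on_subset[OF W_cont]) auto
  have Ac: "continuous_on {a<..<b} A" by (rule continuous_on_subset[OF A_cont]) auto
  show ?thesis
  proof (intro exI allI impI conjI)
    fix \<zeta> assume t: "test \<zeta>"
    then obtain c d where cd: "a < c" "d < b" "\<And>s. s \<notin> {c..d} \<Longrightarrow> \<zeta> s = 0"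
      by (auto simp: test_def)
    have z: "\<zeta> (f x) = 0" if "f x \<notin> {a<..<b}" for x using cd that by auto
    have SR: "height p x = cos (W (f x)) * foot_height p x + sin (W (f x)) * foot_slope p x" for x
    proof -
      have "cos (W (f x)) * foot_height p x + sin (W (f x)) * foot_slope p x = ((cos (W (f x)))\<^sup>2 + (sin (W (f x)))\<^sup>2) * height p x"
        unfolding foot_height_def foot_slope_def power2_eq_square by algebra
      then show ?thesis unfolding sin_cos_squared_add2 by simp
    qed
    have NR: "normal_height p x = cos (W (f x)) * foot_slope p x - sin (W (f x)) * foot_height p x" for x
    proof -
      have "cos (W (f x)) * foot_slope p x - sin (W (f x)) * foot_height p x = ((cos (W (f x)))\<^sup>2 + (sin (W (f x)))\<^sup>2) * normal_height p x"
        unfolding foot_height_def foot_slope_def power2_eq_square by algebra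
      then show ?thesis unfolding sin_cos_squared_add2 by simp
    qed
    have "I (\<lambda>x. \<zeta> (f x) * height p x)
        = I (\<lambda>x. (\<zeta> (f x) * cos (W (f x))) * foot_height p x + (\<zeta> (f x) * sin (W (f x))) * foot_slope p x)"
      by (simp add: SR algebra_simps)
    also have "\<dots> = I (\<lambda>x. \<alpha> * (\<zeta> (f x) * cos (W (f x))) + \<beta> * (\<zeta> (f x) * sin (W (f x))))"
      by (rule combine[of "\<lambda>s. \<zeta> s * cos (W s)" "\<lambda>s. \<zeta> s * sin (W s)"])
         (intro test_mult t continuous_intros Wc)+
    finally show "I (\<lambda>x. \<zeta> (f x) * height p x) = I (\<lambda>x. \<zeta> (f x) * (\<alpha> * cos (W (f x)) + \<beta> * sin (W (f x))))"
      by (simp add: algebra_simps)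
    have "I (\<lambda>x. \<zeta> (f x) * (norm x * (V x \<bullet> p)))
        = I (\<lambda>x. (\<zeta> (f x) * (- sqrt (A (f x)) * sin (W (f x)))) * foot_height p x + (\<zeta> (f x) * (sqrt (A (f x)) * cos (W (f x)))) * foot_slope p x)"
    proof (intro arg_cong[of _ _ I] ext)
      fix x
      show "\<zeta> (f x) * (norm x * (V x \<bullet> p)) = (\<zeta> (f x) * (- sqrt (A (f x)) * sin (W (f x)))) * foot_height p x
          + (\<zeta> (f x) * (sqrt (A (f x)) * cos (W (f x)))) * foot_slope p x"
      proof (cases "f x \<in> {a<..<b}")
        case True
        then have "norm x * (V x \<bullet> p) = sqrt (A (f x)) * normal_height p x" using A_pos[of "f x"] by (simp add: normal_height_def)
        then show ?thesis unfolding NR[of x] by algebra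
      qed (simp add: z)
    qed
    also have "\<dots> = I (\<lambda>x. \<alpha> * (\<zeta> (f x) * (- sqrt (A (f x)) * sin (W (f x)))) + \<beta> * (\<zeta> (f x) * (sqrt (A (f x)) * cos (W (f x)))))"
      by (rule combine[of "\<lambda>s. \<zeta> s * (- sqrt (A s) * sin (W s))" "\<lambda>s. \<zeta> s * (sqrt (A s) * cos (W s))"])
         (intro test_mult t continuous_intros Wc Ac)+
    finally show "I (\<lambda>x. \<zeta> (f x) * (norm x * (V x \<bullet> p)))
       = I (\<lambda>x. \<zeta> (f x) * (sqrt (A (f x)) * (\<beta> * cos (W (f x)) - \<alpha> * sin (W (f x)))))"
      by (simp add: algebra_simps)
  qed
qed

text \<open>The divergence theorem for \<open>\<psi> o f\<close> times the tangential field \<open>|x| p - (x \<bullet> p) x / |x|\<close>, which is a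
  multiple of the gradient of the height and has divergence \<open>- n\<close> times the height: linear
  functions are eigenfunctions of the Laplacian of the sphere with eigenvalue \<open>n\<close>.\<close>

lemma harmonic_test:
  assumes \<psi>: "\<And>s. (\<psi> has_real_derivative \<psi>' s) (at s)" "continuous_on UNIV \<psi>'"
  shows "I (\<lambda>x. \<psi>' (f x) * (norm x * (V x \<bullet> p))) = real n * I (\<lambda>x. \<psi> (f x) * height p x)"
proof -
  let ?T = "\<lambda>x. norm x *\<^sub>R p - ((x \<bullet> p) / norm x) *\<^sub>R x"
  let ?T' = "\<lambda>x h. ((x \<bullet> h) / norm x) *\<^sub>R p
     - ((((h \<bullet> p) / norm x - (x \<bullet> h) * (x \<bullet> p) / (norm x) ^ 3)) *\<^sub>R x + ((x \<bullet> p) / norm x) *\<^sub>R h)"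
  let ?F = "\<lambda>x. k (x \<bullet> x) * \<psi> (f x)"
  let ?F' = "\<lambda>x h. k' (x \<bullet> x) * (2 * (x \<bullet> h)) * \<psi> (f x) + k (x \<bullet> x) * (\<psi>' (f x) * (V x \<bullet> h))"
  let ?D = "\<lambda>x. k (x \<bullet> x) * (\<psi>' (f x) * (norm x * (V x \<bullet> p)) - real n * (\<psi> (f x) * height p x))"
  have \<psi>c: "continuous_on UNIV \<psi>"
    by (intro continuous_at_imp_continuous_on ballI DERIV_isCont[OF \<psi>(1)])
  have Vc: "continuous_on (- {0}) V"
    using V_der by (auto intro!: continuous_at_imp_continuous_on has_derivative_continuous)
  have "(LINT x|lborel. ?D x) = 0"
  proof (rule integral_divergence_zero(2)[OF open_nonzero compact_annulus annulus_nonzero])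
    show "?F x = 0" if "x \<notin> annulus" for x using k_off_annulus[OF that] by simp
    show "(?F has_derivative ?F' x) (at x)" if "x \<in> - {0}" for x
    proof -
      have x: "x \<noteq> 0" using that by simp
      have "((\<lambda>x. \<psi> (f x)) has_derivative (\<lambda>h. \<psi>' (f x) * (V x \<bullet> h))) (at x)"
        using has_derivative_compose[OF f_der[OF x] \<psi>(1)[unfolded has_field_derivative_def]] .
      from has_derivative_mult[OF kx_der this] show ?thesis
        by (rule has_derivative_eq_rhs) (simp add: fun_eq_iff)
    qed
    show "continuous_on (- {0}) (\<lambda>x. ?F' x h)" for h
      by (intro continuous_intros Vc f_cont continuous_on_compose_UNIV[OF k_cont]
          continuous_on_compose_UNIV[OF k'_cont] continuous_on_compose_UNIV[OF \<psi>c]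
          continuous_on_compose_UNIV[OF \<psi>(2)])
    show "(?T has_derivative ?T' x) (at x)" if "x \<in> - {0}" for x
    proof -
      have x: "x \<noteq> 0" using that by simp
      note n = has_derivative_norm'[OF x]
      have "((\<lambda>x. (x \<bullet> p) / norm x) has_derivative (\<lambda>h. (h \<bullet> p) / norm x - (x \<bullet> h) * (x \<bullet> p) / (norm x) ^ 3)) (at x)"
        using height_der[OF x, of p] by (simp add: height_def[abs_def] sgn_div_norm divide_inverse mult.commute)
      from has_derivative_diff[OF has_derivative_scaleR[OF n has_derivative_const] has_derivative_scaleR[OF this has_derivative_ident]]
      show ?thesis by (rule has_derivative_eq_rhs) (simp add: fun_eq_iff algebra_simps)
    qed
    show "continuous_on (- {0}) (\<lambda>x. ?T' x h)" for h by (intro continuous_intros) auto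
    show "?D x = (if x \<in> - {0} then ?F' x (?T x) + ?F x * (\<Sum>b\<in>Basis. ?T' x b \<bullet> b) else 0)" for x
    proof (cases "x = 0")
      case False
      have nx: "norm x > 0" "x \<bullet> x = norm x * norm x" using False by (simp_all add: dot_square_norm power2_eq_square)
      have xT: "x \<bullet> ?T x = 0" using nx by (simp add: inner_diff_right)
      have VT: "V x \<bullet> ?T x = norm x * (V x \<bullet> p)" using V_radial[OF False] by (simp add: inner_diff_right)
      have "(\<Sum>b\<in>Basis. ?T' x b \<bullet> b) = (\<Sum>b\<in>Basis. (x \<bullet> b) * (p \<bullet> b) / norm x
          - (p \<bullet> b) * (x \<bullet> b) / norm x + (x \<bullet> p) / norm x ^ 3 * ((x \<bullet> b) * (x \<bullet> b)) - (x \<bullet> p) / norm x)"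
        by (intro sum.cong refl) (simp add: inner_diff_left inner_add_left inner_commute algebra_simps)
      also have "\<dots> = (x \<bullet> p) / norm x ^ 3 * (x \<bullet> x) - real (n + 1) * ((x \<bullet> p) / norm x)"
        by (simp add: sum.distrib sum_subtractf dim mult.commute
            flip: sum_distrib_left sum_divide_distrib euclidean_inner[of x x])
      also have "\<dots> = - (real n * ((x \<bullet> p) / norm x))"
        unfolding nx(2) using nx(1) by (simp add: field_simps power3_eq_cube)
      finally have div: "(\<Sum>b\<in>Basis. ?T' x b \<bullet> b) = - (real n * height p x)"
        by (simp add: height_def sgn_div_norm divide_inverse mult.commute)
      show ?thesis unfolding div xT VT using False by (simp add: algebra_simps)
    qed (use k_off_annulus[of 0] annulus_nonzero in auto)
  qed
  moreover have "(LINT x|lborel. ?D x) = I (\<lambda>x. \<psi>' (f x) * (norm x * (V x \<bullet> p))) - real n * I (\<lambda>x. \<psi> (f x) * height p x)"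
  proof -
    have "integrable lborel (\<lambda>x. k (x \<bullet> x) * (\<psi>' (f x) * (norm x * (V x \<bullet> p))))"
      by (intro I_integrable continuous_intros Vc f_cont continuous_on_compose_UNIV[OF \<psi>(2)])
    moreover have "integrable lborel (\<lambda>x. k (x \<bullet> x) * (\<psi> (f x) * height p x))"
      unfolding height_def
      by (intro I_integrable continuous_intros f_cont continuous_on_compose_UNIV[OF \<psi>c]) auto
    ultimately have "I (\<lambda>x. \<psi>' (f x) * (norm x * (V x \<bullet> p))) - real n * I (\<lambda>x. \<psi> (f x) * height p x)
        = (LINT x|lborel. k (x \<bullet> x) * (\<psi>' (f x) * (norm x * (V x \<bullet> p))) - real n * (k (x \<bullet> x) * (\<psi> (f x) * height p x)))"
      by (simp add: I_def)
    then show ?thesis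
      by (simp add: algebra_simps)
  qed
  ultimately show ?thesis by simp
qed

text \<open>These test functions increase to 1 on the open interval; with them, identities for compactly
  supported functions extend to functions that do not vanish near the focal sets.\<close>

definition "bump j s = max 0 (min 1 (real j * min (s - a) (b - s) - 1))"

lemma bump_test: "test (bump j)"
proof -
  have "bump j s = 0" if "s \<notin> {a + 1 / (real j + 1)..b - 1 / (real j + 1)}" for s
  proof -
    have "min (s - a) (b - s) \<le> 1 / (real j + 1)" using that by auto
    then have "real j * min (s - a) (b - s) \<le> real j * (1 / (real j + 1))" by (intro mult_left_mono) auto
    also have "\<dots> \<le> 1" by simp
    finally show ?thesis by (simp add: bump_def)
  qed
  moreover have "continuous_on UNIV (bump j)" unfolding bump_def by (intro continuous_intros)
  ultimately show ?thesis
    unfolding test_def by (intro conjI exI[of _ "a + 1 / (real j + 1)"] exI[of _ "b - 1 / (real j + 1)"]) auto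
qed

lemma bump_bounds: "0 \<le> bump j s" "bump j s \<le> 1" by (auto simp: bump_def)

lemma bump_limit:
  assumes "s \<in> {a<..<b}" shows "(\<lambda>j. bump j s) \<longlonglongrightarrow> 1"
proof (rule tendsto_eventually)
  let ?m = "min (s - a) (b - s)"
  have m: "?m > 0" using assms by auto
  obtain J where J: "2 / ?m < real J" using reals_Archimedean2 by blast
  show "eventually (\<lambda>j. bump j s = 1) sequentially"
    unfolding eventually_sequentially
  proof (intro exI[of _ J] allI impI)
    fix j assume "J \<le> j"
    then have "2 / ?m < real j" using J by simp
    then have "2 < real j * ?m" using m by (simp add: pos_divide_less_eq)
    then show "bump j s = 1" unfolding bump_def by linarith
  qed
qed

text \<open>Convergence is required for regular values only, because the focal sets are null sets.\<close>

lemma I_limit: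
  assumes h: "continuous_on (- {0}) h"
    and u: "\<And>j. continuous_on UNIV (u j)" "\<And>j s. \<bar>u j s\<bar> \<le> 1"
    and l: "\<And>s. s \<in> {a<..<b} \<Longrightarrow> (\<lambda>j. u j s) \<longlonglongrightarrow> l s" and lm: "l \<in> borel_measurable borel"
  shows "(\<lambda>j. I (\<lambda>x. u j (f x) * h x)) \<longlonglongrightarrow> I (\<lambda>x. l (f x) * h x)"
  unfolding I_def
proof (rule integral_dominated_convergence[where w="\<lambda>x. \<bar>k (x \<bullet> x) * h x\<bar>"])
  have kh: "integrable lborel (\<lambda>x. k (x \<bullet> x) * h x)" by (rule I_integrable[OF h])
  then show "integrable lborel (\<lambda>x. \<bar>k (x \<bullet> x) * h x\<bar>)" by simp
  have "(\<lambda>x. l (f x)) \<in> borel_measurable lborel"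
    using measurable_compose[OF f_borel lm] by simp
  then have "(\<lambda>x. l (f x) * (k (x \<bullet> x) * h x)) \<in> borel_measurable lborel"
    by (rule borel_measurable_times[OF _ borel_measurable_integrable[OF kh]])
  then show "(\<lambda>x. k (x \<bullet> x) * (l (f x) * h x)) \<in> borel_measurable lborel"
    by (simp add: mult.left_commute)
  show "(\<lambda>x. k (x \<bullet> x) * (u j (f x) * h x)) \<in> borel_measurable lborel" for j
    by (intro borel_measurable_integrable I_integrable continuous_on_mult h continuous_on_compose_UNIV[OF u(1)] f_cont)
  show "AE x in lborel. (\<lambda>j. k (x \<bullet> x) * (u j (f x) * h x)) \<longlonglongrightarrow> k (x \<bullet> x) * (l (f x) * h x)"
    using null
  proof eventually_elim
    case (elim x)
    show ?case
    proof (cases "x = 0")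
      case True
      then show ?thesis using k_off_annulus[of 0] annulus_nonzero by auto
    next
      case False
      then have "f x \<in> {a<..<b}" using elim f_bounds[OF False] by auto
      then show ?thesis by (intro tendsto_intros l)
    qed
  qed
  show "AE x in lborel. norm (k (x \<bullet> x) * (u j (f x) * h x)) \<le> \<bar>k (x \<bullet> x) * h x\<bar>" for j
  proof (intro AE_I2)
    fix x :: 'a
    have "\<bar>u j (f x)\<bar> * \<bar>k (x \<bullet> x) * h x\<bar> \<le> 1 * \<bar>k (x \<bullet> x) * h x\<bar>"
      by (intro mult_right_mono u(2)) auto
    then show "norm (k (x \<bullet> x) * (u j (f x) * h x)) \<le> \<bar>k (x \<bullet> x) * h x\<bar>" by (simp add: abs_mult mult.left_commute)
  qed
qed

lemma I_bump_limit:
  assumes h: "continuous_on (- {0}) h"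
  shows "(\<lambda>j. I (\<lambda>x. bump j (f x) * h x)) \<longlonglongrightarrow> I h"
proof -
  have "(\<lambda>j. I (\<lambda>x. bump j (f x) * h x)) \<longlonglongrightarrow> I (\<lambda>x. (\<lambda>_. 1) (f x) * h x)"
    by (rule I_limit[OF h]) (use bump_test bump_bounds bump_limit in \<open>auto simp: test_cont\<close>)
  then show ?thesis by simp
qed

text \<open>Because the focal sets are null sets, test functions suffice to identify an integral.\<close>

lemma I_eqI:
  assumes "continuous_on (- {0}) g" "continuous_on (- {0}) h"
    and "\<And>\<zeta>. test \<zeta> \<Longrightarrow> I (\<lambda>x. \<zeta> (f x) * g x) = I (\<lambda>x. \<zeta> (f x) * h x)"
  shows "I g = I h"
proof (rule LIMSEQ_unique[OF I_bump_limit[OF assms(1)]])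
  show "(\<lambda>j. I (\<lambda>x. bump j (f x) * g x)) \<longlonglongrightarrow> I h"
    using I_bump_limit[OF assms(2)] assms(3)[OF bump_test] by simp
qed

text \<open>The averages of the height are \<open>\<alpha> cos w + \<beta> sin w\<close> at distance \<open>w\<close>, with derivative
  \<open>\<beta> cos w - \<alpha> sin w\<close>.  Vanishing of the derivative at \<open>w = 0\<close> and at \<open>w = W b\<close> forces \<open>\<beta> = 0\<close> and
  \<open>\<alpha> sin (W b) = 0\<close>.\<close>

lemma moments_vanish_or_pi:
  "W b = pi \<or> (\<forall>\<zeta>. test \<zeta> \<longrightarrow> I (\<lambda>x. \<zeta> (f x) * height p x) = 0)"
proof -
  obtain \<alpha> \<beta> where avg: "\<And>\<zeta>. test \<zeta> \<Longrightarrow>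
     I (\<lambda>x. \<zeta> (f x) * height p x) = I (\<lambda>x. \<zeta> (f x) * (\<alpha> * cos (W (f x)) + \<beta> * sin (W (f x)))) \<and>
     I (\<lambda>x. \<zeta> (f x) * (norm x * (V x \<bullet> p)))
       = I (\<lambda>x. \<zeta> (f x) * (sqrt (A (f x)) * (\<beta> * cos (W (f x)) - \<alpha> * sin (W (f x)))))"
    using average_height[of p] by blast
  \<comment> \<open>\<open>A\<close> and \<open>W\<close> are only known to be continuous on the range of \<open>f\<close>; clamping makes them continuous
    on the whole line.\<close>
  define cl where "cl s = max a (min b s)" for s
  have cl: "continuous_on UNIV cl" "range cl \<subseteq> {a..b}" "\<And>s. s \<in> {a..b} \<Longrightarrow> cl s = s"
    using ab unfolding cl_def by (auto intro!: continuous_intros)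
  have clc: "continuous_on UNIV (\<lambda>s. g (cl s))" if "continuous_on {a..b} g" for g :: "real \<Rightarrow> real"
    by (rule continuous_on_compose2[OF that cl(1,2)])
  have fcl: "cl (f x) = f x" if "x \<noteq> 0" for x using cl(3) f_bounds[OF that] by blast
  define \<Phi> where "\<Phi> s = \<alpha> * cos (W (cl s)) + \<beta> * sin (W (cl s))" for s
  define \<Phi>' where "\<Phi>' s = \<beta> * cos (W (cl s)) - \<alpha> * sin (W (cl s))" for s
  have \<Phi>c: "continuous_on UNIV \<Phi>" "continuous_on UNIV \<Phi>'"
    unfolding \<Phi>_def \<Phi>'_def by (intro continuous_intros clc[OF W_cont])+
  have Ac: "continuous_on UNIV (\<lambda>s. A (cl s))" by (rule clc[OF A_cont])
  have cf: "continuous_on (- {0}) (\<lambda>x. g (f x))" if "continuous_on UNIV g" for g :: "real \<Rightarrow> real"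
    by (rule continuous_on_compose_UNIV[OF that f_cont])
  have Icong: "I g = I h" if "\<And>x. x \<noteq> 0 \<Longrightarrow> g x = h x" for g h
    unfolding I_def
  proof (intro Bochner_Integration.integral_cong refl)
    fix x :: 'a
    show "k (x \<bullet> x) * g x = k (x \<bullet> x) * h x"
      using that[of x] k_off_annulus[of x] annulus_nonzero by (cases "x = 0") auto
  qed
  have flux: "I (\<lambda>x. \<psi>' (f x) * (sqrt (A (cl (f x))) * \<Phi>' (f x))) = real n * I (\<lambda>x. \<psi> (f x) * \<Phi> (f x))"
    if \<psi>: "\<And>s. (\<psi> has_real_derivative \<psi>' s) (at s)" "continuous_on UNIV \<psi>'" for \<psi> \<psi>'
  proof -
    have \<psi>c: "continuous_on UNIV \<psi>"
      by (intro continuous_at_imp_continuous_on ballI DERIV_isCont[OF \<psi>(1)])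
    have Vc: "continuous_on (- {0}) V"
      using V_der by (auto intro!: continuous_at_imp_continuous_on has_derivative_continuous)
    have 1: "I (\<lambda>x. \<psi>' (f x) * (norm x * (V x \<bullet> p))) = I (\<lambda>x. \<psi>' (f x) * (sqrt (A (cl (f x))) * \<Phi>' (f x)))"
    proof (rule I_eqI)
      fix \<zeta> assume "test \<zeta>"
      then have t: "test (\<lambda>s. \<zeta> s * \<psi>' s)" using \<psi>(2) continuous_on_subset test_mult by blast
      have "I (\<lambda>x. \<zeta> (f x) * (\<psi>' (f x) * (norm x * (V x \<bullet> p))))
          = I (\<lambda>x. \<zeta> (f x) * \<psi>' (f x) * (norm x * (V x \<bullet> p)))" by (simp add: mult.assoc)
      also have "\<dots> = I (\<lambda>x. \<zeta> (f x) * \<psi>' (f x) * (sqrt (A (f x)) * (\<beta> * cos (W (f x)) - \<alpha> * sin (W (f x)))))"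
        using avg[OF t] by blast
      also have "\<dots> = I (\<lambda>x. \<zeta> (f x) * (\<psi>' (f x) * (sqrt (A (cl (f x))) * \<Phi>' (f x))))"
        by (rule Icong) (simp add: fcl \<Phi>'_def mult.assoc)
      finally show "I (\<lambda>x. \<zeta> (f x) * (\<psi>' (f x) * (norm x * (V x \<bullet> p))))
          = I (\<lambda>x. \<zeta> (f x) * (\<psi>' (f x) * (sqrt (A (cl (f x))) * \<Phi>' (f x))))" .
    qed (intro continuous_intros cf[OF \<psi>(2)] cf[OF Ac] cf[OF \<Phi>c(2)] Vc)+
    have 2: "I (\<lambda>x. \<psi> (f x) * height p x) = I (\<lambda>x. \<psi> (f x) * \<Phi> (f x))"
    proof (rule I_eqI)
      fix \<zeta> assume "test \<zeta>"
      then have t: "test (\<lambda>s. \<zeta> s * \<psi> s)" using \<psi>c continuous_on_subset test_mult by blast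
      have "I (\<lambda>x. \<zeta> (f x) * (\<psi> (f x) * height p x)) = I (\<lambda>x. \<zeta> (f x) * \<psi> (f x) * height p x)" by (simp add: mult.assoc)
      also have "\<dots> = I (\<lambda>x. \<zeta> (f x) * \<psi> (f x) * (\<alpha> * cos (W (f x)) + \<beta> * sin (W (f x))))"
        using avg[OF t] by blast
      also have "\<dots> = I (\<lambda>x. \<zeta> (f x) * (\<psi> (f x) * \<Phi> (f x)))"
        by (rule Icong) (simp add: fcl \<Phi>_def mult.assoc)
      finally show "I (\<lambda>x. \<zeta> (f x) * (\<psi> (f x) * height p x)) = I (\<lambda>x. \<zeta> (f x) * (\<psi> (f x) * \<Phi> (f x)))" .
    next
      show "continuous_on (- {0}) (\<lambda>x. \<psi> (f x) * height p x)"
        unfolding height_def by (intro continuous_intros cf[OF \<psi>c]) auto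
      show "continuous_on (- {0}) (\<lambda>x. \<psi> (f x) * \<Phi> (f x))"
        by (intro continuous_intros cf[OF \<psi>c] cf[OF \<Phi>c(1)])
    qed
    show ?thesis using harmonic_test[OF \<psi>] 1 2 by simp
  qed
  define N where "N = density lborel (\<lambda>x::'a. ennreal (k (x \<bullet> x)))"
  have km: "(\<lambda>x::'a. k (x \<bullet> x)) \<in> borel_measurable lborel"
    by (simp add: borel_measurable_continuous_onI continuous_on_compose_UNIV[OF k_cont] continuous_intros)
  have fN: "f \<in> measurable N borel" using f_borel by (simp add: N_def)
  define M where "M = distr N borel f"
  have intM: "(LINT s|M. g s) = I (\<lambda>x. g (f x))" if "continuous_on UNIV g" for g :: "real \<Rightarrow> real"
  proof -
    have gm: "g \<in> borel_measurable borel" by (rule borel_measurable_continuous_onI[OF that])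
    have "(LINT s|M. g s) = (LINT x|N. g (f x))" unfolding M_def by (rule integral_distr[OF fN gm])
    also have "\<dots> = (LINT x|lborel. k (x \<bullet> x) *\<^sub>R g (f x))"
      unfolding N_def using measurable_compose[OF f_borel gm] km k_nonneg
      by (intro integral_density) auto
    finally show ?thesis by (simp add: I_def)
  qed
  have fin: "finite_measure M"
  proof -
    have "emeasure N (space N) = (\<integral>\<^sup>+x. ennreal (k (x \<bullet> x)) \<partial>(lborel :: 'a measure))"
      unfolding N_def using km by (subst emeasure_density) auto
    also have "\<dots> < \<infinity>"
      using I_integrable[of "\<lambda>_. 1"] k_nonneg by (simp add: integrable_iff_bounded)
    finally have "finite_measure N" by (intro finite_measureI) auto
    then show ?thesis unfolding M_def by (rule finite_measure.finite_measure_distr[OF _ fN])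
  qed
  have sM: "sets M = sets borel" by (simp add: M_def)
  have supp: "AE s in M. a < s \<and> s < b"
  proof -
    have "AE x in N. a < f x \<and> f x < b"
      unfolding N_def
    proof (subst AE_density)
      show "(\<lambda>x::'a. ennreal (k (x \<bullet> x))) \<in> borel_measurable lborel" using km by simp
      show "AE x in lborel. 0 < ennreal (k (x \<bullet> x)) \<longrightarrow> a < f x \<and> f x < b"
        using null
      proof eventually_elim
        case (elim x)
        show ?case
        proof
          assume "0 < ennreal (k (x \<bullet> x))"
          then have x: "x \<noteq> 0" using k_off_annulus[of x] annulus_nonzero by fastforce
          then show "a < f x \<and> f x < b" using elim f_bounds[OF x] by auto
        qed
      qed
    qed
    then show ?thesis unfolding M_def by (subst AE_distr_iff[OF fN]) auto
  qed
  have pos: "emeasure M {s<..<t} \<noteq> 0" if st: "a \<le> s" "s < t" "t \<le> b" for s t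
  proof
    assume 0: "emeasure M {s<..<t} = 0"
    define g where "g u = max 0 (min (u - s) (t - u))" for u
    have gc: "continuous_on UNIV g" unfolding g_def by (intro continuous_intros)
    have "AE u in M. u \<notin> {s<..<t}"
      using 0 sM by (subst AE_iff_measurable[of "{s<..<t}"]) (auto simp: sets_eq_imp_space_eq[OF sM])
    then have "AE u in M. g u = 0" by eventually_elim (auto simp: g_def)
    then have "(LINT u|M. g u) = 0" by (rule integral_eq_zero_AE)
    then have "I (\<lambda>x. g (f x)) = 0" using intM[OF gc] by simp
    moreover obtain x where "x \<noteq> 0" "k (x \<bullet> x) > 0" "f x = (s + t) / 2"
      using level_point[of "(s + t) / 2"] st by auto
    then have "I (\<lambda>x. g (f x)) > 0"
      using st by (intro I_pos[of _ x] cf[OF gc]) (auto simp: g_def)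
    ultimately show False by simp
  qed
  have fluxM: "(LINT s|M. \<psi>' s * (sqrt (A (cl s)) * \<Phi>' s)) = real n * (LINT s|M. \<psi> s * \<Phi> s)"
    if \<psi>: "\<And>s. (\<psi> has_real_derivative \<psi>' s) (at s)" "continuous_on UNIV \<psi>'" for \<psi> \<psi>'
  proof -
    have \<psi>c: "continuous_on UNIV \<psi>"
      by (intro continuous_at_imp_continuous_on ballI DERIV_isCont[OF \<psi>(1)])
    have "(LINT s|M. \<psi>' s * (sqrt (A (cl s)) * \<Phi>' s)) = I (\<lambda>x. \<psi>' (f x) * (sqrt (A (cl (f x))) * \<Phi>' (f x)))"
      by (rule intM) (intro continuous_intros \<psi>(2) Ac \<Phi>c)
    moreover have "(LINT s|M. \<psi> s * \<Phi> s) = I (\<lambda>x. \<psi> (f x) * \<Phi> (f x))"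
      by (rule intM) (intro continuous_intros \<psi>c \<Phi>c)
    ultimately show ?thesis using flux[OF \<psi>] by simp
  qed
  have Apos: "A (cl s) > 0" if "s \<in> {a<..<b}" for s using A_pos[OF that] cl(3)[of s] that by simp
  have Ann: "A (cl s) \<ge> 0" for s using A_nonneg cl(2) by blast
  have Wd: "(W has_real_derivative 1 / sqrt (A (cl s))) (at s)" if "s \<in> {a<..<b}" for s
    using W_der[OF that] cl(3)[of s] that by simp
  interpret value_distribution M "\<lambda>s. A (cl s)" \<Phi> \<Phi>' W a b "real n"
    by (rule value_distribution.intro) (use fin sM ab supp pos Ac Apos Ann W_cont Wd \<Phi>c fluxM in auto)
  have \<beta>: "\<beta> = 0" using endpoint_flux_zero cl(3)[of a] ab by (simp add: \<Phi>'_def)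
  have \<alpha>: "\<alpha> = 0 \<or> sin (W b) = 0"
    using endpoint_flux_zero_right cl(3)[of b] ab \<beta> by (simp add: \<Phi>'_def)
  have "W b = pi" if "sin (W b) = 0"
  proof (rule ccontr)
    assume "W b \<noteq> pi"
    then have "0 < W b" "W b < pi" using W_b_le_pi W_less[of a b] ab by auto
    then show False using sin_gt_zero that by force
  qed
  moreover have "\<forall>\<zeta>. test \<zeta> \<longrightarrow> I (\<lambda>x. \<zeta> (f x) * height p x) = 0" if "\<alpha> = 0"
    using avg that \<beta> by (simp add: I_def)
  ultimately show ?thesis using \<alpha> by blast
qed

lemma tube_moment_zero:
  assumes "W b \<noteq> pi"
  shows "I (\<lambda>x. indicator {..<s} (f x) * height p x) = 0"
proof -
  define u where "u j v = bump j v * min 1 (real j * max 0 (s - v))" for j v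
  have uc: "continuous_on UNIV (u j)" for j
    unfolding u_def by (intro continuous_intros test_cont bump_test)
  have ut: "test (u j)" for j
    unfolding u_def by (intro test_mult bump_test continuous_intros)
  have ub: "\<bar>u j v\<bar> \<le> 1" for j v
  proof -
    have "\<bar>bump j v\<bar> * \<bar>min 1 (real j * max 0 (s - v))\<bar> \<le> 1 * 1"
      using bump_bounds[of j v] by (intro mult_mono) (auto simp: min_def)
    then show ?thesis by (simp add: u_def abs_mult)
  qed
  have ul: "(\<lambda>j. u j v) \<longlonglongrightarrow> indicator {..<s} v" if v: "v \<in> {a<..<b}" for v
  proof (cases "v < s")
    case True
    obtain J where J: "1 / (s - v) < real J" using reals_Archimedean2 by blast
    have "(\<lambda>j. min 1 (real j * max 0 (s - v))) \<longlonglongrightarrow> 1"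
    proof (rule tendsto_eventually, unfold eventually_sequentially, intro exI[of _ J] allI impI)
      fix j assume "J \<le> j"
      then have "1 / (s - v) < real j" using J by simp
      then have "1 < real j * (s - v)" using True by (simp add: pos_divide_less_eq)
      then show "min 1 (real j * max 0 (s - v)) = 1" using True by simp
    qed
    then have "(\<lambda>j. u j v) \<longlonglongrightarrow> 1 * 1" unfolding u_def by (intro tendsto_mult bump_limit[OF v])
    then show ?thesis using True by simp
  next
    case False
    then show ?thesis by (simp add: u_def)
  qed
  have Sc: "continuous_on (- {0}) (height p)" unfolding height_def by (intro continuous_intros) auto
  have "(\<lambda>j. I (\<lambda>x. u j (f x) * height p x)) \<longlonglongrightarrow> I (\<lambda>x. indicator {..<s} (f x) * height p x)"
    by (rule I_limit[OF Sc uc ub ul]) auto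
  moreover have "I (\<lambda>x. u j (f x) * height p x) = 0" for j
    using moments_vanish_or_pi[of p] assms ut by blast
  ultimately show ?thesis by (simp add: LIMSEQ_const_iff)
qed

end

lemma max_square_der: "((\<lambda>u::real. (max 0 u)\<^sup>2) has_real_derivative 2 * max 0 u) (at u)"
proof (cases "u = 0")
  case True
  have "((\<lambda>h. ((max 0 (0 + h))\<^sup>2 - (max 0 0)\<^sup>2) / h) \<longlongrightarrow> 0) (at (0::real))"
  proof (rule Lim_null_comparison)
    show "\<forall>\<^sub>F h in at 0. norm (((max 0 (0 + h))\<^sup>2 - (max 0 0)\<^sup>2) / h) \<le> \<bar>h\<bar>"
    proof (rule always_eventually, rule allI)
      fix h :: real
      show "norm (((max 0 (0 + h))\<^sup>2 - (max 0 0)\<^sup>2) / h) \<le> \<bar>h\<bar>"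
        by (cases "h > 0") (auto simp: power2_eq_square max_def)
    qed
    show "((\<lambda>h. \<bar>h\<bar>) \<longlongrightarrow> 0) (at (0::real))"
      by (rule tendsto_eq_intros refl | simp)+
  qed
  then show ?thesis using True by (simp add: DERIV_def)
next
  case False
  show ?thesis
  proof (cases "u > 0")
    case True
    have "((\<lambda>u. u\<^sup>2) has_real_derivative 2 * u) (at u)"
      by (auto intro!: derivative_eq_intros)
    then have "((\<lambda>u. (max 0 u)\<^sup>2) has_real_derivative 2 * u) (at u)"
      by (rule has_field_derivative_transform_within_open[of _ _ _ "{0<..}"]) (use True in auto)
    then show ?thesis using True by simp
  next
    case False
    then have "u < 0" using \<open>u \<noteq> 0\<close> by simp
    have "((\<lambda>u. (max 0 u)\<^sup>2) has_real_derivative 0) (at u)"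
      by (rule has_field_derivative_transform_within_open[of "\<lambda>_. 0" _ _ "{..<0}"]) (use \<open>u < 0\<close> in auto)
    then show ?thesis using \<open>u < 0\<close> by simp
  qed
qed

text \<open>A step function of class \<open>C\<^sup>1\<close> that tends to 1 for large arguments.\<close>

definition smooth_step :: "real \<Rightarrow> real" where
  "smooth_step u = (max 0 u)\<^sup>2 / (1 + (max 0 u)\<^sup>2)"

definition smooth_step' :: "real \<Rightarrow> real" where
  "smooth_step' u = 2 * max 0 u / (1 + (max 0 u)\<^sup>2)\<^sup>2"

lemma smooth_step_der: "(smooth_step has_real_derivative smooth_step' u) (at u)"
proof -
  have "1 + (max 0 u)\<^sup>2 > 0" by (intro add_pos_nonneg) auto
  then have nz: "1 + (max 0 u)\<^sup>2 \<noteq> 0" by simp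
  have "((\<lambda>u. 1 + (max 0 u)\<^sup>2) has_real_derivative 2 * max 0 u) (at u)"
    using DERIV_add[OF DERIV_const max_square_der, of 1 u] by simp
  from DERIV_divide[OF max_square_der this nz]
  show ?thesis
    unfolding smooth_step_def[abs_def] smooth_step'_def
    by (rule DERIV_cong) (simp add: power2_eq_square algebra_simps)
qed

lemma smooth_step'_cont: "continuous_on UNIV smooth_step'"
proof -
  have "1 + (max 0 u)\<^sup>2 \<noteq> 0" for u :: real by (smt (verit) zero_le_power2)
  then show ?thesis unfolding smooth_step'_def by (intro continuous_intros) auto
qed

lemma smooth_step_bounds: "0 \<le> smooth_step u" "smooth_step u \<le> 1"
  unfolding smooth_step_def by (simp_all add: divide_le_eq_1 add_nonneg_nonneg add_pos_nonneg)

lemma smooth_step_neg: "u \<le> 0 \<Longrightarrow> smooth_step u = 0"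
  by (simp add: smooth_step_def)

lemma smooth_step_pos: "u > 0 \<Longrightarrow> smooth_step u > 0"
  by (simp add: smooth_step_def add_pos_nonneg zero_less_divide_iff)

lemma smooth_step_limit:
  assumes "filterlim g at_top sequentially"
  shows "(\<lambda>j. smooth_step (g j)) \<longlonglongrightarrow> 1"
proof -
  have "filterlim (\<lambda>j. (g j)\<^sup>2) at_top sequentially"
    by (rule filterlim_pow_at_top[OF _ assms]) simp
  then have "filterlim (\<lambda>j. 1 + (g j)\<^sup>2) at_top sequentially"
    by (rule filterlim_tendsto_add_at_top[OF tendsto_const])
  then have "(\<lambda>j. 1 - inverse (1 + (g j)\<^sup>2)) \<longlonglongrightarrow> 1 - 0"
    by (intro tendsto_diff tendsto_const tendsto_inverse_0_at_top)
  moreover have "eventually (\<lambda>j. 1 - inverse (1 + (g j)\<^sup>2) = smooth_step (g j)) sequentially"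
    using filterlim_at_top_dense[THEN iffD1, OF assms, THEN spec, of 0]
  proof eventually_elim
    case (elim j)
    have "1 + (g j)\<^sup>2 > 0" by (intro add_pos_nonneg) auto
    then show ?case using elim by (simp add: smooth_step_def field_simps)
  qed
  ultimately show ?thesis using Lim_transform_eventually by fastforce
qed

context isoparametric_extension begin

text \<open>The radial weights may increase to the indicator function of the punctured unit ball, since the
  moments vanish for each of them.\<close>

lemma tube_moment_ball:
  assumes null: "AE x in lborel. x \<noteq> 0 \<longrightarrow> f x \<noteq> a \<and> f x \<noteq> b" and Wb: "W b \<noteq> pi"
  shows "(LINT x|lborel. indicator (ball 0 1 - {0}) x * (indicator {..<s} (f x) * (sgn x \<bullet> p))) = 0"
proof -
  define m where "m j = real j + 3" for j :: nat
  define k where "k j u = smooth_step (m j * u - 1) * smooth_step (m j * (1 - u))" for j u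
  define k' where "k' j u = (smooth_step' (m j * u - 1) * m j) * smooth_step (m j * (1 - u))
      + (smooth_step' (m j * (1 - u)) * - m j) * smooth_step (m j * u - 1)" for j u
  have m: "m j \<ge> 3" for j by (simp add: m_def)
  have m0: "m j > 0" for j using m[of j] by linarith
  have step_cont: "continuous_on UNIV smooth_step"
    by (intro continuous_at_imp_continuous_on ballI DERIV_isCont[OF smooth_step_der])
  have cutoff: "cutoff_extension_null f V DV A A' B a b n (k j) (k' j) (1 / m j) (1 / 2)" for j
  proof (unfold_locales)
    show "(k j has_real_derivative k' j u) (at u)" for u
    proof -
      have 1: "((\<lambda>u. smooth_step (m j * u - 1)) has_real_derivative smooth_step' (m j * u - 1) * m j) (at u)"
        by (rule DERIV_chain2[OF smooth_step_der]) (auto intro!: derivative_eq_intros)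
      have 2: "((\<lambda>u. smooth_step (m j * (1 - u))) has_real_derivative smooth_step' (m j * (1 - u)) * - m j) (at u)"
        by (rule DERIV_chain2[OF smooth_step_der]) (auto intro!: derivative_eq_intros)
      show ?thesis
        unfolding k_def[abs_def] by (rule DERIV_cong[OF DERIV_mult[OF 1 2]]) (simp add: k'_def)
    qed
    show "continuous_on UNIV (k' j)"
      unfolding k'_def
      by (intro continuous_intros continuous_on_compose2[OF smooth_step'_cont] continuous_on_compose2[OF step_cont]) auto
    show "k j u \<ge> 0" for u by (simp add: k_def smooth_step_bounds)
    show "0 < 1 / m j" using m0[of j] by simp
    show "k j u = 0" if "u < 1 / m j \<or> 1 < u" for u
    proof -
      have "m j * u - 1 \<le> 0 \<or> m j * (1 - u) \<le> 0"
        using that m0[of j] by (auto simp: pos_less_divide_eq mult.commute mult_le_0_iff)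
      then show ?thesis using smooth_step_neg by (auto simp: k_def)
    qed
    show "k j (1 / 2) > 0"
      unfolding k_def using m[of j] by (intro mult_pos_pos smooth_step_pos) auto
    show "AE x in lborel. x \<noteq> 0 \<longrightarrow> f x \<noteq> a \<and> f x \<noteq> b" by (rule null)
  qed
  have zero: "(LINT x|lborel. k j (x \<bullet> x) * (indicator {..<s} (f x) * (sgn x \<bullet> p))) = 0" for j
  proof -
    interpret cutoff_extension_null f V DV A A' B a b n "k j" "k' j" "1 / m j" "1 / 2" by (rule cutoff)
    show ?thesis using tube_moment_zero[OF Wb, of s p] by (simp add: I_def height_def)
  qed
  have sgn_m: "(sgn :: 'a \<Rightarrow> 'a) \<in> borel_measurable borel" by (simp add: sgn_div_norm[abs_def])
  have g_m: "(\<lambda>x. indicator {..<s} (f x) * (sgn x \<bullet> p)) \<in> borel_measurable borel"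
    using f_borel sgn_m by measurable
  have "(\<lambda>j. LINT x|lborel. k j (x \<bullet> x) * (indicator {..<s} (f x) * (sgn x \<bullet> p)))
     \<longlonglongrightarrow> (LINT x|lborel. indicator (ball 0 1 - {0}) x * (indicator {..<s} (f x) * (sgn x \<bullet> p)))"
  proof (rule integral_dominated_convergence[where w="\<lambda>x. indicator (cball 0 1) x *\<^sub>R norm p"])
    show "(\<lambda>x. indicator (ball 0 1 - {0}) x * (indicator {..<s} (f x) * (sgn x \<bullet> p))) \<in> borel_measurable lborel"
      using borel_measurable_times[OF borel_measurable_indicator g_m, of "ball 0 1 - {0}"] by simp
    have kc: "continuous_on UNIV (k j)" for j
      unfolding k_def by (intro continuous_intros continuous_on_compose2[OF step_cont]) auto
    have "(\<lambda>x::'a. k j (x \<bullet> x)) \<in> borel_measurable borel" for j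
      by (rule borel_measurable_continuous_onI[OF continuous_on_compose2[OF kc
            continuous_on_inner[OF continuous_on_id continuous_on_id] subset_UNIV]])
    from borel_measurable_times[OF this g_m]
    show "(\<lambda>x. k j (x \<bullet> x) * (indicator {..<s} (f x) * (sgn x \<bullet> p))) \<in> borel_measurable lborel" for j
      by simp
    show "integrable lborel (\<lambda>x::'a. indicator (cball 0 1) x *\<^sub>R norm p)"
      by (rule borel_integrable_compact) auto
    have klim: "(\<lambda>j. k j (x \<bullet> x)) \<longlonglongrightarrow> indicator (ball 0 1 - {0}) x" for x :: 'a
    proof (cases "x \<in> ball 0 1 - {0}")
      case True
      then have x: "0 < x \<bullet> x" "x \<bullet> x < 1"
        by (auto simp: dot_square_norm power_less_one_iff)
      have ml: "filterlim m at_top sequentially"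
        using filterlim_tendsto_add_at_top[OF tendsto_const[of 3] filterlim_real_sequentially]
        by (simp add: m_def[abs_def] add.commute)
      have "filterlim (\<lambda>j. - 1 + m j * (x \<bullet> x)) at_top sequentially"
        by (intro filterlim_tendsto_add_at_top[OF tendsto_const] filterlim_at_top_mult_tendsto_pos[OF tendsto_const x(1)] ml)
      then have 1: "(\<lambda>j. smooth_step (m j * (x \<bullet> x) - 1)) \<longlonglongrightarrow> 1" by (intro smooth_step_limit) simp
      have "filterlim (\<lambda>j. m j * (1 - x \<bullet> x)) at_top sequentially"
        by (intro filterlim_at_top_mult_tendsto_pos[OF tendsto_const] ml) (use x in simp)
      then have 2: "(\<lambda>j. smooth_step (m j * (1 - x \<bullet> x))) \<longlonglongrightarrow> 1" by (rule smooth_step_limit)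
      show ?thesis using tendsto_mult[OF 1 2] True by (simp add: k_def)
    next
      case False
      have "k j (x \<bullet> x) = 0" for j
      proof (cases "x = 0")
        case False
        then have "norm x \<ge> 1" using \<open>x \<notin> ball 0 1 - {0}\<close> by simp
        then have "x \<bullet> x \<ge> 1" by (simp add: dot_square_norm)
        then have "m j * (1 - x \<bullet> x) \<le> 0" using m0[of j] by (simp add: mult_le_0_iff)
        then show ?thesis by (simp add: k_def smooth_step_neg)
      qed (simp add: k_def smooth_step_neg)
      then show ?thesis using False by simp
    qed
    show "AE x in lborel. (\<lambda>j. k j (x \<bullet> x) * (indicator {..<s} (f x) * (sgn x \<bullet> p)))
       \<longlonglongrightarrow> indicator (ball 0 1 - {0}) x * (indicator {..<s} (f x) * (sgn x \<bullet> p))"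
      by (intro AE_I2 tendsto_mult klim tendsto_const)
    show "AE x in lborel. norm (k j (x \<bullet> x) * (indicator {..<s} (f x) * (sgn x \<bullet> p)))
       \<le> indicator (cball 0 1) x *\<^sub>R norm p" for j
    proof (intro AE_I2)
      fix x :: 'a
      have b: "norm (indicator {..<s} (f x) * (sgn x \<bullet> p)) \<le> norm p"
      proof -
        have "\<bar>sgn x \<bullet> p\<bar> \<le> norm (sgn x) * norm p" by (rule Cauchy_Schwarz_ineq2)
        also have "\<dots> \<le> norm p" by (simp add: norm_sgn)
        finally show ?thesis by (simp add: indicator_def)
      qed
      show "norm (k j (x \<bullet> x) * (indicator {..<s} (f x) * (sgn x \<bullet> p))) \<le> indicator (cball 0 1) x *\<^sub>R norm p"
      proof (cases "norm x \<le> 1")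
        case True
        have "\<bar>k j (x \<bullet> x)\<bar> \<le> 1"
          using smooth_step_bounds by (simp add: k_def abs_mult mult_le_one)
        then have "\<bar>k j (x \<bullet> x)\<bar> * norm (indicator {..<s} (f x) * (sgn x \<bullet> p)) \<le> 1 * norm p"
          using b by (intro mult_mono) auto
        then show ?thesis using True by (simp add: abs_mult)
      next
        case False
        then have "x \<bullet> x > 1" by (simp add: dot_square_norm one_less_power)
        then have "m j * (1 - x \<bullet> x) \<le> 0" using m0[of j] by (simp add: mult_le_0_iff)
        then show ?thesis by (simp add: k_def smooth_step_neg)
      qed
    qed
  qed
  then show ?thesis using zero by (simp add: LIMSEQ_const_iff)
qed

end

section \<open>Orthogonal invariance of Lebesgue measure and cones over submanifolds\<close>

text \<open>With \<open>B\<close> the unit ball, evaluate the double integral of \<open>1 (g x \<in> E) 1 (g x + y \<in> B)\<close> over \<open>x\<close> and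
  \<open>y\<close> in two ways: directly, and after translating \<open>x\<close> by the preimage of \<open>- y\<close>.  This yields
  \<open>\<mu> E \<lambda> B = \<mu> B \<lambda> E\<close> for Lebesgue measure \<open>\<lambda>\<close> and its image \<open>\<mu>\<close>, and \<open>\<mu> B = \<lambda> B\<close> because \<open>g\<close> preserves the
  ball.\<close>

lemma lborel_distr_orthogonal:
  fixes g :: "'a::euclidean_space \<Rightarrow> 'a"
  assumes g: "orthogonal_transformation g"
  shows "distr lborel borel g = (lborel :: 'a measure)"
proof (rule measure_eqI)
  fix E :: "'a set" assume "E \<in> sets (distr lborel borel g)"
  then have E[measurable]: "E \<in> sets borel" by simp
  have lin: "linear g" using g by (rule orthogonal_transformation_linear)
  have gm[measurable]: "g \<in> borel_measurable borel"
    by (intro borel_measurable_continuous_onI linear_continuous_on) (simp add: lin linear_conv_bounded_linear[symmetric])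
  obtain g' where g': "\<And>y. g (g' y) = y"
    using orthogonal_transformation_surj[OF g] by (metis surj_def)
  define B where "B = ball (0::'a) 1"
  have B[measurable]: "B \<in> sets borel" by (simp add: B_def)
  have pre: "emeasure lborel {x. g x \<in> X} = (\<integral>\<^sup>+x. indicator X (g x) \<partial>lborel)" if [measurable]: "X \<in> sets borel" for X
  proof -
    have "(\<integral>\<^sup>+x. indicator X (g x) \<partial>lborel) = (\<integral>\<^sup>+x. indicator {x. g x \<in> X} x \<partial>lborel)"
      by (intro nn_integral_cong) (simp add: indicator_def)
    also have "\<dots> = emeasure lborel {x. g x \<in> X}" by (intro nn_integral_indicator) measurable
    finally show ?thesis by simp
  qed
  have shift: "(\<integral>\<^sup>+x. u (x + c) \<partial>lborel) = (\<integral>\<^sup>+x. u x \<partial>lborel)"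
    if "u \<in> borel_measurable borel" for u :: "'a \<Rightarrow> ennreal" and c
    using nn_integral_distr[of "(+) c" lborel borel u] that by (simp add: lborel_distr_plus add.commute)
  have flip: "(\<integral>\<^sup>+y. indicator E (c - y) \<partial>lborel) = emeasure lborel E" for c
  proof -
    have "distr lborel borel (\<lambda>x. c + (-1) *\<^sub>R x) = lborel"
      using lborel_affine[of "-1" c] by (simp add: density_1)
    then have "emeasure lborel E = emeasure (distr lborel borel (\<lambda>x. c - x)) E" by simp
    also have "\<dots> = (\<integral>\<^sup>+y. indicator E y \<partial>distr lborel borel (\<lambda>x. c - x))" by simp
    also have "\<dots> = (\<integral>\<^sup>+y. indicator E (c - y) \<partial>lborel)" by (rule nn_integral_distr) auto
    finally show ?thesis by simp
  qed
  have ball_shift: "(\<integral>\<^sup>+y. indicator B (c + y) \<partial>lborel) = emeasure lborel B" for c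
    using shift[of "indicator B" c] by (simp add: add.commute)
  have gadd: "g (x + g' (- y)) = g x - y" for x y
    using linear_add[OF lin, of x "g' (- y)"] g' by simp
  have "emeasure lborel {x. g x \<in> E} * emeasure lborel B
      = (\<integral>\<^sup>+x. indicator E (g x) * emeasure lborel B \<partial>lborel)"
    unfolding pre[OF E] by (rule nn_integral_multc[symmetric]) simp
  also have "\<dots> = (\<integral>\<^sup>+x. \<integral>\<^sup>+y. indicator E (g x) * indicator B (g x + y) \<partial>lborel \<partial>lborel)"
    by (intro nn_integral_cong) (simp add: nn_integral_cmult ball_shift)
  also have "\<dots> = (\<integral>\<^sup>+y. \<integral>\<^sup>+x. indicator E (g x) * indicator B (g x + y) \<partial>lborel \<partial>lborel)"
    by (rule lborel_pair.Fubini'[symmetric]) simp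
  also have "\<dots> = (\<integral>\<^sup>+y. \<integral>\<^sup>+x. indicator E (g x - y) * indicator B (g x) \<partial>lborel \<partial>lborel)"
  proof (rule nn_integral_cong)
    fix y
    show "(\<integral>\<^sup>+x. indicator E (g x) * indicator B (g x + y) \<partial>lborel)
        = (\<integral>\<^sup>+x. indicator E (g x - y) * indicator B (g x) \<partial>lborel)"
      using shift[of "\<lambda>x. indicator E (g x) * indicator B (g x + y)" "g' (- y)"] by (simp add: gadd)
  qed
  also have "\<dots> = (\<integral>\<^sup>+x. \<integral>\<^sup>+y. indicator E (g x - y) * indicator B (g x) \<partial>lborel \<partial>lborel)"
    by (rule lborel_pair.Fubini') simp
  also have "\<dots> = (\<integral>\<^sup>+x. emeasure lborel E * indicator B (g x) \<partial>lborel)"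
    by (intro nn_integral_cong) (simp add: nn_integral_multc flip)
  also have "\<dots> = emeasure lborel E * emeasure lborel {x. g x \<in> B}"
    unfolding pre[OF B] by (rule nn_integral_cmult) simp
  also have "{x. g x \<in> B} = B" using g by (simp add: B_def orthogonal_transformation_norm set_eq_iff)
  finally have "emeasure lborel B * emeasure lborel {x. g x \<in> E} = emeasure lborel B * emeasure lborel E"
    by (simp add: mult.commute)
  moreover have "emeasure lborel B \<noteq> 0"
  proof
    assume "emeasure lborel B = 0"
    then have "negligible B"
      using B by (simp add: negligible_iff_null_sets null_sets_completionI null_setsI)
    then show False using open_not_negligible[of B] by (simp add: B_def)
  qed
  moreover have "emeasure lborel B \<noteq> top"
    using emeasure_lborel_ball_finite[of "0::'a" 1] by (simp add: B_def)
  ultimately have "emeasure lborel {x. g x \<in> E} = emeasure lborel E"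
    by (simp add: ennreal_mult_cancel_left)
  moreover have "emeasure (distr lborel borel g) E = emeasure lborel (g -` E \<inter> space lborel)"
    by (rule emeasure_distr) auto
  moreover have "g -` E \<inter> space lborel = {x. g x \<in> E}" by auto
  ultimately show "emeasure (distr lborel borel g) E = emeasure lborel E" by simp
qed simp

text \<open>Locally the cone is the image of a piece of the linear space spanned by \<open>W\<close> and a unit vector \<open>e\<close>
  orthogonal to it under the smooth map \<open>G\<close>, where the coordinate along \<open>e\<close> is the radius.  By the
  bound on the codimension this is a proper subspace.\<close>

lemma negligible_cone_submanifold:
  fixes M :: "'a::euclidean_space set"
  assumes "sphere_codim_ge M 1"
  shows "negligible {x. x \<noteq> 0 \<and> sgn x \<in> M}"
proof (subst locally_negligible_alt, rule ballI)
  fix x0 :: 'a assume x0: "x0 \<in> {x. x \<noteq> 0 \<and> sgn x \<in> M}"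
  then have "sgn x0 \<in> M" by simp
  then have "\<exists>d. d + 1 + 1 \<le> DIM('a) \<and> submanifold_at M (sgn x0) d"
    using assms unfolding sphere_codim_ge_def by (elim conjE) (rule bspec)
  then obtain d where d: "d + 1 + 1 \<le> DIM('a)" "submanifold_at M (sgn x0) d" by (elim exE conjE)
  from d(2) obtain U V \<phi> \<psi> W where 1: "open U" "open V" "sgn x0 \<in> U" "homeomorphism U V \<phi> \<psi>"
      "smooth_on V \<psi>" "subspace W" "dim W = d" "\<phi> ` (M \<inter> U) = V \<inter> (W :: 'a set)"
    unfolding submanifold_at_def by (elim exE conjE)
  have "dim W < DIM('a)" using 1(7) d(1) by simp
  then obtain e0 where e0: "e0 \<noteq> 0" "\<And>y. y \<in> span W \<Longrightarrow> orthogonal e0 y"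
    using orthogonal_to_subspace_exists by blast
  define e where "e = sgn e0"
  have e: "e \<bullet> e = 1" using e0 by (simp add: e_def dot_square_norm norm_sgn)
  have eW: "w \<bullet> e = 0" if "w \<in> W" for w
    using e0(2)[OF span_base[OF that]] by (simp add: e_def sgn_div_norm orthogonal_def inner_commute)
  define pr where "pr y = y - (y \<bullet> e) *\<^sub>R e" for y
  define G where "G y = (y \<bullet> e) *\<^sub>R \<psi> (pr y)" for y
  define T where "T = span (insert e W) \<inter> pr -` V"
  define C where "C = {x. x \<noteq> 0 \<and> sgn x \<in> M \<inter> U}"
  have "dim (insert e W) \<le> d + 1" using 1(7) by (simp add: dim_insert)
  then have "negligible T"
    unfolding T_def using d(1) by (intro negligible_Int negligible_lowdim disjI1) (simp add: dim_span)
  have prV: "open (pr -` V)"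
    unfolding pr_def by (intro open_vimage 1(2) continuous_intros)
  have \<psi>: "Ck_on (Suc 0) V \<psi>" by (rule smooth_on_imp_Ck_on[OF 1(5,2) order_refl])
  have "G differentiable_on T"
    unfolding differentiable_on_def
  proof
    fix y assume "y \<in> T"
    then have "pr y \<in> V" by (simp add: T_def)
    then have "\<psi> differentiable (at (pr y))"
      using has_derivative_Ck_on[OF 1(2) \<psi>] differentiableI by blast
    moreover have ye: "(\<lambda>y. y \<bullet> e) differentiable (at y)"
      by (rule bounded_linear_imp_differentiable[OF bounded_linear_inner_left])
    moreover have "pr differentiable (at y)"
      unfolding pr_def by (intro derivative_intros ye)
    ultimately have "(\<lambda>y. \<psi> (pr y)) differentiable (at y)"
      using differentiable_chain_at[of pr y \<psi>] by (simp add: o_def)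
    then have "G differentiable (at y)"
      unfolding G_def by (intro differentiable_scaleR ye)
    then show "G differentiable (at y within T)" by (rule differentiable_at_withinI)
  qed
  then have neg: "negligible (G ` T)"
    by (rule negligible_differentiable_image_negligible[OF order_refl \<open>negligible T\<close>])
  have "C \<subseteq> G ` T"
  proof
    fix x assume "x \<in> C"
    then have x: "x \<noteq> 0" "sgn x \<in> M" "sgn x \<in> U" by (auto simp: C_def)
    define z where "z = \<phi> (sgn x)"
    have z: "z \<in> V" "z \<in> W" using 1(8) x by (auto simp: z_def)
    have \<psi>z: "\<psi> z = sgn x" using 1(4) x(3) by (simp add: z_def homeomorphism_def)
    define y where "y = norm x *\<^sub>R e + z"
    have "y \<bullet> e = norm x" "pr y = z" using e eW[OF z(2)] by (simp_all add: y_def pr_def inner_add_left)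
    then have "G y = x" "y \<in> T"
      using \<psi>z z x by (auto simp: G_def T_def y_def sgn_div_norm intro!: span_add span_scale intro: span_base)
    then show "x \<in> G ` T" by blast
  qed
  then have "negligible C" using neg negligible_subset by blast
  moreover have "openin (top_of_set {x. x \<noteq> 0 \<and> sgn x \<in> M}) C"
  proof -
    have "open (- {0} \<inter> sgn -` U)"
      by (rule continuous_open_preimage[OF _ open_nonzero 1(1)]) (auto intro!: continuous_intros)
    moreover have "C = {x. x \<noteq> 0 \<and> sgn x \<in> M} \<inter> (- {0} \<inter> sgn -` U)" by (auto simp: C_def)
    ultimately show ?thesis unfolding openin_open by blast
  qed
  moreover have "x0 \<in> C" using x0 1(3) by (simp add: C_def)
  ultimately show "\<exists>S. openin (top_of_set {x. x \<noteq> 0 \<and> sgn x \<in> M}) S \<and> x0 \<in> S \<and> negligible S" by blast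
qed

section \<open>Isoparametric functions on the sphere\<close>

text \<open>Derivatives within the sphere are determined on tangent vectors, by differentiating along a great
  circle.\<close>

lemma has_derivative_sphere_unique:
  fixes x :: "'a::euclidean_space"
  assumes x: "norm x = 1" and v: "v \<bullet> x = 0"
    and f1: "(f has_derivative f1) (at x within sphere 0 1)"
    and f2: "(f has_derivative f2) (at x within sphere 0 1)"
  shows "f1 v = f2 v"
proof (cases "v = 0")
  case True
  then show ?thesis
    using linear_0[OF has_derivative_linear[OF f1]] linear_0[OF has_derivative_linear[OF f2]] by simp
next
  case False
  define e where "e = sgn v"
  have e: "e \<bullet> e = 1" "e \<bullet> x = 0" "v = norm v *\<^sub>R e"
    using False v by (simp_all add: e_def dot_square_norm norm_sgn sgn_div_norm)
  define c where "c t = cos t *\<^sub>R x + sin t *\<^sub>R e" for t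
  have xx: "x \<bullet> x = 1" using x by (simp add: dot_square_norm)
  have c1: "c t \<in> sphere 0 1" for t
  proof -
    have "c t \<bullet> c t = 1"
      using e by (simp add: c_def inner_add_left inner_add_right xx inner_commute power2_eq_square[symmetric])
    then show ?thesis by (simp add: norm_eq_sqrt_inner)
  qed
  have cd: "(c has_derivative (\<lambda>h. h *\<^sub>R e)) (at 0)"
    unfolding c_def[abs_def] by (auto intro!: derivative_eq_intros)
  have c0: "c 0 = x" by (simp add: c_def)
  have sub: "c ` UNIV \<subseteq> sphere 0 1" using c1 by blast
  have "((\<lambda>t. f (c t)) has_derivative (\<lambda>h. f1 (h *\<^sub>R e))) (at 0)"
    by (rule has_derivative_in_compose[OF cd]) (simp add: c0 has_derivative_subset[OF f1 sub])
  moreover have "((\<lambda>t. f (c t)) has_derivative (\<lambda>h. f2 (h *\<^sub>R e))) (at 0)"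
    by (rule has_derivative_in_compose[OF cd]) (simp add: c0 has_derivative_subset[OF f2 sub])
  ultimately have "(\<lambda>h. f1 (h *\<^sub>R e)) = (\<lambda>h. f2 (h *\<^sub>R e))" by (rule has_derivative_unique)
  from fun_cong[OF this, of "norm v"] show ?thesis using e(3) by simp
qed

lemma sphere_frechet_derivative:
  fixes x :: "'a::euclidean_space"
  assumes x: "norm x = 1" and v: "v \<bullet> x = 0"
    and d: "(Y has_derivative Y') (at x within sphere 0 1)"
  shows "frechet_derivative Y (at x within sphere 0 1) v = Y' v"
proof -
  have "Y differentiable (at x within sphere 0 1)" using d by (rule differentiableI)
  then have "(Y has_derivative frechet_derivative Y (at x within sphere 0 1)) (at x within sphere 0 1)"
    by (simp add: frechet_derivative_works)
  then show ?thesis by (rule has_derivative_sphere_unique[OF x v _ d])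
qed

lemma sphere_grad_eq:
  fixes F :: "'a::euclidean_space \<Rightarrow> real"
  assumes x: "norm x = 1" and w: "w \<bullet> x = 0"
    and d: "((\<lambda>x. F (sgn x)) has_derivative (\<lambda>h. w \<bullet> h)) (at x)"
  shows "sphere_grad F x = w"
  unfolding sphere_grad_def
proof (rule the_equality)
  have F: "(F has_derivative (\<lambda>h. w \<bullet> h)) (at x within sphere 0 1)"
    by (rule has_derivative_transform[OF _ _ has_derivative_at_withinI[OF d]])
       (use x in \<open>auto simp: sgn_div_norm\<close>)
  then show "w \<bullet> x = 0 \<and> (F has_derivative (\<bullet>) w) (at x within sphere 0 1)" using w by simp
  fix w' assume w': "w' \<bullet> x = 0 \<and> (F has_derivative (\<bullet>) w') (at x within sphere 0 1)"
  have "w' \<bullet> (w' - w) = w \<bullet> (w' - w)"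
    by (rule has_derivative_sphere_unique[OF x _ conjunct2[OF w'] F]) (use w w' in \<open>simp add: inner_diff_left\<close>)
  then have "(w' - w) \<bullet> (w' - w) = 0" by (simp add: inner_diff_left)
  then show "w' = w" by simp
qed

text \<open>For unit vectors, the ambient gradient of the homogeneous extension is the gradient on the sphere,
  and since it is orthogonal to \<open>x\<close> everywhere, the radial direction contributes nothing to the ambient
  Laplacian, which therefore agrees with the one on the sphere up to the sign convention.\<close>

lemma isoparametric_extension_exists:
  fixes F :: "'a::euclidean_space \<Rightarrow> real"
  assumes dim: "DIM('a) = n + 1" "n \<ge> 2" and iso: "isoparametric F a b"
  shows "\<exists>V DV A A' B. isoparametric_extension (\<lambda>x. F (sgn x)) V DV A A' B a b n \<and>
     (\<forall>x. norm x = 1 \<longrightarrow> sphere_grad F x = V x)"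
proof -
  from iso have ab: "a < b" and smF: "smooth_on (sphere 0 1) F" and ran: "F ` sphere 0 1 = {a..b}"
    unfolding isoparametric_def by blast+
  from iso have "\<exists>A B. smooth_on {a..b} A \<and> smooth_on {a..b} B \<and>
     (\<forall>x\<in>sphere 0 1. (norm (sphere_grad F x))\<^sup>2 = A (F x) \<and> sphere_laplacian F x = B (F x))"
    unfolding isoparametric_def by (elim conjE)
  then obtain A B where smA: "smooth_on {a..b} A" and smB: "smooth_on {a..b} B"
    and AB: "\<forall>x\<in>sphere 0 1. (norm (sphere_grad F x))\<^sup>2 = A (F x) \<and> sphere_laplacian F x = B (F x)"
    by (elim exE conjE)
  define f where "f x = F (sgn x)" for x
  have f_eq: "f = (\<lambda>x. F (sgn x))" by (simp add: f_def fun_eq_iff)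
  have f2: "Ck_on (Suc (Suc 0)) (- {0}) f" unfolding f_eq by (rule Ck_on_compose_sgn[OF smF])
  define f' where "f' x = frechet_derivative f (at x)" for x
  have f': "(f has_derivative f' x) (at x)" if "x \<noteq> 0" for x
    unfolding f'_def by (rule has_derivative_Ck_on[OF open_nonzero f2]) (use that in simp)
  define V where "V x = (\<Sum>b\<in>Basis. f' x b *\<^sub>R b)" for x
  have V_f': "f' x h = V x \<bullet> h" if "x \<noteq> 0" for x h
  proof -
    have "f' x h = f' x (\<Sum>b\<in>Basis. (h \<bullet> b) *\<^sub>R b)" by (simp add: euclidean_representation)
    also have "\<dots> = (\<Sum>b\<in>Basis. (h \<bullet> b) * f' x b)"
      using linear_sum[OF has_derivative_linear[OF f'[OF that]], of "\<lambda>b. (h \<bullet> b) *\<^sub>R b" Basis]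
        linear_scale[OF has_derivative_linear[OF f'[OF that]]] by simp
    also have "\<dots> = V x \<bullet> h" unfolding V_def inner_sum_left inner_scaleR_left
      by (intro sum.cong refl) (simp add: inner_commute mult.commute)
    finally show ?thesis .
  qed
  have f_der: "(f has_derivative (\<lambda>h. V x \<bullet> h)) (at x)" if "x \<noteq> 0" for x
    using f'[OF that] V_f'[OF that] by (metis (no_types, lifting) ext)
  have V1: "Ck_on (Suc 0) (- {0}) V"
    unfolding V_def
  proof (intro Ck_on_sum Ck_on_scaleR Ck_on_const open_nonzero finite_Basis)
    show "Ck_on (Suc 0) (- {0}) (\<lambda>x. f' x b)" for b
      using f2 unfolding f'_def Ck_on.simps(2)[of "Suc 0"] by blast
  qed
  define DV where "DV x = frechet_derivative V (at x)" for x
  have V_der: "(V has_derivative DV x) (at x)" if "x \<noteq> 0" for x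
    unfolding DV_def by (rule has_derivative_Ck_on[OF open_nonzero V1]) (use that in simp)
  have DV_cont: "continuous_on (- {0}) (\<lambda>x. DV x h)" for h
    using V1 unfolding DV_def Ck_on.simps by blast
  have f_scale: "f (c *\<^sub>R x) = f x" if "c > 0" for c x
    using that by (simp add: f_def sgn_scaleR)
  have V_scale: "V (c *\<^sub>R x) = (1 / c) *\<^sub>R V x" if "c > 0" "x \<noteq> 0" for c x
  proof -
    have "((\<lambda>x. f (c *\<^sub>R x)) has_derivative (\<lambda>h. V (c *\<^sub>R x) \<bullet> (c *\<^sub>R h))) (at x)"
      by (rule has_derivative_compose[where f="\<lambda>x. c *\<^sub>R x" and g=f])
         (use that f_der in \<open>auto intro!: derivative_eq_intros\<close>)
    then have "(f has_derivative (\<lambda>h. V (c *\<^sub>R x) \<bullet> (c *\<^sub>R h))) (at x)" using f_scale[OF that(1)] by simp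
    from has_derivative_unique[OF this f_der[OF that(2)]]
    have "(c *\<^sub>R V (c *\<^sub>R x)) \<bullet> h = V x \<bullet> h" for h by (simp add: fun_eq_iff)
    then have "c *\<^sub>R V (c *\<^sub>R x) = V x" using vector_eq_rdot by blast
    then have "(1 / c) *\<^sub>R (c *\<^sub>R V (c *\<^sub>R x)) = (1 / c) *\<^sub>R V x" by simp
    then show ?thesis using that(1) by simp
  qed
  have V_radial: "V x \<bullet> x = 0" if "x \<noteq> 0" for x
    by (rule gradient_orthogonal_of_radially_constant[OF f_der[OF that] f_scale])
  have DV_scale: "DV (c *\<^sub>R x) h = (1 / c\<^sup>2) *\<^sub>R DV x h" if "c > 0" "x \<noteq> 0" for c x h
  proof -
    have "((\<lambda>x. V (c *\<^sub>R x)) has_derivative (\<lambda>h. DV (c *\<^sub>R x) (c *\<^sub>R h))) (at x)"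
      by (rule has_derivative_compose[where f="\<lambda>x. c *\<^sub>R x" and g=V])
         (use that V_der in \<open>auto intro!: derivative_eq_intros\<close>)
    then have "((\<lambda>x. (1 / c) *\<^sub>R V x) has_derivative (\<lambda>h. DV (c *\<^sub>R x) (c *\<^sub>R h))) (at x)"
      by (rule has_derivative_transform_within_open[OF _ open_nonzero]) (use that V_scale in auto)
    moreover have "((\<lambda>x. (1 / c) *\<^sub>R V x) has_derivative (\<lambda>h. (1 / c) *\<^sub>R DV x h)) (at x)"
      using V_der[OF that(2)] by (intro has_derivative_scaleR_right)
    ultimately have "(\<lambda>h. DV (c *\<^sub>R x) (c *\<^sub>R h)) = (\<lambda>h. (1 / c) *\<^sub>R DV x h)" by (rule has_derivative_unique)
    from fun_cong[OF this, of h] have "c *\<^sub>R DV (c *\<^sub>R x) h = (1 / c) *\<^sub>R DV x h"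
      using linear_scale[OF has_derivative_linear[OF V_der[of "c *\<^sub>R x"]]] that by simp
    then have "(1 / c) *\<^sub>R (c *\<^sub>R DV (c *\<^sub>R x) h) = (1 / c) *\<^sub>R ((1 / c) *\<^sub>R DV x h)" by simp
    then show ?thesis using that(1) by (simp add: power2_eq_square)
  qed
  have grad: "sphere_grad F x = V x" if "norm x = 1" for x
  proof -
    have x0: "x \<noteq> 0" using that by auto
    show ?thesis by (rule sphere_grad_eq[OF that V_radial[OF x0] f_der[OF x0, unfolded f_eq]])
  qed
  have lap: "sphere_laplacian F x = - (\<Sum>b\<in>Basis. DV x b \<bullet> b)" if x: "norm x = 1" for x
  proof -
    have x0: "x \<noteq> 0" using x by auto
    have xx: "x \<bullet> x = 1" using x by (simp add: dot_square_norm)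
    note lin = has_derivative_linear[OF V_der[OF x0]]
    have G: "(sphere_grad F has_derivative DV x) (at x within sphere 0 1)"
      by (rule has_derivative_transform[OF _ _ has_derivative_at_withinI[OF V_der[OF x0]]])
         (use x grad in auto)
    \<comment> \<open>by differentiating \<open>V y \<bullet> y = 0\<close> in the direction \<open>x\<close>\<close>
    have Dxx: "DV x x \<bullet> x = 0"
    proof -
      have "((\<lambda>y. V y \<bullet> y) has_derivative (\<lambda>h. V x \<bullet> h + DV x h \<bullet> x)) (at x)"
        by (intro has_derivative_inner V_der x0 has_derivative_ident)
      then have "((\<lambda>y. 0) has_derivative (\<lambda>h. V x \<bullet> h + DV x h \<bullet> x)) (at x)"
        by (rule has_derivative_transform_within_open[OF _ open_nonzero]) (use x0 V_radial in auto)
      from has_derivative_unique[OF this has_derivative_const]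
      have "V x \<bullet> x + DV x x \<bullet> x = 0" by (rule fun_cong)
      then show ?thesis using V_radial[OF x0] by simp
    qed
    have "sphere_cov_deriv (sphere_grad F) x (tangent_proj x b) \<bullet> b
        = DV x b \<bullet> b - (x \<bullet> b) * (DV x x \<bullet> b) - (DV x b \<bullet> x) * (x \<bullet> b)" for b
    proof -
      have "tangent_proj x b \<bullet> x = 0" by (simp add: tangent_proj_def inner_diff_left xx)
      then have "sphere_cov_deriv (sphere_grad F) x (tangent_proj x b) = tangent_proj x (DV x (tangent_proj x b))"
        by (simp add: sphere_cov_deriv_def sphere_frechet_derivative[OF x _ G])
      moreover have "DV x (tangent_proj x b) = DV x b - (b \<bullet> x) *\<^sub>R DV x x"
        by (simp add: tangent_proj_def linear_diff[OF lin] linear_scale[OF lin])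
      ultimately have "sphere_cov_deriv (sphere_grad F) x (tangent_proj x b)
          = tangent_proj x (DV x b - (b \<bullet> x) *\<^sub>R DV x x)" by metis
      then show ?thesis
        by (simp add: tangent_proj_def[of x "DV x b - _"] inner_diff_left Dxx inner_commute[of b x])
    qed
    then have "sphere_div (sphere_grad F) x
        = (\<Sum>b\<in>Basis. DV x b \<bullet> b) - (\<Sum>b\<in>Basis. (x \<bullet> b) * (DV x x \<bullet> b)) - (\<Sum>b\<in>Basis. (DV x b \<bullet> x) * (x \<bullet> b))"
      by (simp add: sphere_div_def sum_subtractf)
    also have "(\<Sum>b\<in>Basis. (x \<bullet> b) * (DV x x \<bullet> b)) = 0"
      using Dxx euclidean_inner[of x "DV x x"] by (simp add: inner_commute)
    also have "(\<Sum>b\<in>Basis. (DV x b \<bullet> x) * (x \<bullet> b)) = DV x x \<bullet> x"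
    proof -
      have "DV x x = DV x (\<Sum>b\<in>Basis. (x \<bullet> b) *\<^sub>R b)" by (simp add: euclidean_representation)
      also have "\<dots> = (\<Sum>b\<in>Basis. (x \<bullet> b) *\<^sub>R DV x b)" by (simp add: linear_sum[OF lin] linear_scale[OF lin])
      finally show ?thesis by (metis (no_types, lifting) inner_scaleR_left inner_sum_left mult.commute sum.cong)
    qed
    finally show ?thesis by (simp add: sphere_laplacian_def Dxx)
  qed
  have Ck: "Ck_on k {a<..<b} A" for k by (rule smooth_on_imp_Ck_on[OF smA]) auto
  define A' where "A' s = frechet_derivative A (at s) 1" for s
  have A_der: "(A has_real_derivative A' s) (at s)" if "s \<in> {a<..<b}" for s
  proof -
    have d: "(A has_derivative frechet_derivative A (at s)) (at s)"
      by (rule has_derivative_Ck_on[OF _ Ck[of "Suc 0"] that]) simp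
    moreover have "frechet_derivative A (at s) = (*) (A' s)"
    proof
      fix h show "frechet_derivative A (at s) h = A' s * h"
        using linear_scale[OF has_derivative_linear[OF d], of h 1] by (simp add: A'_def mult.commute)
    qed
    ultimately show ?thesis by (simp add: has_field_derivative_def)
  qed
  have A'_diff: "A' differentiable (at s)" if "s \<in> {a<..<b}" for s
  proof -
    have "Ck_on (Suc 0) {a<..<b} A'"
      using Ck[of "Suc (Suc 0)"] unfolding A'_def Ck_on.simps(2)[of "Suc 0"] by blast
    from has_derivative_Ck_on[OF _ this that] show ?thesis by (auto intro: differentiableI)
  qed
  have "isoparametric_extension f V DV A A' B a b n"
  proof
    show "f (sgn x) = f x" for x
      by (cases "x = 0") (simp_all add: f_def sgn_div_norm)
    show "f ` sphere 0 1 = {a..b}"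
    proof -
      have "f ` sphere 0 1 = F ` sphere 0 1" by (intro image_cong) (auto simp: f_def sgn_div_norm)
      then show ?thesis using ran by simp
    qed
    show "(norm x)\<^sup>2 * (V x \<bullet> V x) = A (f x)" if "x \<noteq> 0" for x
    proof -
      have n1: "norm (sgn x) = 1" using that by (simp add: norm_sgn)
      have "V (sgn x) = norm x *\<^sub>R V x"
        using V_scale[of "inverse (norm x)" x] that by (simp add: sgn_div_norm inverse_eq_divide)
      then have "(norm x)\<^sup>2 * (V x \<bullet> V x) = (norm (sphere_grad F (sgn x)))\<^sup>2"
        using grad[OF n1] by (simp add: power_mult_distrib dot_square_norm)
      also have "\<dots> = A (F (sgn x))" using AB n1 by simp
      finally show ?thesis by (simp add: f_def)
    qed
    show "(norm x)\<^sup>2 * (\<Sum>b\<in>Basis. DV x b \<bullet> b) = - B (f x)" if "x \<noteq> 0" for x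
    proof -
      have n1: "norm (sgn x) = 1" using that by (simp add: norm_sgn)
      have "DV (sgn x) h = (norm x)\<^sup>2 *\<^sub>R DV x h" for h
        using DV_scale[of "inverse (norm x)" x h] that by (simp add: sgn_div_norm inverse_eq_divide power_one_over)
      then have "(norm x)\<^sup>2 * (\<Sum>b\<in>Basis. DV x b \<bullet> b) = - sphere_laplacian F (sgn x)"
        using lap[OF n1] by (simp add: sum_distrib_left)
      also have "\<dots> = - B (F (sgn x))" using AB n1 by simp
      finally show ?thesis by (simp add: f_def)
    qed
    show "continuous_on {a..b} A" "continuous_on {a..b} B"
      by (rule smooth_on_imp_continuous_on, fact)+
  qed (use dim ab f_der V_der DV_cont A_der A'_diff in auto)
  then show ?thesis unfolding f_eq using grad by blast
qed

section \<open>Diameter pi forces a single principal curvature\<close>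

context isoparametric_extension begin

text \<open>If the distance of the focal sets is the diameter of the sphere, they consist of antipodal points
  \<open>p\<close> and \<open>- p\<close>.  The distances of \<open>x\<close> to these points add up to \<open>pi\<close>, so both Lipschitz bounds are
  equalities.\<close>

lemma cos_W_linear_of_W_b_pi:
  assumes Wb: "W b = pi"
  shows "\<exists>p. norm p = 1 \<and> (\<forall>x. norm x = 1 \<longrightarrow> cos (W (f x)) = x \<bullet> p)"
proof -
  obtain p where p: "norm p = 1" "f p = a" using f_onto[of a] ab by auto
  obtain q where q: "norm q = 1" "f q = b" using f_onto[of b] ab by auto
  have ip: "\<bar>x \<bullet> y\<bar> \<le> 1" if "norm x = 1" "norm y = 1" for x y :: 'a
    using Cauchy_Schwarz_ineq2[of x y] that by simp
  have "pi \<le> arccos (p \<bullet> q)" using W_lipschitz[OF p(1) q(1)] p q Wb by simp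
  moreover have "arccos (p \<bullet> q) \<le> pi" using ip[OF p(1) q(1)] by (intro arccos_ubound) auto
  ultimately have "arccos (p \<bullet> q) = pi" by simp
  then have pq: "p \<bullet> q = - 1" using cos_arccos_abs[OF ip[OF p(1) q(1)]] by simp
  have "(p + q) \<bullet> (p + q) = p \<bullet> p + 2 * (p \<bullet> q) + q \<bullet> q"
    by (simp add: inner_add_left inner_add_right inner_commute)
  also have "\<dots> = 0" using p q pq by (simp add: dot_square_norm)
  finally have "p + q = 0" by simp
  then have q_eq: "q = - p" by (simp add: eq_neg_iff_add_eq_0 add.commute)
  have "cos (W (f x)) = x \<bullet> p" if x: "norm x = 1" for x
  proof -
    have "W (f x) \<le> arccos (x \<bullet> p)"
      using W_lipschitz[OF p(1) x] p by (simp add: inner_commute)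
    moreover have "pi - W (f x) \<le> pi - arccos (x \<bullet> p)"
      using W_lipschitz[OF x q(1)] q Wb ip[OF x p(1)] by (simp add: q_eq arccos_minus_abs)
    ultimately have "W (f x) = arccos (x \<bullet> p)" by simp
    then show ?thesis using ip[OF x p(1)] by (simp add: cos_arccos_abs)
  qed
  then show ?thesis using p(1) by blast
qed

text \<open>Now \<open>f\<close> is a function of \<open>x \<bullet> p\<close>, and its unit normal is the explicit field \<open>Y\<close>.  In directions
  orthogonal to \<open>x\<close> and \<open>p\<close> its derivative is a scalar multiple of the identity; as the dimension is at
  least 3, there are such directions.\<close>

lemma one_principal_curvature_of_W_b_pi:
  assumes Wb: "W b = pi" and F: "\<And>x. norm x = 1 \<Longrightarrow> f x = F x"
    and grad: "\<And>x. norm x = 1 \<Longrightarrow> sphere_grad F x = V x"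
    and x: "norm x = 1" "F x \<in> {a<..<b}"
  shows "card (principal_curvatures F x) = 1"
proof -
  obtain p where p: "norm p = 1" and cosW: "\<And>x. norm x = 1 \<Longrightarrow> cos (W (f x)) = x \<bullet> p"
    using cos_W_linear_of_W_b_pi[OF Wb] by blast
  have pp: "p \<bullet> p = 1" using p by (simp add: dot_square_norm)
  define Y where "Y y = - (1 / sqrt (1 - (y \<bullet> p)\<^sup>2)) *\<^sub>R (p - (y \<bullet> p) *\<^sub>R y)" for y
  have normal: "unit_normal F y = Y y \<and> (y \<bullet> p)\<^sup>2 < 1" if y: "norm y = 1" "F y \<in> {a<..<b}" for y
  proof -
    have y0: "y \<noteq> 0" using y by auto
    have yy: "y \<bullet> y = 1" using y by (simp add: dot_square_norm)
    have fy: "f y \<in> {a<..<b}" using y F by simp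
    have "0 < W (f y)" "W (f y) < pi"
      using W_less[of a "f y"] W_less[of "f y" b] fy Wb by auto
    then have s: "sin (W (f y)) > 0" by (rule sin_gt_zero)
    have w: "sqrt (A (f y)) > 0" using A_pos[OF fy] by simp
    have c: "cos (W (f y)) = y \<bullet> p" by (rule cosW[OF y(1)])
    have s2: "(sin (W (f y)))\<^sup>2 = 1 - (y \<bullet> p)\<^sup>2" using sin_squared_eq[of "W (f y)"] c by simp
    have lt: "(y \<bullet> p)\<^sup>2 < 1" using s2 s by (smt (verit) zero_less_power)
    have "((\<lambda>s. cos (W s)) has_real_derivative - sin (W (f y)) * (1 / sqrt (A (f y)))) (at (f y))"
      using W_der[OF fy] by (auto intro!: derivative_eq_intros)
    from has_derivative_compose[OF f_der[OF y0] this[unfolded has_field_derivative_def]]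
    have d1: "((\<lambda>x. cos (W (f x))) has_derivative (\<lambda>h. - sin (W (f y)) * (1 / sqrt (A (f y))) * (V y \<bullet> h))) (at y)" .
    note n = has_derivative_norm'[OF y0]
    have "((\<lambda>x. (x \<bullet> p) / norm x) has_derivative (\<lambda>h. (p - (y \<bullet> p) *\<^sub>R y) \<bullet> h)) (at y)"
      using y y0 by (auto intro!: derivative_eq_intros n simp: fun_eq_iff inner_diff_left inner_diff_right inner_commute)
    then have d2: "((\<lambda>x. cos (W (f x))) has_derivative (\<lambda>h. (p - (y \<bullet> p) *\<^sub>R y) \<bullet> h)) (at y)"
    proof (rule has_derivative_transform_within_open[OF _ open_nonzero])
      show "y \<in> - {0}" using y0 by simp
      fix x :: 'a assume "x \<in> - {0}"
      then have "norm (sgn x) = 1" by (simp add: norm_sgn)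
      from cosW[OF this] show "(x \<bullet> p) / norm x = cos (W (f x))"
        by (simp add: f_sgn) (simp add: sgn_div_norm divide_inverse mult.commute)
    qed
    have "(- (sin (W (f y)) / sqrt (A (f y))) *\<^sub>R V y) \<bullet> h = (p - (y \<bullet> p) *\<^sub>R y) \<bullet> h" for h
      using fun_cong[OF has_derivative_unique[OF d1 d2], of h] by simp
    then have "- (sin (W (f y)) / sqrt (A (f y))) *\<^sub>R V y = p - (y \<bullet> p) *\<^sub>R y" using vector_eq_rdot by blast
    then have "- (sqrt (A (f y)) / sin (W (f y))) *\<^sub>R (- (sin (W (f y)) / sqrt (A (f y))) *\<^sub>R V y)
         = - (sqrt (A (f y)) / sin (W (f y))) *\<^sub>R (p - (y \<bullet> p) *\<^sub>R y)" by simp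
    then have Vy: "V y = - (sqrt (A (f y)) / sin (W (f y))) *\<^sub>R (p - (y \<bullet> p) *\<^sub>R y)"
      using s w by simp
    have "(p - (y \<bullet> p) *\<^sub>R y) \<bullet> (p - (y \<bullet> p) *\<^sub>R y) = 1 - (y \<bullet> p)\<^sup>2"
      by (simp add: inner_diff_left inner_diff_right pp yy inner_commute power2_eq_square)
    then have nrm: "norm (p - (y \<bullet> p) *\<^sub>R y) = sqrt (1 - (y \<bullet> p)\<^sup>2)" by (simp add: norm_eq_sqrt_inner)
    have "sgn (V y) = - sgn (p - (y \<bullet> p) *\<^sub>R y)"
      unfolding Vy using s w by (simp add: sgn_scaleR sgn_minus)
    also have "\<dots> = Y y" by (simp add: Y_def sgn_div_norm nrm inverse_eq_divide)
    finally show ?thesis using lt grad[OF y(1)] by (simp add: unit_normal_def)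
  qed
  have x0: "x \<noteq> 0" using x by auto
  have xx: "x \<bullet> x = 1" using x by (simp add: dot_square_norm)
  have lt: "1 - (x \<bullet> p)\<^sup>2 > 0" using normal[OF x] by simp
  define \<sigma> where "\<sigma> = 1 / sqrt (1 - (x \<bullet> p)\<^sup>2)"
  have \<sigma>: "\<sigma> > 0" using lt by (simp add: \<sigma>_def)
  have near: "unit_normal F x = Y x" using normal[OF x] by simp
  have "\<exists>Y'. (Y has_derivative Y') (at x) \<and> (\<forall>v. v \<bullet> p = 0 \<longrightarrow> Y' v = (\<sigma> * (x \<bullet> p)) *\<^sub>R v)"
  proof -
    have "((\<lambda>y. 1 / sqrt (1 - (y \<bullet> p)\<^sup>2)) has_derivative
        (\<lambda>h. (x \<bullet> p) / (sqrt (1 - (x \<bullet> p)\<^sup>2) * (1 - (x \<bullet> p)\<^sup>2)) * (h \<bullet> p))) (at x)"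
    proof -
      have "((\<lambda>s. 1 / sqrt (1 - s\<^sup>2)) has_real_derivative (x \<bullet> p) / (sqrt (1 - (x \<bullet> p)\<^sup>2) * (1 - (x \<bullet> p)\<^sup>2))) (at (x \<bullet> p))"
        using lt by (auto intro!: derivative_eq_intros simp: field_simps)
      from has_derivative_compose[OF has_derivative_inner_left[OF has_derivative_ident] this[unfolded has_field_derivative_def]]
      show ?thesis .
    qed
    then have d1: "((\<lambda>y. - (1 / sqrt (1 - (y \<bullet> p)\<^sup>2))) has_derivative
        (\<lambda>h. - ((x \<bullet> p) / (sqrt (1 - (x \<bullet> p)\<^sup>2) * (1 - (x \<bullet> p)\<^sup>2)) * (h \<bullet> p)))) (at x)"
      by (rule has_derivative_minus)
    have d2: "((\<lambda>y. p - (y \<bullet> p) *\<^sub>R y) has_derivative (\<lambda>h. - ((x \<bullet> p) *\<^sub>R h + (h \<bullet> p) *\<^sub>R x))) (at x)"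
      by (auto intro!: derivative_eq_intros)
    show ?thesis
      unfolding Y_def[abs_def]
      by (intro exI conjI, rule has_derivative_scaleR[OF d1 d2]) (simp add: \<sigma>_def)
  qed
  then obtain Y' where Y': "(Y has_derivative Y') (at x)" "\<And>v. v \<bullet> p = 0 \<Longrightarrow> Y' v = (\<sigma> * (x \<bullet> p)) *\<^sub>R v"
    by blast
  have "open {y. y \<noteq> 0 \<and> f y \<in> {a<..<b}}"
  proof -
    have "open (- {0} \<inter> f -` {a<..<b})"
      by (rule continuous_open_preimage[OF f_cont]) auto
    moreover have "- {0} \<inter> f -` {a<..<b} = {y. y \<noteq> 0 \<and> f y \<in> {a<..<b}}" by auto
    ultimately show ?thesis by simp
  qed
  then obtain d where d: "d > 0" "ball x d \<subseteq> {y. y \<noteq> 0 \<and> f y \<in> {a<..<b}}"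
    using x x0 F unfolding open_contains_ball by (metis (mono_tags, lifting) mem_Collect_eq)
  have U: "(unit_normal F has_derivative Y') (at x within sphere 0 1)"
  proof (rule has_derivative_transform_within[OF has_derivative_at_withinI[OF Y'(1)] d(1)])
    show "x \<in> sphere 0 1" using x by simp
    fix y :: 'a assume y: "y \<in> sphere 0 1" "dist y x < d"
    then have "f y \<in> {a<..<b}" using d(2) by (auto simp: dist_commute)
    then show "Y y = unit_normal F y" using normal[of y] y F by auto
  qed
  have cov: "sphere_cov_deriv (unit_normal F) x v = (\<sigma> * (x \<bullet> p)) *\<^sub>R v" if "v \<bullet> x = 0" "v \<bullet> p = 0" for v
    using sphere_frechet_derivative[OF x(1) that(1) U] Y'(2)[OF that(2)] that(1)
    by (simp add: sphere_cov_deriv_def tangent_proj_def)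
  have vY: "v \<bullet> unit_normal F x = 0 \<longleftrightarrow> v \<bullet> p = 0" if "v \<bullet> x = 0" for v
    using that \<sigma> by (simp add: near Y_def inner_diff_right \<sigma>_def)
  obtain v where v: "v \<noteq> 0" "v \<bullet> x = 0" "v \<bullet> p = 0"
  proof -
    have "dim {x, p} \<le> card {x, p}" by (rule dim_le_card') simp
    also have "\<dots> \<le> 2" by (simp add: card_insert_le_m1)
    also have "\<dots> < DIM('a)" using dim n2 by simp
    finally obtain v where v: "v \<noteq> 0" "\<And>y. y \<in> span {x, p} \<Longrightarrow> orthogonal v y"
      using orthogonal_to_subspace_exists by blast
    have "x \<in> span {x, p}" "p \<in> span {x, p}" by (auto intro: span_base)
    then show thesis using v that[of v] by (auto simp: orthogonal_def)
  qed
  have "principal_curvatures F x = {- (\<sigma> * (x \<bullet> p))}"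
  proof (intro set_eqI iffI)
    fix \<kappa> assume "\<kappa> \<in> principal_curvatures F x"
    then obtain u where u: "u \<noteq> 0" "u \<bullet> x = 0" "u \<bullet> unit_normal F x = 0"
      "- sphere_cov_deriv (unit_normal F) x u = \<kappa> *\<^sub>R u"
      unfolding principal_curvatures_def by blast
    then have "- (\<sigma> * (x \<bullet> p)) *\<^sub>R u = \<kappa> *\<^sub>R u" using cov[of u] vY[of u] by simp
    then have "\<kappa> = - (\<sigma> * (x \<bullet> p))" using u(1) by (metis scaleR_cancel_right)
    then show "\<kappa> \<in> {- (\<sigma> * (x \<bullet> p))}" by simp
  next
    fix \<kappa> assume "\<kappa> \<in> {- (\<sigma> * (x \<bullet> p))}"
    then have "- sphere_cov_deriv (unit_normal F) x v = \<kappa> *\<^sub>R v" using cov[OF v(2,3)] by simp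
    then show "\<kappa> \<in> principal_curvatures F x"
      unfolding principal_curvatures_def using v vY[OF v(2)] by blast
  qed
  then show ?thesis by simp
qed

end

section \<open>Tubes and the Pompeiu property\<close>

context isoparametric_extension begin

text \<open>Below the level \<open>b\<close> the distance to the focal set is a strictly increasing function of the value.  Points
  of the level \<open>b\<close> are farther away than \<open>t\<close> by the definition of the focal distance.\<close>

lemma tube_eq_sublevel:
  assumes F: "\<And>x. norm x = 1 \<Longrightarrow> f x = F x" and t: "0 < t" "t < focal_distance F a b"
  shows "\<exists>s. isoparametric_tube F a t = {x \<in> sphere 0 1. F x < s}"
proof -
  have lev: "level_set F a = {p \<in> sphere 0 1. f p = a}" using F by (auto simp: level_set_def)
  have ne: "level_set F a \<noteq> {}"
  proof -
    obtain x where "norm x = 1" "f x = a" using f_onto[of a] ab by auto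
    then show ?thesis by (auto simp: lev)
  qed
  have nonneg: "sphere_infdist x (level_set F a) \<ge> 0" if "norm x = 1" for x
    unfolding sphere_infdist_def sphere_dist_def
  proof (rule cINF_greatest[OF ne])
    fix p assume "p \<in> level_set F a"
    then have "\<bar>x \<bullet> p\<bar> \<le> 1" using Cauchy_Schwarz_ineq2[of x p] that by (simp add: lev)
    then show "0 \<le> arccos (x \<bullet> p)" by (intro arccos_lbound) auto
  qed
  have dist: "sphere_infdist x (level_set F a) = W (F x)" if "norm x = 1" "F x < b" for x
    using distance_to_level_a[of x] that F by (simp add: sphere_infdist_def sphere_dist_def lev)
  have far: "t < sphere_infdist x (level_set F a)" if "norm x = 1" "F x = b" for x
  proof -
    have "focal_distance F a b \<le> sphere_infdist x (level_set F a)"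
      unfolding focal_distance_def
      by (rule cINF_lower[OF bdd_belowI2[where m=0]]) (use nonneg that in \<open>auto simp: level_set_def\<close>)
    then show ?thesis using t by simp
  qed
  have Fb: "F x \<in> {a..b}" if "norm x = 1" for x
    using f_bounds[OF norm1_nonzero[OF that]] F[OF that] by simp
  have tube: "isoparametric_tube F a t = {x \<in> sphere 0 1. F x < b \<and> W (F x) < t}"
  proof (intro set_eqI iffI)
    fix x assume "x \<in> isoparametric_tube F a t"
    then have x: "norm x = 1" "sphere_infdist x (level_set F a) < t" by (auto simp: isoparametric_tube_def)
    then have "F x \<noteq> b" using far[of x] by auto
    then have "F x < b" using Fb[OF x(1)] by simp
    then show "x \<in> {x \<in> sphere 0 1. F x < b \<and> W (F x) < t}" using x dist[of x] by simp
  next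
    fix x assume "x \<in> {x \<in> sphere 0 1. F x < b \<and> W (F x) < t}"
    then show "x \<in> isoparametric_tube F a t" using dist[of x] by (simp add: isoparametric_tube_def)
  qed
  show ?thesis
  proof (cases "W b \<le> t")
    case True
    have "W (F x) < t" if "norm x = 1" "F x < b" for x
      using W_less[of "F x" b] Fb[OF that(1)] that(2) True by simp
    then have "isoparametric_tube F a t = {x \<in> sphere 0 1. F x < b}" unfolding tube by auto
    then show ?thesis by blast
  next
    case False
    then obtain s where s: "a \<le> s" "s \<le> b" "W s = t"
      using IVT'[of W a t b] W_cont t(1) ab by auto
    have "s < b" using s False by (cases "s = b") auto
    have "F x < b \<and> W (F x) < t \<longleftrightarrow> F x < s" if "norm x = 1" for x
      using W_less[of "F x" s] W_less[of s "F x"] Fb[OF that] s \<open>s < b\<close>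
      by (cases "F x" s rule: linorder_cases) auto
    then have "isoparametric_tube F a t = {x \<in> sphere 0 1. F x < s}" unfolding tube by auto
    then show ?thesis by blast
  qed
qed

end

lemma sphere_integral:
  fixes u :: "'a::euclidean_space \<Rightarrow> real"
  assumes u: "u \<in> borel_measurable borel"
  shows "(LINT x|sphere_measure. u x) = real DIM('a) * (LINT y|lborel. indicator (ball 0 1 - {0}) y * u (sgn y))"
proof -
  let ?D = "ball 0 1 - {0::'a}" and ?S = "sphere 0 1 :: 'a set"
  let ?M = "distr (restrict_space lborel ?D) (restrict_space borel ?S) sgn"
  have sm: "sphere_measure = density ?M (\<lambda>_. ennreal (real DIM('a)))"
  proof (rule measure_eqI)
    fix X :: "'a set" assume "X \<in> sets sphere_measure"
    then have X: "X \<in> sets ?M" by (simp add: sphere_measure_def)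
    then show "emeasure sphere_measure X = emeasure (density ?M (\<lambda>_. ennreal (real DIM('a)))) X"
      by (simp add: sphere_measure_def emeasure_density_const ennreal_of_nat_eq_real_of_nat)
  qed (simp add: sphere_measure_def)
  have uS: "u \<in> borel_measurable (restrict_space borel ?S)" by (rule measurable_restrict_space1[OF u])
  have sg: "sgn \<in> measurable (restrict_space lborel ?D) (restrict_space borel ?S)"
  proof (rule measurable_restrict_space2)
    show "sgn \<in> space (restrict_space lborel ?D) \<rightarrow> ?S" by (auto simp: space_restrict_space norm_sgn)
    have "(sgn :: 'a \<Rightarrow> 'a) \<in> borel_measurable borel" by (simp add: sgn_div_norm[abs_def])
    then show "sgn \<in> borel_measurable (restrict_space lborel ?D)" by (intro measurable_restrict_space1) simp
  qed
  have "(LINT x|sphere_measure. u x) = (LINT x|?M. real DIM('a) *\<^sub>R u x)"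
    unfolding sm by (rule integral_density) (use uS in auto)
  also have "\<dots> = real DIM('a) * (LINT x|?M. u x)" by simp
  also have "(LINT x|?M. u x) = (LINT y|restrict_space lborel ?D. u (sgn y))"
    by (rule integral_distr[OF sg uS])
  also have "\<dots> = (LINT y|lborel. indicator ?D y *\<^sub>R u (sgn y))"
    by (rule integral_restrict_space) simp
  finally show ?thesis by simp
qed

text \<open>An isometry of the sphere preserves inner products, hence Euclidean distances.\<close>

lemma sphere_isometry_orthogonal:
  fixes h :: "'a::euclidean_space \<Rightarrow> 'a"
  assumes "sphere_isometry h"
  shows "\<exists>g. orthogonal_transformation g \<and> (\<forall>x. norm x = 1 \<longrightarrow> g x = h x)"
proof (rule isometry_sphere_extend)
  have im: "h ` sphere 0 1 = sphere 0 1" and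
    di: "\<And>x y. norm x = 1 \<Longrightarrow> norm y = 1 \<Longrightarrow> arccos (h x \<bullet> h y) = arccos (x \<bullet> y)"
    using assms by (auto simp: sphere_isometry_def sphere_dist_def)
  show n: "norm (h x) = 1" if "norm x = 1" for x
    using im that by (metis imageI mem_sphere_0)
  show "dist (h x) (h y) = dist x y" if "norm x = 1" "norm y = 1" for x y
  proof -
    have "\<bar>h x \<bullet> h y\<bar> \<le> 1" "\<bar>x \<bullet> y\<bar> \<le> 1"
      using Cauchy_Schwarz_ineq2[of "h x" "h y"] Cauchy_Schwarz_ineq2[of x y] that n by simp_all
    then have "h x \<bullet> h y = x \<bullet> y"
      using arg_cong[OF di[OF that], of cos] by (simp add: cos_arccos_abs)
    moreover have "h x \<bullet> h x = 1" "h y \<bullet> h y = 1" "x \<bullet> x = 1" "y \<bullet> y = 1"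
      using n that by (simp_all add: dot_square_norm)
    ultimately show ?thesis
      by (simp add: dist_norm norm_eq_sqrt_inner inner_diff_left inner_diff_right inner_commute)
  qed
qed

theorem corollary7:
  fixes F :: "'a::euclidean_space \<Rightarrow> real" and a b t :: real and n :: nat
  assumes "DIM('a) = n + 1"
    and "n \<ge> 2"
    and "proper_isoparametric F a b"
    and "num_principal_curvatures F a b \<noteq> 1"
    and "0 < t"
    and "t < focal_distance F a b"
  shows "\<not> pompeiu_property (isoparametric_tube F a t)"
proof
  assume pompeiu: "pompeiu_property (isoparametric_tube F a t)"
  define f where "f x = F (sgn x)" for x
  have f_eq: "f = (\<lambda>x. F (sgn x))" by (simp add: f_def fun_eq_iff)
  have Ff: "f x = F x" if "norm x = 1" for x using that by (simp add: f_def sgn_div_norm)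
  from assms(3) have "isoparametric F a b" by (simp add: proper_isoparametric_def)
  from isoparametric_extension_exists[OF assms(1,2) this] obtain V DV A A' B where
    ext: "isoparametric_extension f V DV A A' B a b n" and grad: "\<forall>x. norm x = 1 \<longrightarrow> sphere_grad F x = V x"
    unfolding f_eq by (elim exE conjE)
  interpret isoparametric_extension f V DV A A' B a b n by (rule ext)
  have "W b \<noteq> pi"
  proof
    assume Wb: "W b = pi"
    have one: "card (principal_curvatures F x) = 1" if "s \<in> {a<..<b}" "x \<in> level_set F s" for s x
      using one_principal_curvature_of_W_b_pi[OF Wb Ff, of x] grad that by (auto simp: level_set_def)
    have "num_principal_curvatures F a b = 1"
      unfolding num_principal_curvatures_def
    proof (rule the_equality)
      show "\<forall>s\<in>{a<..<b}. \<forall>x\<in>level_set F s. card (principal_curvatures F x) = 1" using one by blast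
      fix g assume g: "\<forall>s\<in>{a<..<b}. \<forall>x\<in>level_set F s. card (principal_curvatures F x) = g"
      obtain x where x: "norm x = 1" "f x = (a + b) / 2" using f_onto[of "(a + b) / 2"] ab by auto
      have "x \<in> level_set F ((a + b) / 2)" "(a + b) / 2 \<in> {a<..<b}"
        using x Ff ab by (auto simp: level_set_def)
      then show "g = 1" using g one by metis
    qed
    then show False using assms(4) by simp
  qed
  have null: "AE x in lborel. x \<noteq> 0 \<longrightarrow> f x \<noteq> a \<and> f x \<noteq> b"
  proof -
    have "AE x in lborel. \<not> (x \<noteq> 0 \<and> sgn x \<in> level_set F c)" if "sphere_codim_ge (level_set F c) 2" for c
    proof -
      have "sphere_codim_ge (level_set F c) 1"
        using that unfolding sphere_codim_ge_def by (metis add_leD1 add.commute add.left_commute add.assoc one_add_one)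
      then have "negligible {x. x \<noteq> 0 \<and> sgn x \<in> level_set F c}" by (rule negligible_cone_submanifold)
      then have "AE x in lebesgue. x \<notin> {x. x \<noteq> 0 \<and> sgn x \<in> level_set F c}"
        by (intro AE_not_in) (simp add: negligible_iff_null_sets)
      then show ?thesis by (simp add: AE_completion_iff)
    qed
    from this[of a] this[of b] show ?thesis
      using assms(3) unfolding proper_isoparametric_def
      by (auto simp: level_set_def f_def norm_sgn elim: eventually_elim2)
  qed
  obtain s where tube: "isoparametric_tube F a t = {x \<in> sphere 0 1. F x < s}"
    using tube_eq_sublevel[OF Ff assms(5,6)] by blast
  obtain p :: 'a where p: "norm p = 1" using f_onto[of a] ab by auto
  \<comment> \<open>By the Pompeiu property the linear function would vanish, since its integral over each congruent
    copy of the tube is a first moment of the tube itself.\<close>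
  have "\<forall>x\<in>sphere 0 1. x \<bullet> p = 0"
  proof (rule pompeiu[unfolded pompeiu_property_def, THEN spec, THEN mp, THEN mp], goal_cases)
    case 1
    show ?case by (intro continuous_intros)
  next
    case 2
    show ?case
    proof (intro allI impI)
    fix h :: "'a \<Rightarrow> 'a" assume "sphere_isometry h"
    then obtain g where g: "orthogonal_transformation g" "\<And>x. norm x = 1 \<Longrightarrow> g x = h x"
      using sphere_isometry_orthogonal by blast
    obtain g' where g': "orthogonal_transformation g'" "\<And>x. g' (g x) = x" "\<And>x. g (g' x) = x"
      using orthogonal_transformation_inv[OF g(1)] orthogonal_transformation_inj[OF g(1)]
        orthogonal_transformation_surj[OF g(1)] by (metis inv_f_f surj_f_inv_f)
    have lin: "linear g" "linear g'" using g g' orthogonal_transformation_linear by blast+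
    have gm: "g \<in> borel_measurable borel" "g' \<in> borel_measurable borel"
      using lin by (auto intro!: borel_measurable_continuous_onI linear_continuous_on simp: linear_conv_bounded_linear[symmetric])
    have sgn_g: "sgn (g x) = g (sgn x)" for x
      using orthogonal_transformation_norm[OF g(1), of x] linear_scale[OF lin(1)] by (simp add: sgn_div_norm)
    let ?Om = "h ` {x \<in> sphere 0 1. F x < s}"
    have Om: "?Om = {y \<in> sphere 0 1. f (g' y) < s}"
    proof (intro set_eqI iffI)
      fix y assume "y \<in> ?Om"
      then obtain x where x: "norm x = 1" "F x < s" "y = g x" using g(2) by auto
      then show "y \<in> {y \<in> sphere 0 1. f (g' y) < s}"
        using orthogonal_transformation_norm[OF g(1), of x] g' Ff by simp
    next
      fix y assume y: "y \<in> {y \<in> sphere 0 1. f (g' y) < s}"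
      then have n: "norm (g' y) = 1" using orthogonal_transformation_norm[OF g'(1), of y] by simp
      then have "y = h (g' y)" "F (g' y) < s" using g(2)[OF n] g'(3)[of y] y Ff[OF n] by auto
      then show "y \<in> ?Om" using n by auto
    qed
    define u where "u y = indicator ?Om y * (y \<bullet> p)" for y
    have um: "u \<in> borel_measurable borel"
    proof -
      have "{y. f (g' y) < s} \<in> sets borel"
        using measurable_compose[OF gm(2) f_borel] by (simp add: borel_measurable_iff_less)
      moreover have "?Om = sphere 0 1 \<inter> {y. f (g' y) < s}" unfolding Om by auto
      ultimately have "?Om \<in> sets borel" by (simp add: sets.Int)
      then show ?thesis unfolding u_def by simp
    qed
    have "(LINT x : ?Om | sphere_measure. x \<bullet> p) = (LINT x|sphere_measure. u x)"
      by (simp add: set_lebesgue_integral_def u_def)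
    also have "\<dots> = real DIM('a) * (LINT y|lborel. indicator (ball 0 1 - {0}) y * u (sgn y))"
      by (rule sphere_integral[OF um])
    also have "(LINT y|lborel. indicator (ball 0 1 - {0}) y * u (sgn y))
        = (LINT y|distr lborel borel g. indicator (ball 0 1 - {0}) y * u (sgn y))"
      by (simp add: lborel_distr_orthogonal[OF g(1)])
    also have "\<dots> = (LINT x|lborel. indicator (ball 0 1 - {0}) (g x) * u (sgn (g x)))"
    proof (rule integral_distr)
      show "g \<in> measurable lborel borel" using gm by simp
      have "(sgn :: 'a \<Rightarrow> 'a) \<in> borel_measurable borel" by (simp add: sgn_div_norm[abs_def])
      from measurable_compose[OF this um] show "(\<lambda>y. indicator (ball 0 1 - {0}) y * u (sgn y)) \<in> borel_measurable borel"
        by (intro borel_measurable_times borel_measurable_indicator) auto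
    qed
    also have "\<dots> = (LINT x|lborel. indicator (ball 0 1 - {0}) x * (indicator {..<s} (f x) * (sgn x \<bullet> g' p)))"
    proof (intro Bochner_Integration.integral_cong refl)
      fix x
      show "indicator (ball 0 1 - {0}) (g x) * u (sgn (g x))
          = indicator (ball 0 1 - {0}) x * (indicator {..<s} (f x) * (sgn x \<bullet> g' p))"
      proof (cases "x = 0")
        case True
        then show ?thesis using linear_0[OF lin(1)] by simp
      next
        case False
        have ng: "norm (g x) = norm x" by (rule orthogonal_transformation_norm[OF g(1)])
        have "g x \<noteq> 0" using ng False by (metis norm_eq_zero)
        then have ind: "indicator (ball 0 1 - {0}) (g x) = (indicator (ball 0 1 - {0}) x :: real)"
          using ng False by (simp add: indicator_def)
        have ns: "norm (g (sgn x)) = 1"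
          using orthogonal_transformation_norm[OF g(1), of "sgn x"] False by (simp add: norm_sgn)
        have "g (sgn x) \<bullet> p = g' (g (sgn x)) \<bullet> g' p"
          using g'(1) by (simp add: orthogonal_transformation_def)
        then have "u (sgn (g x)) = indicator {..<s} (f x) * (sgn x \<bullet> g' p)"
          unfolding u_def Om sgn_g using ns by (simp add: g'(2) f_sgn indicator_def)
        then show ?thesis by (simp add: ind)
      qed
    qed
    also have "\<dots> = 0" by (rule tube_moment_ball[OF null \<open>W b \<noteq> pi\<close>])
    finally show "(LINT x : h ` isoparametric_tube F a t | sphere_measure. x \<bullet> p) = 0"
      unfolding tube by simp
    qed
  qed
  then have "p \<bullet> p = 0" using p by simp
  then show False using p by simp
qed

end
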